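(* For all $\nu\in M_{\mathbb Q}$ (that is, for $\nu=\infty$ and for $\nu=p$ any prime) we have $\mathcal K_\nu=\{0\}\cup\mu_\infty$.
   Context: $M_{\mathbb Q}$ is the set of places of $\mathbb Q$, identified with $\{\infty\}\cup\{\text{primes}\}$. $\mu_\infty$ is the set of all roots of unity in $\overline{\mathbb Q}$. For $P\in\mathbb Z[X]\setminus\{0\}$ let $m(P)=\int_0^1\log|P(e^{2\pi i t})|\,dt$. For an algebraic number $\alpha$, its $\mathbb Z$-minimal polynomial is the unique irreducible $P=a_DX^D+\dots+a_0\in\mathbb Z[X]$ with $P(\alpha)=0$ and $a_D\ge1$; the absolute logarithmic Weil height is $h(\alpha)=m(P)/D$. A sequence $(\alpha_n)_{n\in\mathbb N}$ of algebraic numbers is called strict if for every $\alpha\in\overline{\mathbb Q}$ there are at most finitely many $n$ with $\alpha_n=\alpha$. Two algebraic numbers are conjugate if they have the same minimal polynomial over $\mathbb Q$. Definition of $\mathcal K_\infty$: here $\overline{\mathbb Q}\subseteq\mathbb C$. $\mathcal K_\infty$ is the set of all $\kappa\in\overline{\mathbb Q}$ with the following property: for every strict sequence $(\alpha_n)_{n\in\mathbb N}$ of algebraic numbers such that no $\alpha_n$ is a conjugate of $\kappa$ and $\lim_{n\to\infty}h(\alpha_n)=0$, one has $$\lim_{n\to\infty}\frac{1}{[\mathbb Q(\alpha_n):\mathbb Q]}\sum_{\sigma:\mathbb Q(\alpha_n)\to\mathbb C}\log|\sigma(\alpha_n)-\kappa|=\int_0^1\log|e^{2\pi i t}-\kappa|\,dt=\log\max\{1,|\kappa|\}.$$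 Definition of $\mathcal K_p$ for a prime $p$: here $\overline{\mathbb Q}\subseteq\overline{\mathbb Q_p}$ is the algebraic closure of $\mathbb Q$ in an algebraic closure of $\mathbb Q_p$, and $|\cdot|_p$ is the extension to $\overline{\mathbb Q_p}$ of the $p$-adic absolute value with $|p|_p=1/p$. $\mathcal K_p$ is the set of all $\kappa\in\overline{\mathbb Q}$ such that $$\lim_{\substack{h(\alpha)\to0\\ [\mathbb Q(\alpha):\mathbb Q]\to\infty}}\frac{1}{[\mathbb Q(\alpha):\mathbb Q]}\sum_{\sigma:\mathbb Q(\alpha)\to\overline{\mathbb Q_p}}\log|\sigma(\alpha)-\kappa|_p=\log\max\{1,|\kappa|_p\},$$ where $\alpha$ ranges over algebraic numbers that are not conjugate to $\kappa$. All sums run over all field embeddings $\sigma$. *)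

theory Defs
  imports
    "HOL-Analysis.Analysis"
    "HOL-Computational_Algebra.Computational_Algebra"
    "HOL-Library.FuncSet"
begin

section \<open>Minimal polynomials, number fields and embeddings\<close>

text \<open>
  Everything here is polymorphic in the ambient field of characteristic 0. The algebraic closure
  of the rationals inside that field is the set of its elements satisfying the library predicate
  \<^const>\<open>algebraic\<close>. The two instances of interest are \<^typ>\<open>complex\<close> and an algebraic closure
  of the field of \<open>p\<close>-adic numbers.
\<close>

definition int_min_poly :: "'a::field_char_0 \<Rightarrow> int poly" where
  "int_min_poly \<alpha> =
    (THE P. irreducible P \<and> poly (map_poly of_int P) \<alpha> = 0 \<and> lead_coeff P \<ge> 1)"

definition rat_min_poly :: "'a::field_char_0 \<Rightarrow> rat poly" where
  "rat_min_poly \<alpha> =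
    (THE P. irreducible P \<and> poly (map_poly of_rat P) \<alpha> = 0 \<and> lead_coeff P = 1)"

definition conjugate_over_Q :: "'a::field_char_0 \<Rightarrow> 'a \<Rightarrow> bool" where
  "conjugate_over_Q \<alpha> \<beta> \<longleftrightarrow> rat_min_poly \<alpha> = rat_min_poly \<beta>"

definition is_subfield :: "'a::field set \<Rightarrow> bool" where
  "is_subfield S \<longleftrightarrow> 0 \<in> S \<and> 1 \<in> S \<and>
    (\<forall>x\<in>S. \<forall>y\<in>S. x + y \<in> S \<and> x * y \<in> S) \<and> (\<forall>x\<in>S. - x \<in> S \<and> inverse x \<in> S)"

definition rat_adjoin :: "'a::field_char_0 \<Rightarrow> 'a set" where
  "rat_adjoin \<alpha> = \<Inter>{S. is_subfield S \<and> \<alpha> \<in> S}"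

lemma vector_space_of_rat: "vector_space (\<lambda>(q::rat) (x::'a::field_char_0). of_rat q * x)"
  by unfold_locales (simp_all add: algebra_simps of_rat_add of_rat_mult)

definition rat_adjoin_degree :: "'a::field_char_0 \<Rightarrow> nat" where
  "rat_adjoin_degree \<alpha> = vector_space.dim (\<lambda>q x. of_rat q * x) (rat_adjoin \<alpha>)"

text \<open>
  Field homomorphisms are total functions in HOL; restricting to \<^const>\<open>extensional\<close> functions
  makes each embedding of \<open>S\<close> occur exactly once.
\<close>

definition field_embeddings :: "'a::field set \<Rightarrow> ('a \<Rightarrow> 'b::field) set" where
  "field_embeddings S = {\<sigma> \<in> extensional S. \<sigma> 1 = 1 \<and>
    (\<forall>x\<in>S. \<forall>y\<in>S. \<sigma> (x + y) = \<sigma> x + \<sigma> y \<and> \<sigma> (x * y) = \<sigma> x * \<sigma> y)}"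

definition roots_of_unity :: "'a::field set" where
  "roots_of_unity = {z. \<exists>n>0. z ^ n = 1}"


section \<open>Height and logarithmic averages\<close>

definition log_mahler_measure :: "int poly \<Rightarrow> real" where
  "log_mahler_measure P =
    integral {0..1} (\<lambda>t. ln (cmod (poly (map_poly of_int P) (exp (2 * pi * \<i> * of_real t)))))"

definition weil_height :: "'a::field_char_0 \<Rightarrow> real" where
  "weil_height \<alpha> = log_mahler_measure (int_min_poly \<alpha>) / real (degree (int_min_poly \<alpha>))"

definition strict_seq :: "(nat \<Rightarrow> 'a::field_char_0) \<Rightarrow> bool" where
  "strict_seq \<alpha> \<longleftrightarrow> (\<forall>\<beta>. algebraic \<beta> \<longrightarrow> finite {n. \<alpha> n = \<beta>})"

definition log_average :: "('a \<Rightarrow> real) \<Rightarrow> 'a \<Rightarrow> 'a::field_char_0 \<Rightarrow> real" where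
  "log_average v \<kappa> \<alpha> =
    1 / real (rat_adjoin_degree \<alpha>) *
      (\<Sum>\<sigma> \<in> (field_embeddings (rat_adjoin \<alpha>) :: ('a \<Rightarrow> 'a) set). ln (v (\<sigma> \<alpha> - \<kappa>)))"


section \<open>The archimedean place\<close>

definition K_inf :: "complex set" where
  "K_inf = {\<kappa>. algebraic \<kappa> \<and>
    (\<forall>\<alpha>. (\<forall>n. algebraic (\<alpha> n)) \<and> strict_seq \<alpha> \<and> (\<forall>n. \<not> conjugate_over_Q (\<alpha> n) \<kappa>) \<and>
        (\<lambda>n. weil_height (\<alpha> n)) \<longlonglongrightarrow> 0 \<longrightarrow>
      (\<lambda>n. log_average cmod \<kappa> (\<alpha> n)) \<longlonglongrightarrow>
        integral {0..1} (\<lambda>t. ln (cmod (exp (2 * pi * \<i> * of_real t) - \<kappa>))) \<and>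
      integral {0..1} (\<lambda>t. ln (cmod (exp (2 * pi * \<i> * of_real t) - \<kappa>))) = ln (max 1 (cmod \<kappa>)))}"


section \<open>The finite places\<close>

definition padic_abs :: "nat \<Rightarrow> rat \<Rightarrow> real" where
  "padic_abs p q = (if q = 0 then 0 else
    (case quotient_of q of (a, b) \<Rightarrow>
      real p powi (int (multiplicity (int p) b) - int (multiplicity (int p) a))))"

text \<open>
  The type \<^typ>\<open>'k\<close> is an algebraic closure of its subfield \<open>Qp\<close>, and \<open>Qp\<close> is the completion of
  the rationals with respect to the \<open>p\<close>-adic absolute value. This determines \<open>'k\<close>, \<open>Qp\<close> and \<open>v\<close> up
  to isomorphism, and a model exists for every prime \<open>p\<close>.
\<close>

locale padic_closure =
  fixes p :: nat
    and Qp :: "'k::{alg_closed_field, field_char_0} set"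
    and v :: "'k \<Rightarrow> real"
  assumes prime_p: "prime p"
    and v_nonneg: "v x \<ge> 0"
    and v_eq_0_iff: "v x = 0 \<longleftrightarrow> x = 0"
    and v_mult: "v (x * y) = v x * v y"
    and v_ultrametric: "v (x + y) \<le> max (v x) (v y)"
    and v_of_rat: "v (of_rat q) = padic_abs p q"
    and subfield_Qp: "is_subfield Qp"
    and Rats_dense: "\<lbrakk>x \<in> Qp; \<epsilon> > 0\<rbrakk> \<Longrightarrow> \<exists>q. v (x - of_rat q) < \<epsilon>"
    and Qp_complete: "\<lbrakk>\<And>n. s n \<in> Qp; \<And>\<epsilon>. \<epsilon> > 0 \<Longrightarrow> \<exists>N. \<forall>m\<ge>N. \<forall>n\<ge>N. v (s m - s n) < \<epsilon>\<rbrakk>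
      \<Longrightarrow> \<exists>x\<in>Qp. (\<lambda>n. v (s n - x)) \<longlonglongrightarrow> 0"
    and algebraic_over_Qp: "\<exists>f. f \<noteq> 0 \<and> (\<forall>i. coeff f i \<in> Qp) \<and> poly f x = 0"

text \<open>
  The limit is taken along all \<open>\<alpha>\<close> with height tending to 0 (the value 0 is allowed) and degree
  tending to infinity.
\<close>

definition K_fin :: "('k::{alg_closed_field, field_char_0} \<Rightarrow> real) \<Rightarrow> 'k set" where
  "K_fin v = {\<kappa>. algebraic \<kappa> \<and>
    ((\<lambda>\<alpha>. log_average v \<kappa> \<alpha>) \<longlongrightarrow> ln (max 1 (v \<kappa>)))
      (inf (filtercomap weil_height (nhds 0))
        (inf (filtercomap rat_adjoin_degree at_top)
          (principal {\<alpha>. algebraic \<alpha> \<and> \<not> conjugate_over_Q \<alpha> \<kappa>})))}"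

end

theory Submission
  imports
    Defs
    "Subresultants.Subresultant"
    "HOL-Complex_Analysis.Complex_Analysis"
    "HOL-Real_Asymp.Real_Asymp"
begin

text \<open>
  \<^bold>\<open>Reduction to integer polynomials.\<close> Embeddings of \<open>\<rat>(\<alpha>)\<close> correspond to the roots of the minimal
  polynomial \<open>P\<close> of \<open>\<alpha>\<close>, so an average of \<open>ln \<bar>\<sigma>\<alpha> - \<kappa>\<bar>\<close> is \<open>(ln \<bar>P(\<kappa>)\<bar> - ln \<bar>a\<bar>) / D\<close>, where \<open>a\<close> is
  the leading coefficient and \<open>D\<close> the degree of \<open>P\<close>. The height of \<open>\<alpha>\<close> is \<open>ln M(P) / D\<close>, with the
  Mahler measure \<open>M(P)\<close>. Since only finitely many numbers have bounded height and degree, membership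
  of \<open>\<kappa>\<close> in either set says that \<open>\<bar>P(\<kappa>)\<bar> / \<bar>a\<bar>\<close> is \<open>max 1 \<bar>\<kappa>\<bar>\<^sup>D\<close> up to a factor \<open>exp (o(D))\<close> for
  irreducible \<open>P\<close> with \<open>D \<rightarrow> \<infinity>\<close> and \<open>ln M(P) = o(D)\<close>. This property is called \<open>equidistributes\<close>
  below and is studied for all places at once, in a locale \<open>field_abs_value\<close>.

  \<^bold>\<open>Zero and roots of unity.\<close> For \<open>\<kappa> = 0\<close> both \<open>P(0)\<close> and \<open>a\<close> are integers of size at most \<open>M(P)\<close>.
  For \<open>\<kappa>\<^sup>N = 1\<close> the product of \<open>P(\<zeta>)\<close> over all \<open>N\<close>-th roots of unity \<open>\<zeta>\<close> is a nonzero integer, the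
  resultant of \<open>X\<^sup>N - 1\<close> and \<open>P\<close>. A nonzero integer that is at most \<open>exp (o(D))\<close> in the usual sense is
  at least \<open>exp (- o(D))\<close> at every place, so upper bounds \<open>\<bar>P(\<zeta>)\<bar> \<le> exp (o(D))\<close> yield the matching
  lower bounds. At a prime the upper bound is the ultrametric inequality. Over the complex numbers it
  is \<open>circle_bound\<close>: join to the roots of \<open>P\<close> a further \<open>m \<approx> \<eta> D\<close> points on a small circle around a
  point \<open>z\<close> of the unit circle. The discriminant of all these points is bounded above by a Vandermonde
  determinant, the part that comes from the roots of \<open>P\<close> is bounded below because the discriminant
  of \<open>P\<close> is a nonzero integer, and the cross terms, which are thus bounded above, are at least
  \<open>\<bar>P(z)\<bar>\<^sup>2\<^sup>m\<close> up to a power of \<open>a\<close>, by the maximum principle.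

  \<^bold>\<open>All other numbers.\<close> Let \<open>\<kappa>\<close> be algebraic, neither zero nor a root of unity, with minimal
  polynomial \<open>Q\<close>. By Kronecker's theorem some power \<open>\<kappa>\<^sup>k\<close> is not a root of any nonzero polynomial with
  coefficients in \<open>{-1, 0, 1}\<close>, so the \<open>2\<^sup>m\<close> subsums of \<open>\<Sum>i<m. \<kappa>\<^sup>k\<^sup>i\<close> are distinct. The unit ball of the
  relevant field is covered by \<open>N\<^sup>r\<close> balls of radius \<open>\<theta>\<^sup>r\<close> for a fixed \<open>N\<close> and \<open>\<theta> < 1\<close>, and the
  pigeonhole principle gives polynomials \<open>R\<close> of degree at most \<open>n\<close> with coefficients in \<open>{-1, 0, 1}\<close>
  and \<open>0 < \<bar>R(\<kappa>)\<bar> \<le> exp (- c n) max 1 \<bar>\<kappa>\<bar>\<^sup>n\<close>. The polynomial \<open>P = R + (c X\<^sup>n + c') Q\<close> has the same value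
  at \<open>\<kappa>\<close>, and bounded integers \<open>c\<close> and \<open>c'\<close> can be chosen such that \<open>P\<close> has no irreducible factor
  of both small degree and small height. If \<open>\<kappa>\<close> had the equidistribution property, then the factors of
  degree \<open>D\<close> large and height small could not be exponentially smaller than \<open>max 1 \<bar>\<kappa>\<bar>\<^sup>D\<close> at \<open>\<kappa>\<close>, and
  the factors of large height are too few to matter by Liouville's inequality. Multiplying over the factors contradicts the
  bound for \<open>R(\<kappa>)\<close>.
\<close>

hide_const (open) Module.smult

section \<open>Resultants as products over roots\<close>

lemma split_over_proots:
  fixes p :: "'a::alg_closed_field poly"
  assumes "p \<noteq> 0"
  shows "p = smult (lead_coeff p) (\<Prod>x\<in>#proots p. [:- x, 1:])" and "size (proots p) = degree p"
proof -
  obtain A where A: "size A = degree p" "p = smult (lead_coeff p) (\<Prod>x\<in>#A. [:- x, 1:])"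
    using alg_closed_imp_factorization[OF assms] by blast
  have "proots p = proots (\<Prod>x\<in>#A. [:- x, 1:])"
    by (subst A(2)) (use assms in simp)
  also have "\<dots> = A"
  proof (induction A)
    case (add a A)
    have "(\<Prod>x\<in>#A. [:- x, 1:]) \<noteq> 0" by (auto simp: prod_mset_zero_iff)
    then have "proots ([:- a, 1:] * (\<Prod>x\<in>#A. [:- x, 1:])) = proots [:- a, 1:] + proots (\<Prod>x\<in>#A. [:- x, 1:])"
      by (intro proots_mult) auto
    moreover have "proots [:- a, 1:] = {#a#}"
      using proots_linear_factor[of "- a"] by simp
    ultimately show ?case using add by (simp del: mult_pCons_left)
  qed simp
  finally have "proots p = A" .
  then show "p = smult (lead_coeff p) (\<Prod>x\<in>#proots p. [:- x, 1:])" "size (proots p) = degree p"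
    using A by simp_all
qed

lemma poly_over_proots:
  fixes p :: "'a::alg_closed_field poly"
  assumes "p \<noteq> 0"
  shows "poly p z = lead_coeff p * (\<Prod>x\<in>#proots p. z - x)"
proof -
  have "poly p z = poly (smult (lead_coeff p) (\<Prod>x\<in>#proots p. [:- x, 1:])) z"
    using split_over_proots(1)[OF assms] by simp
  also have "\<dots> = lead_coeff p * (\<Prod>x\<in>#proots p. z - x)"
    by (simp add: poly_prod_mset image_mset.compositionality comp_def)
  finally show ?thesis .
qed

text \<open>
  This is the classical expression of the resultant through the roots of the first polynomial.
\<close>
definition root_product :: "'a::field poly \<Rightarrow> 'a poly \<Rightarrow> 'a" where
  "root_product F G = lead_coeff F ^ degree G * (\<Prod>x\<in>#proots F. poly G x)"

text \<open>
  Both sides are powers of the leading coefficients times the product of all differences between a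
  root of \<open>F\<close> and a root of \<open>G\<close>.
\<close>
lemma root_product_swap:
  fixes F G :: "'a::alg_closed_field poly"
  assumes "F \<noteq> 0" "G \<noteq> 0"
  shows "root_product F G = (-1) ^ (degree F * degree G) * root_product G F"
proof -
  have *: "(\<Prod>x\<in>#A. \<Prod>y\<in>#B. x - y) = (-1) ^ (size A * size B) * (\<Prod>y\<in>#B. \<Prod>x\<in>#A. y - x)"
    for A B :: "'a multiset"
  proof -
    have 1: "(\<Prod>y\<in>#B. y - x) = (-1) ^ size B * (\<Prod>y\<in>#B. x - y)" for x
      by (induction B) (auto simp: algebra_simps)
    have 2: "(\<Prod>y\<in>#B. \<Prod>x\<in>#A. y - x) = (\<Prod>x\<in>#A. \<Prod>y\<in>#B. y - x)"
      by (induction A) (simp_all add: prod_mset.distrib)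
    have 3: "((-1) ^ size B) ^ size A = ((-1) ^ (size A * size B) :: 'a)"
      by (metis mult.commute power_mult)
    show ?thesis unfolding 2 1 prod_mset.distrib
      by (simp add: 3 mult.assoc[symmetric])
  qed
  have a: "root_product F G = lead_coeff F ^ degree G * lead_coeff G ^ degree F * (\<Prod>x\<in>#proots F. \<Prod>y\<in>#proots G. x - y)"
    if "F \<noteq> 0" "G \<noteq> 0" for F G :: "'a poly"
    unfolding root_product_def poly_over_proots[OF that(2)]
    by (simp add: prod_mset.distrib split_over_proots(2)[OF that(1)])
  have sq: "(-1) ^ k * ((-1) ^ k * y) = y" for k and y :: 'a
    by (simp add: mult.assoc[symmetric])
  show ?thesis
    unfolding a[OF assms] a[OF assms(2,1)] *[of "proots F"]
      split_over_proots(2)[OF assms(1)] split_over_proots(2)[OF assms(2)]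
    by (simp add: mult_ac sq)
qed

text \<open>
  Both sides obey the same Euclidean recursion from \<open>(F, G)\<close> to \<open>(G, F mod G)\<close>, because \<open>F\<close> and
  \<open>F mod G\<close> agree at the roots of \<open>G\<close>.
\<close>
lemma resultant_eq_root_product:
  fixes F G :: "'a::alg_closed_field poly"
  assumes "F \<noteq> 0" "G \<noteq> 0"
  shows "resultant F G = root_product F G"
proof -
  have main: "resultant F G = root_product F G" if "degree G \<le> degree F" "F \<noteq> 0" "G \<noteq> 0"
    for F G :: "'a poly"
    using that
  proof (induction "degree G" arbitrary: F G rule: less_induct)
    case less
    show ?case
    proof (cases "degree G = 0")
      case True
      then obtain c where c: "G = [:c:]" by (rule degree_eq_zeroE)
      show ?thesis unfolding c using less.prems(2)
        by (simp add: root_product_def split_over_proots(2))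
    next
      case False
      define H where "H = F mod G"
      have eq: "F + (- (F div G)) * G = H" by (simp add: H_def minus_div_mult_eq_mod[symmetric])
      have dH: "degree H < degree G" using False less.prems(3)
        using degree_mod_less[of G F] less.prems(3) by (auto simp: H_def)
      have FH: "poly F y = poly H y" if "y \<in># proots G" for y
      proof -
        have "poly G y = 0" using that less.prems(3) by simp
        then show ?thesis by (simp flip: eq)
      qed
      have FHp: "(\<Prod>x\<in>#proots G. poly F x) = (\<Prod>x\<in>#proots G. poly H x)"
        by (rule arg_cong[of _ _ prod_mset], rule image_mset_cong) (rule FH)
      have res: "resultant F G = coeff (subresultant 0 F G) 0"
        by (simp add: subresultant_resultant)
      have swap: "root_product F G = (-1) ^ (degree F * degree G) * root_product G F"
        using less.prems by (intro root_product_swap) auto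
      show ?thesis
      proof (cases "degree H = 0")
        case True
        then obtain c where c: "H = [:c:]" by (rule degree_eq_zeroE)
        have "poly [:c:] = (\<lambda>_. c)" by (simp add: fun_eq_iff)
        then have cG: "c ^ degree G = (\<Prod>x\<in>#proots G. poly F x)" unfolding FHp c
          using split_over_proots(2)[OF less.prems(3)] by simp
        have "subresultant 0 F G = smult ((-1)^(degree F * degree G) * lead_coeff G ^ degree F
            * coeff H 0 ^ (degree G - 1)) H"
          using BT_eq_19[OF eq less.prems(1), of 0] dH True by simp
        then have "resultant F G = (-1)^(degree F * degree G) * lead_coeff G ^ degree F
            * (c ^ (degree G - 1) * c)"
          unfolding res by (simp add: c)
        also have "c ^ (degree G - 1) * c = c ^ degree G" using False by (cases "degree G") auto
        also note cG
        finally show ?thesis unfolding swap by (simp add: root_product_def)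
      next
        case False
        then have H0: "H \<noteq> 0" by auto
        have "subresultant 0 F G = smult ((-1)^(degree F * degree G) *
            lead_coeff G ^ (degree F - degree H)) (subresultant 0 G H)"
          using BT_lemma_1_12[OF eq less.prems(1), of 0] dH False by simp
        then have "resultant F G = (-1)^(degree F * degree G) *
            lead_coeff G ^ (degree F - degree H) * resultant G H"
          unfolding res by (simp add: subresultant_resultant)
        also have "resultant G H = root_product G H"
          using less.hyps[OF dH] dH less.prems H0 by simp
        finally have r: "resultant F G = (-1)^(degree F * degree G) *
            lead_coeff G ^ (degree F - degree H) * root_product G H" .
        have "lead_coeff G ^ degree F = lead_coeff G ^ (degree F - degree H) * lead_coeff G ^ degree H"
          using dH less.prems(1) by (subst power_add[symmetric]) simp
        then show ?thesis unfolding swap r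
          by (simp only: root_product_def FHp mult.assoc)
      qed
    qed
  qed
  show ?thesis
  proof (cases "degree G \<le> degree F")
    case True
    then show ?thesis using main assms by blast
  next
    case False
    then have "resultant G F = root_product G F" using main assms by simp
    then show ?thesis using root_product_swap[OF assms] resultant_swap[of F G] by simp
  qed
qed

text \<open>
  The integer on the left does not depend on the field in which the roots are taken. Comparing its
  usual size with its size at another place is the source of all lower bounds below.
\<close>
lemma int_resultant_root_product:
  fixes F G :: "int poly"
  assumes "F \<noteq> 0" "G \<noteq> 0"
  shows "(of_int (resultant F G) :: 'a::{alg_closed_field, field_char_0}) =
    of_int (lead_coeff F) ^ degree G * (\<Prod>x\<in>#proots (of_int_poly F). poly (of_int_poly G) x)"
proof -
  have "(of_int (resultant F G) :: 'a) = resultant (of_int_poly F) (of_int_poly G)"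
    by (rule of_int_hom.resultant_hom[symmetric])
  also have "\<dots> = root_product (of_int_poly F) (of_int_poly G)"
    using assms by (intro resultant_eq_root_product) auto
  finally show ?thesis by (simp add: root_product_def)
qed

section \<open>Minimal polynomials\<close>

abbreviation ipoly :: "int poly \<Rightarrow> 'a::field_char_0 \<Rightarrow> 'a" where
  "ipoly P \<equiv> poly (of_int_poly P)"

abbreviation rpoly :: "rat poly \<Rightarrow> 'a::field_char_0 \<Rightarrow> 'a" where
  "rpoly q \<equiv> poly (map_poly of_rat q)"

interpretation of_rat_poly_hom: map_poly_idom_hom of_rat ..

lemma rpoly_of_int_poly: "rpoly (of_int_poly P) x = ipoly P x"
  by (simp add: map_poly_map_poly comp_def)

lemma ex_primitive_minimal_poly:
  fixes x :: "'a::field_char_0"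
  assumes "algebraic x"
  shows "\<exists>G. content G = 1 \<and> lead_coeff G > 0 \<and> ipoly G x = 0 \<and>
    (\<forall>F. F \<noteq> 0 \<longrightarrow> ipoly F x = 0 \<longrightarrow> degree G \<le> degree F)"
proof -
  have "\<exists>F. F \<noteq> 0 \<and> ipoly F x = 0"
    using assms by (elim algebraicE') blast
  then obtain F0 where F0: "F0 \<noteq> 0 \<and> ipoly F0 x = 0" by blast
  obtain F where F: "F \<noteq> 0" "ipoly F x = 0"
    and min: "\<And>G. G \<noteq> 0 \<Longrightarrow> ipoly G x = 0 \<Longrightarrow> degree F \<le> degree G"
    using ex_has_least_nat[of "\<lambda>F. F \<noteq> 0 \<and> ipoly F x = 0", OF F0, of degree] by metis
  define P where "P = primitive_part F"
  have "F = smult (content F) P" by (simp add: P_def)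
  then have "ipoly F x = of_int (content F) * ipoly P x"
    by (metis of_int_hom.map_poly_hom_smult poly_smult)
  then have P: "ipoly P x = 0" "P \<noteq> 0" "content P = 1" "degree P = degree F"
    using F by (simp_all add: P_def content_primitive_part)
  define G where "G = smult (sgn (lead_coeff P)) P"
  have l: "lead_coeff P \<noteq> 0" using P(2) by simp
  then have s: "sgn (lead_coeff P) = 1 \<or> sgn (lead_coeff P) = -1"
    by (auto simp: sgn_if)
  have "content G = 1" using s P unfolding G_def content_smult by auto
  moreover have "lead_coeff G > 0"
  proof -
    have "lead_coeff G = \<bar>lead_coeff P\<bar>" unfolding G_def lead_coeff_smult by (simp add: sgn_mult_abs abs_sgn mult.commute)
    then show ?thesis using l by (simp only: zero_less_abs_iff) simp
  qed
  moreover have "ipoly G x = 0" using P by (simp add: G_def of_int_hom.map_poly_hom_smult)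
  moreover have "degree G = degree F" using P s by (auto simp: G_def)
  ultimately show ?thesis using min by (intro exI[of _ G]) simp
qed

text \<open>
  Pseudo-division leaves a remainder of smaller degree, which vanishes by minimality. The scalar
  factor that pseudo-division introduces is removed by multiplicativity of the content.
\<close>
lemma primitive_minimal_poly_dvd:
  fixes x :: "'a::field_char_0"
  assumes G: "content G = 1" "ipoly G x = 0"
    and min: "\<And>F. F \<noteq> 0 \<Longrightarrow> ipoly F x = 0 \<Longrightarrow> degree G \<le> degree F"
    and F: "ipoly F x = 0"
  shows "G dvd F"
proof -
  have G0: "G \<noteq> 0" using G by auto
  obtain q r where qr: "pseudo_divmod F G = (q, r)" by force
  define c where "c = lead_coeff G ^ (Suc (degree F) - degree G)"
  have c: "c \<noteq> 0" using G0 by (simp add: c_def)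
  have eq: "smult c F = G * q + r" and r: "r = 0 \<or> degree r < degree G"
    using pseudo_divmod[OF G0 qr] by (simp_all add: c_def)
  have "ipoly (smult c F) x = 0" using F by (simp add: of_int_hom.map_poly_hom_smult)
  then have "ipoly r x = 0" unfolding eq using G by (simp add: of_int_poly_hom.hom_add of_int_poly_hom.hom_mult)
  then have "r = 0" using min[of r] r by fastforce
  then have eq: "smult c F = G * q" using eq by simp
  have "content q = normalize c * content F"
    using arg_cong[OF eq, of content] G by (simp add: content_mult)
  then have "q = smult (normalize c * content F) (primitive_part q)"
    using content_times_primitive_part[of q] by simp
  also have "normalize c = c * unit_factor c" by (simp add: abs_sgn)
  finally have "smult c F = smult c (G * smult (unit_factor c * content F) (primitive_part q))"
    using eq by (metis mult.assoc mult_smult_right smult_smult)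
  then have "F = G * smult (unit_factor c * content F) (primitive_part q)" using c
    by (simp add: smult_cancel)
  then show ?thesis by (rule dvdI)
qed

text \<open>
  The definite description in \<open>int_min_poly\<close> is attained: a primitive polynomial of least degree with
  root \<open>x\<close> divides all others.
\<close>
lemma int_min_poly_characterization:
  fixes x :: "'a::field_char_0"
  assumes "algebraic x"
  defines "P \<equiv> int_min_poly x"
  shows int_min_poly_irreducible: "irreducible P"
    and int_min_poly_root: "ipoly P x = 0"
    and int_min_poly_lead: "lead_coeff P > 0"
    and int_min_poly_dvd: "ipoly F x = 0 \<Longrightarrow> P dvd F"
    and int_min_poly_eqI: "irreducible Q \<Longrightarrow> ipoly Q x = 0 \<Longrightarrow> lead_coeff Q > 0 \<Longrightarrow> P = Q"
    and int_min_poly_degree: "degree P > 0"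
proof -
  obtain G where G: "content G = 1" "lead_coeff G > 0" "ipoly G x = 0"
    "\<And>F. F \<noteq> 0 \<Longrightarrow> ipoly F x = 0 \<Longrightarrow> degree G \<le> degree F"
    using ex_primitive_minimal_poly[OF assms(1)] by blast
  have G0: "G \<noteq> 0" using G by auto
  have dG: "degree G > 0"
  proof (rule ccontr)
    assume "\<not> degree G > 0"
    then obtain c where "G = [:c:]" by (auto elim: degree_eq_zeroE)
    then show False using G0 G(3) by simp
  qed
  have dvd: "G dvd F" if "ipoly F x = 0" for F
    using primitive_minimal_poly_dvd[OF G(1,3,4) that] by simp
  have irr: "irreducible G"
  proof (rule irreducibleI)
    show "G \<noteq> 0" by fact
    show "\<not> is_unit G" using dG by (auto simp: is_unit_poly_iff)
    fix A B assume AB: "G = A * B"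
    have unit: "is_unit B" if "ipoly A x = 0" "G = A * B" for A B
    proof -
      have n0: "A \<noteq> 0" "B \<noteq> 0" using that G0 by auto
      then have "degree B = 0" using G(4)[OF n0(1) that(1)] that(2) by (simp add: degree_mult_eq)
      then obtain b where b: "B = [:b:]" by (rule degree_eq_zeroE)
      have "content B = 1" using G(1) that(2) by (simp add: content_prod_eq_1_iff)
      then have "is_unit b" unfolding b by (cases "b = 0") (auto simp: content_def)
      then show ?thesis unfolding b by (simp add: is_unit_const_poly_iff)
    qed
    have "ipoly A x * ipoly B x = 0" using G(3) unfolding AB by (simp add: of_int_poly_hom.hom_mult)
    then show "is_unit A \<or> is_unit B" using unit[of A B] unit[of B A] AB by (auto simp: mult.commute)
  qed
  have uniq: "Q = G" if Q: "irreducible Q" "ipoly Q x = 0" "lead_coeff Q > 0" for Q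
  proof -
    obtain B where B: "Q = G * B" using dvd[OF Q(2)] by (elim dvdE)
    have "\<not> is_unit G" using dG by (auto simp: is_unit_poly_iff)
    then have "is_unit B" using irreducibleD[OF Q(1) B] by blast
    then obtain b where b: "B = [:b:]" "is_unit b" by (auto simp: is_unit_poly_iff)
    have "lead_coeff Q = b * lead_coeff G" unfolding B b by (simp add: lead_coeff_smult)
    then have "b > 0" using Q(3) G(2) by (simp add: zero_less_mult_iff)
    then have "b = 1" using b(2) by auto
    then show ?thesis unfolding B b by simp
  qed
  have "P = G" unfolding P_def int_min_poly_def
  proof (rule the_equality)
    show "irreducible G \<and> ipoly G x = 0 \<and> 1 \<le> lead_coeff G" using irr G by simp
    show "Q = G" if "irreducible Q \<and> ipoly Q x = 0 \<and> 1 \<le> lead_coeff Q" for Q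
      using that by (intro uniq) auto
  qed
  then show "irreducible P" "ipoly P x = 0" "lead_coeff P > 0" "degree P > 0"
    using irr G(2,3) dG by simp_all
  show "ipoly F x = 0 \<Longrightarrow> P dvd F" unfolding \<open>P = G\<close> by (rule dvd)
  show "irreducible Q \<Longrightarrow> ipoly Q x = 0 \<Longrightarrow> lead_coeff Q > 0 \<Longrightarrow> P = Q"
    unfolding \<open>P = G\<close> by (rule uniq[symmetric])
qed

lemma algebraic_ipoly_root: "P \<noteq> 0 \<Longrightarrow> ipoly P x = 0 \<Longrightarrow> algebraic x"
  by (rule algebraicI[of "of_int_poly P"]) auto

lemma rat_poly_clear_denominators:
  "\<exists>c::int. c > 0 \<and> (\<exists>F. smult (of_int c) (q::rat poly) = of_int_poly F)"
proof (induction q)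
  case 0
  then show ?case by (intro exI[of _ 1]) (auto intro: exI[of _ 0])
next
  case (pCons a q)
  then obtain c F where cF: "c > 0" "smult (of_int c) q = of_int_poly F" by blast
  obtain n d where nd: "quotient_of a = (n, d)" by force
  then have d: "d > 0" "a = of_int n / of_int d"
    by (simp_all add: quotient_of_denom_pos quotient_of_div)
  have "smult (of_int (c * d)) (pCons a q) = of_int_poly (pCons (c * n) (smult d F))"
  proof -
    have "smult (of_int (c * d)) q = smult (of_int d) (smult (of_int c) q)"
      by (simp add: mult.commute)
    also have "\<dots> = of_int_poly (smult d F)" by (simp add: cF(2) of_int_hom.map_poly_hom_smult)
    finally have "smult (of_int (c * d)) q = of_int_poly (smult d F)" .
    moreover have "of_int (c * d) * a = of_int (c * n)" using d by simp
    ultimately show ?thesis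
      by (simp only: smult_pCons) (rule poly_eqI, simp add: coeff_pCons split: nat.split)
  qed
  moreover have "c * d > 0" using cF(1) d(1) by simp
  ultimately show ?case by blast
qed

lemma rat_root_degree_ge:
  fixes x :: "'a::field_char_0"
  assumes "algebraic x" "q \<noteq> 0" "rpoly q x = 0"
  shows "degree (int_min_poly x) \<le> degree q"
proof -
  obtain c F where c: "c > 0" "smult (of_int c) q = of_int_poly F"
    using rat_poly_clear_denominators[of q] by blast
  have "ipoly F x = rpoly (smult (of_int c) q) x" unfolding c(2) by (simp add: rpoly_of_int_poly)
  also have "\<dots> = 0" using assms by (simp add: of_rat_hom.map_poly_hom_smult)
  finally have dvd: "int_min_poly x dvd F" using int_min_poly_dvd[OF assms(1)] by simp
  have "F \<noteq> 0" using c assms(2) by auto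
  then have "degree (int_min_poly x) \<le> degree F" using dvd by (rule dvd_imp_degree_le[rotated])
  also have "degree F = degree q"
    using arg_cong[OF c(2), of degree] c(1) by simp
  finally show ?thesis .
qed

text \<open>
  Conjugacy is defined through the rational minimal polynomial, heights through the integral one.
\<close>
lemma rat_min_poly_eq:
  fixes x :: "'a::field_char_0"
  assumes "algebraic x"
  shows "rat_min_poly x = smult (1 / of_int (lead_coeff (int_min_poly x))) (of_int_poly (int_min_poly x))"
    (is "_ = ?q")
proof -
  define P where "P = int_min_poly x"
  note P = int_min_poly_characterization[OF assms, folded P_def]
  have q: "rpoly ?q x = 0" "monic ?q" "degree ?q = degree P" "?q \<noteq> 0"
    using P(2,3) by (auto simp: P_def[symmetric] of_rat_hom.map_poly_hom_smult rpoly_of_int_poly)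
  have deg: "degree P \<le> degree r" if "r \<noteq> 0" "rpoly r x = 0" for r
    using rat_root_degree_ge[OF assms that] by (simp add: P_def)
  have irr: "irreducible ?q"
  proof (rule irreducibleI)
    show "?q \<noteq> 0" by fact
    show "\<not> is_unit ?q" using P(6) q(3) by (auto simp: is_unit_poly_iff)
    fix A B assume AB: "?q = A * B"
    have unit: "is_unit B" if "rpoly A x = 0" "?q = A * B" for A B
    proof -
      have n0: "A \<noteq> 0" "B \<noteq> 0" using that q(4) by auto
      then have "degree B = 0" using deg[OF n0(1) that(1)] that(2) q(3) by (simp add: degree_mult_eq)
      then show ?thesis using n0(2) by (auto elim!: degree_eq_zeroE simp: is_unit_const_poly_iff)
    qed
    have "rpoly A x * rpoly B x = 0" using q(1) unfolding AB by (simp add: of_rat_poly_hom.hom_mult)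
    then show "is_unit A \<or> is_unit B" using unit[of A B] unit[of B A] AB by (auto simp: mult.commute)
  qed
  show ?thesis unfolding rat_min_poly_def
  proof (rule the_equality)
    show "irreducible ?q \<and> rpoly ?q x = 0 \<and> monic ?q" using irr q by blast
    fix r assume r: "irreducible r \<and> rpoly r x = 0 \<and> monic r"
    define Q where "Q = ?q"
    note q = q[folded Q_def]
    have "degree (r mod Q) < degree Q" using q(3,4) P(6) degree_mod_less[of Q r] by auto
    moreover have "rpoly (r mod Q) x = 0"
    proof -
      have "rpoly r x = rpoly (Q * (r div Q) + r mod Q) x" by simp
      also have "\<dots> = rpoly (r mod Q) x" using q(1)
        by (simp only: of_rat_poly_hom.hom_mult of_rat_poly_hom.hom_add poly_add poly_mult) simp
      finally show ?thesis using r by simp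
    qed
    ultimately have "r mod Q = 0" using deg[of "r mod Q"] q(3) by fastforce
    then obtain B where B: "r = Q * B" by (metis dvd_def mod_0_imp_dvd)
    have "\<not> is_unit Q" using P(6) q(3) by (auto simp: is_unit_poly_iff)
    then have "is_unit B" using irreducibleD[of r, OF _ B] r by blast
    then obtain b where b: "B = [:b:]" by (meson is_unit_poly_iff)
    have "lead_coeff r = b * lead_coeff Q" unfolding B b by (simp add: lead_coeff_smult)
    then have "b = 1" using q(2) r by (metis mult.right_neutral)
    then show "r = ?q" unfolding B b Q_def by simp
  qed
qed

lemma conjugate_over_Q_iff:
  fixes x y :: "'a::field_char_0"
  assumes "algebraic x" "algebraic y"
  shows "conjugate_over_Q x y \<longleftrightarrow> ipoly (int_min_poly x) y = 0"
proof
  assume "ipoly (int_min_poly x) y = 0"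
  then have "int_min_poly y = int_min_poly x" using int_min_poly_characterization[OF assms(1)]
    by (intro int_min_poly_eqI[OF assms(2)])
  then show "conjugate_over_Q x y" by (simp add: conjugate_over_Q_def rat_min_poly_eq assms)
next
  assume "conjugate_over_Q x y"
  then have "rat_min_poly x = rat_min_poly y" by (simp add: conjugate_over_Q_def)
  moreover have *: "rpoly (rat_min_poly z) w = 0 \<longleftrightarrow> ipoly (int_min_poly z) w = 0" if "algebraic z" for z w :: 'a
    using int_min_poly_lead[OF that]
    by (auto simp: rat_min_poly_eq[OF that] of_rat_hom.map_poly_hom_smult rpoly_of_int_poly)
  ultimately show "ipoly (int_min_poly x) y = 0"
    using *[OF assms(1), of y] *[OF assms(2), of y] int_min_poly_root[OF assms(2)] by simp
qed

lemma irreducible_int_poly_root: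
  fixes x :: "'a::field_char_0"
  assumes "irreducible P" "ipoly P x = 0" "lead_coeff P > 0"
  shows "algebraic x" "int_min_poly x = P"
proof -
  show "algebraic x" using assms by (intro algebraic_ipoly_root[of P]) auto
  then show "int_min_poly x = P" using assms by (rule int_min_poly_eqI)
qed

lemma irreducible_int_poly_dvd:
  fixes x :: "'a::field_char_0"
  assumes "irreducible P" "ipoly P x = 0" "lead_coeff P > 0" "ipoly F x = 0"
  shows "P dvd F"
  using irreducible_int_poly_root[OF assms(1-3)] assms(4) int_min_poly_dvd by metis

text \<open>
  The two roots may lie in different fields. This is how algebraic relations travel between the
  complex numbers and the other places.
\<close>
lemma irreducible_int_poly_root_transfer:
  fixes x :: "'a::field_char_0" and y :: "'b::field_char_0"
  assumes "irreducible P" "lead_coeff P > 0" "ipoly P x = 0" "ipoly F x = 0" "ipoly P y = 0"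
  shows "ipoly F y = 0"
  using irreducible_int_poly_dvd[OF assms(1,3,2,4)] assms(5)
  by (auto elim!: dvdE simp: of_int_poly_hom.hom_mult)

lemma irreducible_int_poly_pderiv_nonzero:
  fixes x :: "'a::field_char_0"
  assumes "irreducible P" "ipoly P x = 0" "lead_coeff P > 0"
  shows "ipoly (pderiv P) x \<noteq> 0"
proof
  assume 0: "ipoly (pderiv P) x = 0"
  have "degree P > 0" using irreducible_int_poly_root[OF assms] int_min_poly_degree by metis
  then have "pderiv P \<noteq> 0" "degree (pderiv P) < degree P"
    by (auto simp: pderiv_eq_0_iff degree_pderiv)
  moreover have "P dvd pderiv P" using irreducible_int_poly_dvd[OF assms 0] .
  ultimately show False using dvd_imp_degree_le[of P "pderiv P"] by simp
qed

text \<open>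
  Irreducible polynomials in characteristic 0 are separable, so sums over the multiset of roots are
  sums over the set of roots.
\<close>
lemma irreducible_int_poly_order:
  fixes x :: "'a::field_char_0"
  assumes "irreducible P" "ipoly P x = 0" "lead_coeff P > 0"
  shows "order x (of_int_poly P) = 1"
proof -
  have "poly (pderiv (of_int_poly P)) x \<noteq> 0"
    using irreducible_int_poly_pderiv_nonzero[OF assms] by (simp add: of_int_hom.map_poly_pderiv)
  moreover have "pderiv (of_int_poly P :: 'a poly) \<noteq> 0" using calculation by auto
  moreover have "of_int_poly P \<noteq> (0 :: 'a poly)" using assms(3) by auto
  ultimately show ?thesis using order_pderiv[of "of_int_poly P" x] assms(2)
    by (metis One_nat_def order_0I order_root)
qed

lemma proots_irreducible_int_poly:
  assumes "irreducible P" "lead_coeff P > 0"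
  shows "proots (of_int_poly P :: 'a::field_char_0 poly) = mset_set {x. ipoly P x = 0}"
proof (rule multiset_eqI)
  fix x :: 'a
  have P0: "of_int_poly P \<noteq> (0::'a poly)" using assms by auto
  then have fin: "finite {x::'a. ipoly P x = 0}" by (rule poly_roots_finite)
  show "count (proots (of_int_poly P)) x = count (mset_set {x. ipoly P x = 0}) x"
  proof (cases "ipoly P x = 0")
    case True
    then show ?thesis using irreducible_int_poly_order[OF assms(1) True assms(2)] fin P0 by simp
  next
    case False
    then show ?thesis using fin P0 by (simp add: order_0I)
  qed
qed

section \<open>The field generated by an algebraic number and its embeddings\<close>

lemma rat_min_poly_root:
  fixes x :: "'a::field_char_0"
  assumes "algebraic x"
  shows "rpoly (rat_min_poly x) y = 0 \<longleftrightarrow> ipoly (int_min_poly x) y = 0"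
  using int_min_poly_lead[OF assms]
  by (auto simp: rat_min_poly_eq[OF assms] of_rat_hom.map_poly_hom_smult rpoly_of_int_poly)

lemma rational_root_transfer:
  fixes x :: "'a::field_char_0" and y :: "'b::field_char_0"
  assumes "algebraic x" "rpoly q x = 0" "ipoly (int_min_poly x) y = 0"
  shows "rpoly q y = 0"
proof -
  obtain c F where c: "c > 0" "smult (of_int c) q = of_int_poly F"
    using rat_poly_clear_denominators[of q] by blast
  have eq: "ipoly F z = of_int c * rpoly q z" for z :: "'c::field_char_0"
  proof -
    have "ipoly F z = rpoly (smult (of_int c) q) z" unfolding c(2) by (simp add: rpoly_of_int_poly)
    then show ?thesis by (simp add: of_rat_hom.map_poly_hom_smult)
  qed
  have "int_min_poly x dvd F" using int_min_poly_dvd[OF assms(1), of F] eq[of x] assms(2) by simp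
  then obtain B where "F = int_min_poly x * B" by (elim dvdE)
  then have "ipoly F y = 0" using assms(3) by (simp add: of_int_poly_hom.hom_mult)
  then show ?thesis using eq[of y] c(1) by simp
qed

lemma is_subfield_of_rat:
  fixes S :: "'a::field_char_0 set"
  assumes "is_subfield S"
  shows "of_rat a \<in> S"
proof -
  note S = assms[unfolded is_subfield_def]
  have nat: "of_nat n \<in> S" for n
    by (induction n) (use S in auto)
  have int: "of_int n \<in> S" for n
    by (cases n) (use nat S in \<open>auto simp del: of_nat_Suc\<close>)
  obtain n d where nd: "quotient_of a = (n, d)" by force
  then have "a = of_int n / of_int d" by (rule quotient_of_div)
  then have "of_rat a = (of_int n * inverse (of_int d) :: 'a)"
    by (simp add: of_rat_divide flip: divide_inverse)
  then show ?thesis using int S by simp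
qed

lemma is_subfield_rpoly:
  fixes S :: "'a::field_char_0 set"
  assumes "is_subfield S" "x \<in> S"
  shows "rpoly g x \<in> S"
proof (induction g)
  case (pCons a g)
  have "of_rat a \<in> S" by (rule is_subfield_of_rat) fact
  then show ?case using pCons assms unfolding is_subfield_def
    by (simp add: of_rat_hom.map_poly_pCons_hom)
qed (use assms in \<open>simp add: is_subfield_def\<close>)

lemma rat_min_poly_at_generator:
  fixes x :: "'a::field_char_0"
  assumes "algebraic x"
  shows "rpoly (rat_min_poly x) x = 0" "degree (rat_min_poly x) = degree (int_min_poly x)"
    "rat_min_poly x \<noteq> 0"
proof -
  have "lead_coeff (int_min_poly x) \<noteq> 0" "int_min_poly x \<noteq> 0"
    using int_min_poly_lead[OF assms] by auto
  then show "rpoly (rat_min_poly x) x = 0" "degree (rat_min_poly x) = degree (int_min_poly x)"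
    "rat_min_poly x \<noteq> 0"
    unfolding rat_min_poly_root[OF assms] using int_min_poly_root[OF assms]
    by (simp_all add: rat_min_poly_eq[OF assms])
qed

text \<open>
  Division of the minimal polynomial \<open>q\<close> by \<open>g\<close> gives \<open>(q mod g)(x) = - g(x) (q div g)(x)\<close>, and the
  second factor is nonzero because its degree is too small. Hence \<open>g(x)\<close> can be inverted as soon as a
  value of a polynomial of smaller degree can be.
\<close>
lemma rpoly_inverse:
  fixes x :: "'a::field_char_0"
  assumes "algebraic x" "rpoly g x \<noteq> 0"
  shows "\<exists>u. rpoly u x * rpoly g x = 1"
proof -
  define q where "q = rat_min_poly x"
  have q: "rpoly q x = 0" "degree q = degree (int_min_poly x)" "q \<noteq> 0"
    unfolding q_def by (rule rat_min_poly_at_generator[OF assms(1)])+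
  have dm: "rpoly f x = rpoly h x * rpoly (f div h) x + rpoly (f mod h) x" for f h
  proof -
    have "rpoly f x = rpoly (h * (f div h) + f mod h) x" by simp
    then show ?thesis by (simp only: of_rat_poly_hom.hom_mult of_rat_poly_hom.hom_add poly_add poly_mult)
  qed
  have low: "\<exists>u. rpoly u x * rpoly g x = 1" if "degree g < degree q" "rpoly g x \<noteq> 0" for g
    using that
  proof (induction "degree g" arbitrary: g rule: less_induct)
    case less
    show ?case
    proof (cases "degree g = 0")
      case True
      then obtain c where c: "g = [:c:]" by (rule degree_eq_zeroE)
      with less.prems have "c \<noteq> 0" by auto
      then have "rpoly [:inverse c:] x * rpoly g x = 1"
        by (simp add: c of_rat_inverse)
      then show ?thesis by blast
    next
      case False
      define h where "h = q div g"
      have g0: "g \<noteq> 0" using False by auto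
      have deg: "degree (q mod g) < degree g" using degree_mod_less[OF g0, of q] False by auto
      have gh: "g * h = q - q mod g" by (simp add: h_def minus_mod_eq_mult_div)
      have h: "h \<noteq> 0"
      proof
        assume "h = 0"
        then have "degree q < degree g" using gh deg by simp
        then show False using less.prems(1) by simp
      qed
      have "degree (g * h) \<le> degree q" unfolding gh using deg less.prems(1) by (intro degree_diff_le) auto
      then have "degree h < degree q" using False h g0 by (simp add: degree_mult_eq)
      with h have h0: "rpoly h x \<noteq> 0"
        using rat_root_degree_ge[OF assms(1), of h] q(2) by auto
      have r: "rpoly (q mod g) x = - (rpoly g x * rpoly h x)"
        using dm[of q g] q(1) by (simp add: h_def eq_neg_iff_add_eq_0 add.commute)
      obtain u where "rpoly u x * rpoly (q mod g) x = 1"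
        using less.hyps[OF deg] deg less.prems h0 r by auto
      then have "rpoly (- u * h) x * rpoly g x = 1" unfolding r
        by (simp add: of_rat_poly_hom.hom_mult of_rat_poly_hom.hom_uminus algebra_simps)
      then show ?thesis by blast
    qed
  qed
  have "rpoly g x = rpoly (g mod q) x" using dm[of g q] q(1) by simp
  moreover have "degree (g mod q) < degree q"
    using degree_mod_less[OF q(3), of g] q(2) int_min_poly_degree[OF assms(1)] by auto
  ultimately show ?thesis using low[of "g mod q"] assms(2) by simp
qed

lemma rat_adjoin_eq:
  fixes x :: "'a::field_char_0"
  assumes "algebraic x"
  shows "rat_adjoin x = range (\<lambda>g. rpoly g x)"
proof
  have "is_subfield (range (\<lambda>g. rpoly g x))" unfolding is_subfield_def
  proof (intro conjI ballI)
    show "0 \<in> range (\<lambda>g. rpoly g x)" by (rule range_eqI[of _ _ 0]) simp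
    show "1 \<in> range (\<lambda>g. rpoly g x)" by (rule range_eqI[of _ _ 1]) simp
    fix y assume "y \<in> range (\<lambda>g. rpoly g x)"
    then obtain g where g: "y = rpoly g x" by blast
    show "- y \<in> range (\<lambda>g. rpoly g x)" unfolding g
      by (rule range_eqI[of _ _ "- g"]) (simp add: of_rat_poly_hom.hom_uminus)
    show "inverse y \<in> range (\<lambda>g. rpoly g x)"
    proof (cases "y = 0")
      case True
      then show ?thesis by (intro range_eqI[of _ _ 0]) simp
    next
      case False
      obtain u where "rpoly u x * y = 1" using rpoly_inverse[OF assms, of g] False g by auto
      then have "inverse y = rpoly u x" using False by (simp add: field_simps)
      then show ?thesis by blast
    qed
    fix z assume "z \<in> range (\<lambda>g. rpoly g x)"
    then obtain h where h: "z = rpoly h x" by blast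
    show "y + z \<in> range (\<lambda>g. rpoly g x)" unfolding g h
      by (rule range_eqI[of _ _ "g + h"]) (simp add: of_rat_poly_hom.hom_add)
    show "y * z \<in> range (\<lambda>g. rpoly g x)" unfolding g h
      by (rule range_eqI[of _ _ "g * h"]) (simp add: of_rat_poly_hom.hom_mult)
  qed
  moreover have "x \<in> range (\<lambda>g. rpoly g x)"
    by (rule range_eqI[of _ _ "[:0, 1:]"]) (simp add: of_rat_hom.map_poly_pCons_hom)
  ultimately show "rat_adjoin x \<subseteq> range (\<lambda>g. rpoly g x)" unfolding rat_adjoin_def by blast
  show "range (\<lambda>g. rpoly g x) \<subseteq> rat_adjoin x" unfolding rat_adjoin_def
    using is_subfield_rpoly by blast
qed

lemma is_subfield_rat_adjoin: "is_subfield (rat_adjoin x)"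
  unfolding rat_adjoin_def is_subfield_def by blast

lemma generator_in_rat_adjoin: "x \<in> rat_adjoin x"
  unfolding rat_adjoin_def by blast

lemma rpoly_eq_sum_lessThan:
  assumes "degree g < n"
  shows "rpoly g x = (\<Sum>i<n. of_rat (coeff g i) * x ^ i)"
proof -
  have "rpoly g x = (\<Sum>i\<le>degree g. of_rat (coeff g i) * x ^ i)"
    by (simp add: poly_altdef)
  also have "\<dots> = (\<Sum>i<n. of_rat (coeff g i) * x ^ i)"
    using assms by (intro sum.mono_neutral_left) (auto simp: coeff_eq_0)
  finally show ?thesis .
qed

interpretation rat_vs: vector_space "\<lambda>(q::rat) (y::'a::field_char_0). of_rat q * y"
  by (rule vector_space_of_rat)

lemma rat_adjoin_subset_span_powers:
  fixes x :: "'a::field_char_0"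
  assumes "algebraic x"
  shows "rat_adjoin x \<subseteq> rat_vs.span ((\<lambda>i. x ^ i) ` {..<degree (int_min_poly x)})"
proof
  fix y assume "y \<in> rat_adjoin x"
  then obtain g where g: "y = rpoly g x" unfolding rat_adjoin_eq[OF assms] by blast
  define q where "q = rat_min_poly x"
  have q: "rpoly q x = 0" "degree q = degree (int_min_poly x)" "q \<noteq> 0"
    unfolding q_def by (rule rat_min_poly_at_generator[OF assms])+
  have "y = rpoly (q * (g div q) + g mod q) x" using g by simp
  also have "\<dots> = rpoly (g mod q) x" using q(1)
    by (simp only: of_rat_poly_hom.hom_mult of_rat_poly_hom.hom_add poly_add poly_mult) simp
  also have "\<dots> = (\<Sum>i<degree (int_min_poly x). of_rat (coeff (g mod q) i) * x ^ i)"
    using degree_mod_less[OF q(3), of g] q(2) int_min_poly_degree[OF assms]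
    by (intro rpoly_eq_sum_lessThan) auto
  also have "\<dots> \<in> rat_vs.span ((\<lambda>i. x ^ i) ` {..<degree (int_min_poly x)})"
    by (intro rat_vs.span_sum rat_vs.span_scale rat_vs.span_base) auto
  finally show "y \<in> rat_vs.span ((\<lambda>i. x ^ i) ` {..<degree (int_min_poly x)})" .
qed

lemma rat_adjoin_degree_eq:
  fixes x :: "'a::field_char_0"
  assumes "algebraic x"
  shows "rat_adjoin_degree x = degree (int_min_poly x)"
proof -
  define n where "n = degree (int_min_poly x)"
  have n0: "n > 0" using int_min_poly_degree[OF assms] by (simp add: n_def)
  define B where "B = (\<lambda>i. x ^ i) ` {..<n}"
  have zero: "g = 0" if "rpoly g x = 0" "degree g < n" for g
    using rat_root_degree_ge[OF assms, of g] that by (auto simp: n_def)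
  have inj: "inj_on (\<lambda>i. x ^ i) {..<n}"
  proof (rule inj_onI)
    fix i j assume ij: "i \<in> {..<n}" "j \<in> {..<n}" "x ^ i = x ^ j"
    have "monom 1 i - monom 1 j = (0 :: rat poly)"
    proof (rule zero)
      show "rpoly (monom 1 i - monom 1 j) x = 0"
        using ij by (simp add: of_rat_poly_hom.hom_minus poly_monom map_poly_monom)
      show "degree (monom 1 i - monom 1 j :: rat poly) < n"
        using ij by (intro degree_diff_less) (auto simp: degree_monom_eq)
    qed
    then show "i = j" by (metis eq_iff_diff_eq_0 monom_eq_iff' one_neq_zero)
  qed
  have card: "card B = n" unfolding B_def using inj by (simp add: card_image)
  have indep: "rat_vs.independent B"
  proof (rule rat_vs.independent_if_scalars_zero)
    show "finite B" by (simp add: B_def)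
    fix f y assume sum: "(\<Sum>y\<in>B. of_rat (f y) * y) = 0" and y: "y \<in> B"
    define g where "g = (\<Sum>i<n. monom (f (x ^ i)) i)"
    have cg: "coeff g i = f (x ^ i)" if "i < n" for i
      using that by (simp add: g_def coeff_sum if_distrib cong: if_cong)
    have dg: "degree g < n" unfolding g_def using n0
      by (intro degree_sum_less) (auto intro: le_less_trans[OF degree_monom_le])
    have "rpoly g x = (\<Sum>i<n. of_rat (f (x ^ i)) * x ^ i)"
      unfolding rpoly_eq_sum_lessThan[OF dg] using cg by simp
    also have "\<dots> = (\<Sum>y\<in>B. of_rat (f y) * y)"
      unfolding B_def by (subst sum.reindex[OF inj]) simp
    finally have "g = 0" using zero dg sum by simp
    then show "f y = 0" using y cg by (auto simp: B_def)
  qed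
  have "rat_adjoin x \<subseteq> rat_vs.span B"
    unfolding B_def n_def by (rule rat_adjoin_subset_span_powers[OF assms])
  moreover have "B \<subseteq> rat_adjoin x"
  proof -
    have "x ^ i \<in> rat_adjoin x" for i
      using is_subfield_rat_adjoin[of x] generator_in_rat_adjoin[of x]
      by (induction i) (auto simp: is_subfield_def)
    then show ?thesis by (auto simp: B_def)
  qed
  ultimately have "rat_vs.dim (rat_adjoin x) = n" using rat_vs.dim_unique[OF _ _ indep card] by blast
  then show ?thesis by (simp add: rat_adjoin_degree_def n_def)
qed

text \<open>
  Additivity and multiplicativity force an embedding to fix the rational numbers.
\<close>
lemma field_embedding_rpoly:
  fixes S :: "'a::field_char_0 set" and \<sigma> :: "'a \<Rightarrow> 'b::field_char_0"
  assumes S: "is_subfield S" and \<sigma>: "\<sigma> \<in> field_embeddings S" and x: "x \<in> S"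
  shows "\<sigma> (rpoly g x) = rpoly g (\<sigma> x)"
proof -
  note S' = S[unfolded is_subfield_def]
  have 1: "\<sigma> 1 = 1" and add: "\<And>y z. y \<in> S \<Longrightarrow> z \<in> S \<Longrightarrow> \<sigma> (y + z) = \<sigma> y + \<sigma> z"
    and mult: "\<And>y z. y \<in> S \<Longrightarrow> z \<in> S \<Longrightarrow> \<sigma> (y * z) = \<sigma> y * \<sigma> z"
    using \<sigma> by (auto simp: field_embeddings_def)
  have 0: "\<sigma> 0 = 0" using add[of 0 0] S' by simp
  have mem: "of_rat a \<in> S" for a by (rule is_subfield_of_rat) fact
  have int: "of_int n \<in> S" for n using mem[of "of_int n"] by simp
  have nat: "of_nat n \<in> S" for n using int[of "int n"] by simp
  have nat_eq: "\<sigma> (of_nat n) = of_nat n" for n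
    by (induction n) (use 0 1 add nat S' in auto)
  have int_eq: "\<sigma> (of_int n) = of_int n" for n
  proof (cases n)
    case (nonneg m)
    then show ?thesis using nat_eq by simp
  next
    case (neg m)
    then have "of_int n + of_nat (Suc m) = (0::'a)" by simp
    then have "\<sigma> (of_int n) + \<sigma> (of_nat (Suc m)) = 0"
      using add[OF int nat, of n "Suc m"] 0 by simp
    then have "\<sigma> (of_int n) = - of_nat (Suc m)" unfolding nat_eq by (simp only: eq_neg_iff_add_eq_0)
    then show ?thesis using neg by simp
  qed
  have rat_eq: "\<sigma> (of_rat a) = of_rat a" for a
  proof -
    obtain n d where nd: "quotient_of a = (n, d)" by force
    then have a: "a = of_int n / of_int d" and d: "d > 0"
      by (simp_all add: quotient_of_div quotient_of_denom_pos)
    have "of_rat a * of_int d = (of_int n :: 'a)" using d by (simp add: a of_rat_divide)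
    then have "\<sigma> (of_rat a) * of_int d = of_int n"
      using mult[OF mem int, of a d] int_eq by simp
    then show ?thesis using d by (simp add: a of_rat_divide field_simps)
  qed
  show ?thesis
  proof (induction g)
    case (pCons a g)
    have "rpoly g x \<in> S" using S x by (rule is_subfield_rpoly)
    then show ?case using pCons add mult rat_eq mem x S'
      by (simp add: of_rat_hom.map_poly_pCons_hom)
  qed (simp add: 0)
qed

text \<open>
  An embedding is determined by the image of the generator. Conversely every root defines one, as
  rational relations that hold at \<open>x\<close> hold at every root of its minimal polynomial.
\<close>
lemma bij_betw_field_embeddings_roots:
  fixes x :: "'a::field_char_0"
  assumes "algebraic x"
  shows "bij_betw (\<lambda>\<sigma>. \<sigma> x) (field_embeddings (rat_adjoin x)) {y::'b::field_char_0. ipoly (int_min_poly x) y = 0}"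
proof (rule bij_betwI')
  let ?S = "rat_adjoin x"
  fix \<sigma> \<tau> :: "'a \<Rightarrow> 'b"
  assume st: "\<sigma> \<in> field_embeddings ?S" "\<tau> \<in> field_embeddings ?S"
  show "(\<sigma> x = \<tau> x) \<longleftrightarrow> (\<sigma> = \<tau>)"
  proof
    assume eq: "\<sigma> x = \<tau> x"
    have "\<sigma> y = \<tau> y" if y: "y \<in> ?S" for y
    proof -
      obtain g where g: "y = rpoly g x" using y unfolding rat_adjoin_eq[OF assms] by blast
      show ?thesis unfolding g
        using st[THEN field_embedding_rpoly[OF is_subfield_rat_adjoin _ generator_in_rat_adjoin]] eq by simp
    qed
    then show "\<sigma> = \<tau>" using st by (auto simp: field_embeddings_def intro: extensionalityI)
  qed simp
next
  fix \<sigma> :: "'a \<Rightarrow> 'b" assume s: "\<sigma> \<in> field_embeddings (rat_adjoin x)"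
  have z: "\<sigma> 0 = 0" using field_embedding_rpoly[OF is_subfield_rat_adjoin s generator_in_rat_adjoin, of 0] by simp
  have "\<sigma> (rpoly (of_int_poly (int_min_poly x)) x) = rpoly (of_int_poly (int_min_poly x)) (\<sigma> x)"
    by (rule field_embedding_rpoly[OF is_subfield_rat_adjoin s generator_in_rat_adjoin])
  then show "\<sigma> x \<in> {y. ipoly (int_min_poly x) y = 0}"
    using z int_min_poly_root[OF assms] by (simp add: rpoly_of_int_poly)
next
  fix y :: 'b assume "y \<in> {y. ipoly (int_min_poly x) y = 0}"
  then have y: "ipoly (int_min_poly x) y = 0" by simp
  have wd: "rpoly g y = rpoly h y" if "rpoly g x = rpoly h x" for g h
    using rational_root_transfer[OF assms, of "g - h" y] that y by (simp add: of_rat_poly_hom.hom_minus)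
  define \<sigma> where "\<sigma> = restrict (\<lambda>z. rpoly (SOME g. rpoly g x = z) y) (rat_adjoin x)"
  have \<sigma>: "\<sigma> (rpoly g x) = rpoly g y" for g
    using wd[of "SOME g'. rpoly g' x = rpoly g x" g] someI[of "\<lambda>g'. rpoly g' x = rpoly g x" g]
    by (auto simp: \<sigma>_def rat_adjoin_eq[OF assms])
  have "\<sigma> x = y" using \<sigma>[of "[:0, 1:]"] by (simp add: of_rat_hom.map_poly_pCons_hom)
  moreover have "\<sigma> \<in> field_embeddings (rat_adjoin x)"
  proof -
    have "\<sigma> 1 = 1" using \<sigma>[of 1] by simp
    moreover have "\<sigma> (z + w) = \<sigma> z + \<sigma> w \<and> \<sigma> (z * w) = \<sigma> z * \<sigma> w"
      if zw: "z \<in> rat_adjoin x" "w \<in> rat_adjoin x" for z w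
    proof -
      obtain g h where gh: "z = rpoly g x" "w = rpoly h x" using zw unfolding rat_adjoin_eq[OF assms] by blast
      have "\<sigma> (rpoly (g + h) x) = rpoly (g + h) y" "\<sigma> (rpoly (g * h) x) = rpoly (g * h) y" by (rule \<sigma>)+
      then show ?thesis unfolding gh
        by (simp add: \<sigma> of_rat_poly_hom.hom_add of_rat_poly_hom.hom_mult)
    qed
    ultimately show ?thesis by (auto simp: field_embeddings_def \<sigma>_def)
  qed
  ultimately show "\<exists>\<sigma>\<in>field_embeddings (rat_adjoin x). y = \<sigma> x" by blast
qed

section \<open>Absolute values\<close>

text \<open>
  Archimedean and finite places are treated together. The last assumption is all the arithmetic that
  is needed: a nonzero integer has absolute value at least 1 at the archimedean place, and at a prime
  \<open>p\<close> it is divisible by the power of \<open>p\<close> that its absolute value inverts.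
\<close>
locale field_abs_value =
  fixes v :: "'a::{alg_closed_field, field_char_0} \<Rightarrow> real"
  assumes nonneg: "v x \<ge> 0"
    and eq_0_iff [simp]: "v x = 0 \<longleftrightarrow> x = 0"
    and mult: "v (x * y) = v x * v y"
    and triangle: "v (x + y) \<le> v x + v y"
    and int_lower: "n \<noteq> 0 \<Longrightarrow> 1 / real_of_int \<bar>n\<bar> \<le> v (of_int n)"
begin

lemma zero [simp]: "v 0 = 0"
  by simp

lemma pos: "x \<noteq> 0 \<Longrightarrow> v x > 0"
  using nonneg[of x] eq_0_iff[of x] by linarith

lemma one [simp]: "v 1 = 1"
  using mult[of 1 1] eq_0_iff[of 1] by simp

lemma minus [simp]: "v (- x) = v x"
proof -
  have "v (- 1) * v (- 1) = 1" using mult[of "- 1" "- 1"] by simp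
  then have "v (- 1) = 1" using nonneg[of "- 1"] by (simp add: square_eq_1_iff)
  then show ?thesis using mult[of "- 1" x] by simp
qed

lemma power [simp]: "v (x ^ n) = v x ^ n"
  by (induction n) (simp_all add: mult)

lemma inverse [simp]: "v (inverse x) = inverse (v x)"
proof (cases "x = 0")
  case False
  then have "v x * v (inverse x) = 1" using mult[of x "inverse x"] by simp
  then show ?thesis using False by (simp add: field_simps)
qed simp

lemma divide: "v (x / y) = v x / v y"
  by (simp add: divide_inverse mult)

lemma prod_mset: "v (\<Prod>x\<in>#A. f x) = (\<Prod>x\<in>#A. v (f x))"
  by (induction A) (simp_all add: mult)

lemma sum_le: "finite A \<Longrightarrow> v (\<Sum>x\<in>A. f x) \<le> (\<Sum>x\<in>A. v (f x))"
proof (induction A rule: finite_induct)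
  case empty
  then show ?case by simp
next
  case (insert x A)
  then show ?case using triangle[of "f x" "\<Sum>x\<in>A. f x"] by simp
qed

lemma int_upper: "v (of_int n) \<le> real_of_int \<bar>n\<bar>"
proof -
  have nat: "v (of_nat n) \<le> real n" for n
  proof (induction n)
    case 0
    show ?case by simp
  next
    case (Suc n)
    then show ?case using triangle[of 1 "of_nat n"] by simp
  qed
  show ?thesis
  proof (cases n)
    case (nonneg m)
    then show ?thesis using nat[of m] by simp
  next
    case (neg m)
    then have "v (of_int n) = v (of_nat (Suc m))" by (metis minus of_int_minus of_int_of_nat_eq)
    then show ?thesis using nat[of "Suc m"] neg by simp
  qed
qed

lemma log_average_eq:
  fixes x \<kappa> :: 'a
  defines "P \<equiv> int_min_poly x"
  assumes x: "algebraic x" and \<kappa>: "ipoly P \<kappa> \<noteq> 0"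
  shows "log_average v \<kappa> x = (ln (v (ipoly P \<kappa>)) - ln (v (of_int (lead_coeff P)))) / real (degree P)"
proof -
  note P = int_min_poly_characterization[OF x, folded P_def]
  let ?R = "{y::'a. ipoly P y = 0}"
  have P0: "of_int_poly P \<noteq> (0 :: 'a poly)" using P(3) by auto
  have fin: "finite ?R" using P0 by (rule poly_roots_finite)
  have ne: "v (y - \<kappa>) \<noteq> 0" if "y \<in> ?R" for y using that \<kappa> by auto
  have "(\<Sum>\<sigma>\<in>field_embeddings (rat_adjoin x). ln (v (\<sigma> x - \<kappa>))) = (\<Sum>y\<in>?R. ln (v (y - \<kappa>)))"
    using bij_betw_field_embeddings_roots[OF x, where 'b = 'a]
    by (intro sum.reindex_bij_betw) (simp add: P_def)
  also have "\<dots> = ln (\<Prod>y\<in>?R. v (y - \<kappa>))"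
    using fin ne nonneg by (subst ln_prod) (auto simp: less_le)
  also have "(\<Prod>y\<in>?R. v (y - \<kappa>)) = v (\<Prod>y\<in>#mset_set ?R. \<kappa> - y)"
    unfolding prod_mset prod_unfold_prod_mset using minus by (metis minus_diff_eq)
  also have "mset_set ?R = proots (of_int_poly P)"
    by (rule proots_irreducible_int_poly[OF P(1,3), symmetric])
  finally have s: "(\<Sum>\<sigma>\<in>field_embeddings (rat_adjoin x). ln (v (\<sigma> x - \<kappa>))) =
    ln (v (\<Prod>y\<in>#proots (of_int_poly P). \<kappa> - y))" .
  have ev: "ipoly P \<kappa> = of_int (lead_coeff P) * (\<Prod>y\<in>#proots (of_int_poly P). \<kappa> - y)"
    using poly_over_proots[OF P0, of \<kappa>] by simp
  have "v (of_int (lead_coeff P)) > 0" using P(3) by (intro pos) auto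
  moreover have "v (\<Prod>y\<in>#proots (of_int_poly P). \<kappa> - y) > 0" using \<kappa> ev by (intro pos) auto
  ultimately have "ln (v (ipoly P \<kappa>)) = ln (v (of_int (lead_coeff P))) +
      ln (v (\<Prod>y\<in>#proots (of_int_poly P). \<kappa> - y))"
    unfolding ev mult by (rule ln_mult_pos)
  then show ?thesis unfolding log_average_def s rat_adjoin_degree_eq[OF x] P_def[symmetric]
    by (simp add: P_def)
qed

end


section \<open>Jensen's formula and the Mahler measure\<close>

definition unit_circle :: "real \<Rightarrow> complex" where
  "unit_circle t = exp (2 * pi * \<i> * of_real t)"

lemma norm_unit_circle: "cmod (unit_circle t) = 1"
  by (simp add: unit_circle_def norm_exp_eq_Re)

text \<open>
  This is the mean value property at the centre of the disc for the holomorphic function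
  \<open>Ln (1 - u z)\<close>.
\<close>
lemma jensen_disc:
  assumes "cmod u < 1"
  shows "((\<lambda>t. ln (cmod (1 - u * unit_circle t))) has_integral 0) {0..1}"
proof -
  define f where "f = (\<lambda>z. Ln (1 - u * z))"
  have pos: "Re (1 - u * z) > 0" if "cmod z \<le> 1" for z
  proof -
    have "Re (u * z) \<le> cmod (u * z)" by (rule complex_Re_le_cmod)
    also have "\<dots> \<le> cmod u * 1" unfolding norm_mult using that by (intro mult_left_mono) auto
    finally show ?thesis using assms by simp
  qed
  have "f holomorphic_on cball 0 1" unfolding f_def
  proof (intro holomorphic_on_Ln' holomorphic_intros)
    fix z assume "z \<in> cball (0::complex) 1"
    then show "1 - u * z \<notin> \<real>\<^sub>\<le>\<^sub>0" using pos[of z] by (auto simp: complex_nonpos_Reals_iff)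
  qed
  then have "((\<lambda>z. f z / (z - 0)) has_contour_integral (2 * of_real pi * \<i> * f 0)) (circlepath 0 1)"
    by (intro Cauchy_integral_circlepath_simple) auto
  then have "((\<lambda>t. f (circlepath 0 1 t) / circlepath 0 1 t *
      vector_derivative (circlepath 0 1) (at t within {0..1})) has_integral 0) {0..1}"
    by (simp add: has_contour_integral_def f_def)
  then have "((\<lambda>t. 2 * of_real pi * \<i> * f (unit_circle t)) has_integral 0) {0..1}"
  proof (rule has_integral_eq[rotated])
    fix t :: real assume "t \<in> {0..1}"
    then have "vector_derivative (circlepath 0 1) (at t within {0..1}) = 2 * of_real pi * \<i> * unit_circle t"
      using vector_derivative_circlepath01[of t 0 1] by (simp add: unit_circle_def)
    moreover have "circlepath 0 1 t = unit_circle t" by (simp add: circlepath unit_circle_def)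
    moreover have "unit_circle t \<noteq> 0" by (simp add: unit_circle_def)
    ultimately show "f (circlepath 0 1 t) / circlepath 0 1 t *
      vector_derivative (circlepath 0 1) (at t within {0..1}) = 2 * of_real pi * \<i> * f (unit_circle t)"
      by simp
  qed
  then have "((\<lambda>t. inverse (2 * of_real pi * \<i>) * (2 * of_real pi * \<i> * f (unit_circle t))) has_integral
      inverse (2 * of_real pi * \<i>) * 0) {0..1}"
    by (rule has_integral_mult_right)
  moreover have "inverse (2 * of_real pi * \<i>) * (2 * of_real pi * \<i> * z) = z" for z
  proof -
    have "inverse (2 * of_real pi * \<i>) * (2 * of_real pi * \<i>) = (1::complex)" by (rule left_inverse) simp
    then show ?thesis by (metis mult.assoc mult_1)
  qed
  ultimately have "((\<lambda>t. f (unit_circle t)) has_integral 0) {0..1}" by simp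
  then have "(Re \<circ> (\<lambda>t. f (unit_circle t)) has_integral Re 0) {0..1}"
    by (rule has_integral_linear) (rule bounded_linear_Re)
  then have "((\<lambda>t. Re (f (unit_circle t))) has_integral 0) {0..1}" by (simp add: comp_def)
  then show ?thesis
  proof (rule has_integral_eq[rotated])
    fix t :: real
    have "1 - u * unit_circle t \<noteq> 0" using pos[of "unit_circle t"] norm_unit_circle[of t] by (metis order_refl zero_complex.sel(1) less_irrefl)
    then show "Re (f (unit_circle t)) = ln (cmod (1 - u * unit_circle t))" by (simp add: f_def)
  qed
qed

lemma finite_unit_circle_preimage: "finite {t \<in> {0..1}. unit_circle t = w}"
proof (cases "{t \<in> {0..1}. unit_circle t = w} = {}")
  case False
  then obtain s where s: "s \<in> {0..1}" "unit_circle s = w" by blast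
  have "{t \<in> {0..1}. unit_circle t = w} \<subseteq> (\<lambda>n. s + of_int n) ` {-1..1}"
  proof
    fix t assume t: "t \<in> {t \<in> {0..1}. unit_circle t = w}"
    then have "unit_circle t = unit_circle s" using s by simp
    then obtain n :: int where n: "2 * pi * \<i> * of_real t = 2 * pi * \<i> * of_real s + of_real (real_of_int (2 * n) * pi) * \<i>"
      unfolding exp_eq unit_circle_def by blast
    have "2 * pi * t = 2 * pi * s + real_of_int (2 * n) * pi"
      using arg_cong[OF n, of Im] by simp
    then have "2 * pi * t = 2 * pi * (s + of_int n)" by (simp add: algebra_simps)
    then have ts: "t = s + of_int n" by simp
    then have "real_of_int n \<le> 1" "real_of_int n \<ge> -1" using s t by auto
    then have "n \<in> {-1..1}" by simp
    then show "t \<in> (\<lambda>n. s + of_int n) ` {-1..1}" using ts by blast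
  qed
  then show ?thesis by (rule finite_subset) simp
next
  case True
  then show ?thesis by (simp only: finite.emptyI)
qed

text \<open>
  Moving \<open>w\<close> radially away from the unit circle increases its distance to every point of the circle,
  which makes monotone convergence applicable in the proof of Jensen's formula.
\<close>
lemma dist_circle_mono:
  fixes e w :: complex
  assumes "cmod e = 1" "cmod w = 1" "1 \<le> r" "r \<le> s"
  shows "cmod (e - of_real r * w) \<le> cmod (e - of_real s * w)"
proof -
  define c where "c = e \<bullet> w"
  have c: "c \<le> 1" using norm_cauchy_schwarz[of e w] assms by (simp add: c_def)
  have sq: "(cmod (e - of_real x * w))\<^sup>2 = 1 - 2 * x * c + x\<^sup>2" for x
  proof -
    have "(cmod (e - x *\<^sub>R w))\<^sup>2 = (cmod e)\<^sup>2 - 2 * x * c + x\<^sup>2 * (cmod w)\<^sup>2"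
      unfolding power2_norm_eq_inner c_def
      by (simp add: inner_diff_left inner_diff_right inner_commute power2_eq_square algebra_simps)
    then show ?thesis using assms by (simp add: scaleR_conv_of_real)
  qed
  have "0 \<le> (s - r) * (s + r - 2 * c)" using assms c by (intro mult_nonneg_nonneg) auto
  then have "(cmod (e - of_real r * w))\<^sup>2 \<le> (cmod (e - of_real s * w))\<^sup>2"
    unfolding sq by (simp add: power2_eq_square algebra_simps)
  then show ?thesis by (rule power2_le_imp_le) simp
qed

text \<open>
  For \<open>\<bar>w\<bar> > 1\<close> factor out \<open>w\<close>; for \<open>\<bar>w\<bar> < 1\<close> use \<open>\<bar>e - w\<bar> = \<bar>1 - cnj w e\<bar>\<close> on the circle. If
  \<open>\<bar>w\<bar> = 1\<close>, approach \<open>w\<close> radially from outside.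
\<close>
lemma jensen_linear:
  "((\<lambda>t. ln (cmod (unit_circle t - w))) has_integral ln (max 1 (cmod w))) {0..1}"
proof -
  have gt: "((\<lambda>t. ln (cmod (unit_circle t - w))) has_integral ln (cmod w)) {0..1}" if "cmod w > 1" for w
  proof -
    have w: "w \<noteq> 0" using that by auto
    have "((\<lambda>t. ln (cmod w) + ln (cmod (1 - 1 / w * unit_circle t))) has_integral
        (ln (cmod w) * 1 + 0)) {0..1}"
      using that has_integral_const_real[of "ln (cmod w)" 0 1]
      by (intro has_integral_add jensen_disc) (auto simp: norm_divide divide_less_eq_1)
    then have "((\<lambda>t. ln (cmod w) + ln (cmod (1 - 1 / w * unit_circle t))) has_integral ln (cmod w)) {0..1}" by simp
    then show ?thesis
    proof (rule has_integral_eq[rotated])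
      fix t :: real
      have e: "unit_circle t - w = - w * (1 - 1 / w * unit_circle t)" using w by (simp add: algebra_simps)
      have "unit_circle t - w \<noteq> 0" using that norm_unit_circle[of t] by auto
      then have ne: "1 - 1 / w * unit_circle t \<noteq> 0" using e by (metis mult_zero_right)
      have "cmod (unit_circle t - w) = cmod w * cmod (1 - 1 / w * unit_circle t)"
        unfolding e norm_mult by simp
      then show "ln (cmod w) + ln (cmod (1 - 1 / w * unit_circle t)) = ln (cmod (unit_circle t - w))"
        using w ne by (metis ln_mult_pos zero_less_norm_iff)
    qed
  qed
  consider "cmod w < 1" | "cmod w > 1" | "cmod w = 1" by linarith
  then show ?thesis
  proof cases
    case 1
    have "((\<lambda>t. ln (cmod (1 - cnj w * unit_circle t))) has_integral 0) {0..1}"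
      using 1 by (intro jensen_disc) simp
    moreover have "cmod (1 - cnj w * unit_circle t) = cmod (unit_circle t - w)" for t
    proof -
      have "unit_circle t * cnj (unit_circle t) = 1"
        using complex_norm_square[of "unit_circle t"] norm_unit_circle[of t] by simp
      then have "unit_circle t * cnj (unit_circle t - w) = 1 - cnj w * unit_circle t"
        by (simp add: algebra_simps)
      then have "cmod (1 - cnj w * unit_circle t) = cmod (unit_circle t) * cmod (unit_circle t - w)"
        by (metis complex_mod_cnj norm_mult)
      then show ?thesis by (simp add: norm_unit_circle)
    qed
    ultimately show ?thesis using 1 by simp
  next
    case 2
    then show ?thesis using gt[OF 2] by simp
  next
    case 3
    define r where "r k = 1 + 1 / real (Suc k)" for k
    define Z where "Z = {t \<in> {0..1}. unit_circle t = w}"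
    have finZ: "finite Z" unfolding Z_def by (rule finite_unit_circle_preimage)
    \<comment> \<open>At the singular points the integrand is \<open>ln 0 = 0\<close>, so the approximants are set to 0 there.\<close>
    define f where "f k t = (if t \<in> Z then 0 else ln (cmod (unit_circle t - of_real (r k) * w)))" for k t
    define g where "g t = ln (cmod (unit_circle t - w))" for t
    have r1: "r k > 1" for k by (simp add: r_def)
    have rm: "r (Suc k) \<le> r k" for k by (simp add: r_def field_simps)
    have I: "(f k has_integral ln (r k)) {0..1}" for k
    proof (rule has_integral_spike_finite[OF finZ])
      have "cmod (of_real (r k) * w) = r k" using 3 r1[of k] by (simp add: norm_mult)
      then show "((\<lambda>t. ln (cmod (unit_circle t - of_real (r k) * w))) has_integral ln (r k)) {0..1}"
        using gt[of "of_real (r k) * w"] r1[of k] by simp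
    qed (simp add: f_def)
    have "g integrable_on {0..1} \<and> (\<lambda>k. integral {0..1} (f k)) \<longlonglongrightarrow> integral {0..1} g"
    proof (rule monotone_convergence_decreasing)
      show "f k integrable_on {0..1}" for k using I by blast
      show "f (Suc k) t \<le> f k t" if "t \<in> {0..1}" for k t
      proof (cases "t \<in> Z")
        case False
        have "of_real (r (Suc k)) * w \<noteq> unit_circle t"
        proof
          assume "of_real (r (Suc k)) * w = unit_circle t"
          then have "cmod (of_real (r (Suc k)) * w) = 1" by (simp add: norm_unit_circle)
          then show False using 3 r1[of "Suc k"] by (simp add: norm_mult)
        qed
        moreover have "cmod (unit_circle t - of_real (r (Suc k)) * w) \<le> cmod (unit_circle t - of_real (r k) * w)"
          using r1[of "Suc k"] rm[of k] 3 by (intro dist_circle_mono norm_unit_circle) auto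
        ultimately have "0 < cmod (unit_circle t - of_real (r (Suc k)) * w)" "0 < cmod (unit_circle t - of_real (r k) * w)"
          "cmod (unit_circle t - of_real (r (Suc k)) * w) \<le> cmod (unit_circle t - of_real (r k) * w)"
          by (auto intro: less_le_trans)
        then show ?thesis using False by (simp add: f_def)
      qed (simp add: f_def)
      show "(\<lambda>k. f k t) \<longlonglongrightarrow> g t" if "t \<in> {0..1}" for t
      proof (cases "t \<in> Z")
        case True
        then show ?thesis by (simp add: f_def g_def Z_def)
      next
        case False
        have "r \<longlonglongrightarrow> 1 + 0" unfolding r_def by (intro tendsto_intros LIMSEQ_Suc[OF lim_const_over_n[of 1, simplified]])
        then have "(\<lambda>k. ln (cmod (unit_circle t - of_real (r k) * w))) \<longlonglongrightarrow> ln (cmod (unit_circle t - of_real (1 + 0) * w))"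
          using False that by (intro tendsto_intros) (auto simp: Z_def)
        then show ?thesis using False by (simp add: f_def g_def)
      qed
      have "integral {0..1} (f k) \<in> {0..ln 2}" for k
      proof -
        have "r k \<le> 2" by (simp add: r_def field_simps)
        then show ?thesis using r1[of k] by (simp add: integral_unique[OF I])
      qed
      then show "bounded (range (\<lambda>k. integral {0..1} (f k)))"
        by (intro bounded_subset[OF bounded_closed_interval[of 0 "ln 2"]]) (auto simp: cbox_interval)
    qed
    moreover have "(\<lambda>k. integral {0..1} (f k)) \<longlonglongrightarrow> ln (1 + 0)"
    proof -
      have "r \<longlonglongrightarrow> 1 + 0" unfolding r_def by (intro tendsto_intros LIMSEQ_Suc[OF lim_const_over_n[of 1, simplified]])
      then have "(\<lambda>k. ln (r k)) \<longlonglongrightarrow> ln (1 + 0)" by (intro tendsto_intros) auto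
      then show ?thesis by (simp add: integral_unique[OF I])
    qed
    ultimately have "g integrable_on {0..1}" "integral {0..1} g = ln (1 + 0)"
      using LIMSEQ_unique by blast+
    then show ?thesis using 3 unfolding g_def[symmetric] by (simp add: has_integral_integrable_integral)
  qed
qed

definition mahler :: "int poly \<Rightarrow> real" where
  "mahler P = real_of_int \<bar>lead_coeff P\<bar> * (\<Prod>z\<in>#proots (of_int_poly P). max 1 (cmod z))"

text \<open>
  In terms of a root of \<open>P\<close>: degree above \<open>T\<close> and height at most \<open>\<delta>\<close>.
\<close>
definition low_height :: "real \<Rightarrow> nat \<Rightarrow> int poly \<Rightarrow> bool" where
  "low_height \<delta> T P \<longleftrightarrow> irreducible P \<and> lead_coeff P > 0 \<and> degree P > T \<and>
    ln (mahler P) \<le> \<delta> * real (degree P)"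

lemma prod_mset_ge_1: "(\<And>x. x \<in># A \<Longrightarrow> f x \<ge> (1::real)) \<Longrightarrow> (\<Prod>x\<in>#A. f x) \<ge> 1"
proof (induction A)
  case (add a A)
  then have "1 * 1 \<le> f a * (\<Prod>x\<in>#A. f x)" by (intro mult_mono) (auto intro: order_trans[of 0 1])
  then show ?case by simp
qed simp

lemma mahler_ge_lead: "\<bar>lead_coeff P\<bar> \<le> mahler P"
  using mult_left_mono[OF prod_mset_ge_1[of "proots (of_int_poly P)" "\<lambda>z. max 1 (cmod z)"], of "real_of_int \<bar>lead_coeff P\<bar>"]
  by (simp add: mahler_def)

lemma mahler_ge_1: "P \<noteq> 0 \<Longrightarrow> mahler P \<ge> 1"
proof -
  assume "P \<noteq> 0"
  then have "lead_coeff P \<noteq> 0" by simp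
  then have "1 \<le> real_of_int \<bar>lead_coeff P\<bar>" by linarith
  then show ?thesis using mahler_ge_lead[of P] by linarith
qed

lemma mahler_mult:
  assumes "P \<noteq> 0" "Q \<noteq> 0"
  shows "mahler (P * Q) = mahler P * mahler Q"
  using assms by (simp add: mahler_def of_int_poly_hom.hom_mult proots_mult lead_coeff_mult abs_mult)

text \<open>
  The logarithm of the product differs from the sum of the logarithms where a factor vanishes, because
  \<open>ln 0 = 0\<close>. This happens at finitely many points only.
\<close>
lemma jensen_product:
  "c \<noteq> 0 \<Longrightarrow> ((\<lambda>t. ln (cmod (c * (\<Prod>z\<in>#A. unit_circle t - z)))) has_integral
    ln (cmod c * (\<Prod>z\<in>#A. max 1 (cmod z)))) {0..1}"
proof (induction A)
  case empty
  then show ?case using has_integral_const_real[of "ln (cmod c)" 0 1] by simp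
next
  case (add a A)
  define h where "h t = c * (\<Prod>z\<in>#A. unit_circle t - z)" for t
  have "(\<Prod>z\<in>#A. max 1 (cmod z)) > 0"
    using prod_mset_ge_1[of A "\<lambda>z. max 1 (cmod z)"] by simp
  then have rhs: "ln (cmod c * (\<Prod>z\<in>#add_mset a A. max 1 (cmod z))) =
      ln (cmod c * (\<Prod>z\<in>#A. max 1 (cmod z))) + ln (max 1 (cmod a))"
    using add.prems by (subst ln_mult_pos[symmetric]) (auto simp: mult_ac zero_less_mult_iff)
  have "((\<lambda>t. ln (cmod (h t)) + ln (cmod (unit_circle t - a))) has_integral
      ln (cmod c * (\<Prod>z\<in>#add_mset a A. max 1 (cmod z)))) {0..1}"
    unfolding rhs h_def by (intro has_integral_add add jensen_linear)
  moreover have "finite (\<Union>z\<in>set_mset (add_mset a A). {t \<in> {0..1}. unit_circle t = z})"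
    using finite_unit_circle_preimage by (intro finite_UN_I) auto
  ultimately show ?case
  proof (rule has_integral_spike_finite[rotated 2])
    fix t assume "t \<in> {0..1} - (\<Union>z\<in>set_mset (add_mset a A). {t \<in> {0..1}. unit_circle t = z})"
    then have "unit_circle t - a \<noteq> 0" "h t \<noteq> 0" using add.prems by (auto simp: h_def)
    then show "ln (cmod (c * (\<Prod>z\<in>#add_mset a A. unit_circle t - z))) = ln (cmod (h t)) + ln (cmod (unit_circle t - a))"
      by (subst ln_mult_pos[symmetric]) (auto simp: h_def norm_mult mult_ac)
  qed
qed

lemma has_integral_log_mahler:
  assumes "P \<noteq> 0"
  shows "((\<lambda>t. ln (cmod (ipoly P (unit_circle t)))) has_integral ln (mahler P)) {0..1}"
proof -
  have P0: "of_int_poly P \<noteq> (0 :: complex poly)" using assms by simp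
  have "of_int (lead_coeff P) \<noteq> (0::complex)" using assms by simp
  from jensen_product[OF this, of "proots (of_int_poly P)"] show ?thesis
    unfolding mahler_def poly_over_proots[OF P0] by simp
qed

lemma log_mahler_measure_eq: "P \<noteq> 0 \<Longrightarrow> log_mahler_measure P = ln (mahler P)"
  unfolding log_mahler_measure_def unit_circle_def[symmetric] using has_integral_log_mahler by (rule integral_unique)

section \<open>The length of a polynomial\<close>

definition poly_length :: "complex poly \<Rightarrow> real" where
  "poly_length p = (\<Sum>i\<le>degree p. cmod (coeff p i))"

lemma poly_length_upto: "degree p \<le> n \<Longrightarrow> poly_length p = (\<Sum>i\<le>n. cmod (coeff p i))"
  unfolding poly_length_def by (rule sum.mono_neutral_left) (auto simp: coeff_eq_0)

text \<open>
  Multiplication by \<open>X - a\<close> multiplies the length by at most \<open>1 + \<bar>a\<bar>\<close>.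
\<close>
lemma poly_length_linear_mult: "poly_length ([:- a, 1:] * p) \<le> 2 * max 1 (cmod a) * poly_length p"
proof -
  define n where "n = Suc (degree p)"
  let ?q = "[:- a, 1:] * p"
  have "degree ?q \<le> n" using degree_mult_le[of "[:- a, 1:]" p] by (simp add: n_def)
  then have "poly_length ?q = (\<Sum>i\<le>n. cmod (coeff ?q i))" by (rule poly_length_upto)
  also have "\<dots> \<le> (\<Sum>i\<le>n. cmod a * cmod (coeff p i) + cmod (coeff (pCons 0 p) i))"
  proof (rule sum_mono)
    fix i
    have "coeff ?q i = - a * coeff p i + coeff (pCons 0 p) i" by simp
    then show "cmod (coeff ?q i) \<le> cmod a * cmod (coeff p i) + cmod (coeff (pCons 0 p) i)"
      using norm_triangle_ineq[of "- a * coeff p i" "coeff (pCons 0 p) i"] by (simp add: norm_mult)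
  qed
  also have "\<dots> = cmod a * (\<Sum>i\<le>n. cmod (coeff p i)) + (\<Sum>i\<le>n. cmod (coeff (pCons 0 p) i))"
    by (simp add: sum.distrib sum_distrib_left)
  also have "(\<Sum>i\<le>n. cmod (coeff (pCons 0 p) i)) = (\<Sum>i\<le>degree p. cmod (coeff p i))"
    unfolding n_def by (subst sum.atMost_Suc_shift) simp
  also have "\<dots> = poly_length p" by (simp add: poly_length_def)
  also have "(\<Sum>i\<le>n. cmod (coeff p i)) = poly_length p"
    by (rule poly_length_upto[symmetric]) (simp add: n_def)
  also have "cmod a * poly_length p + poly_length p = (cmod a + 1) * poly_length p"
    by (simp add: algebra_simps)
  also have "\<dots> \<le> 2 * max 1 (cmod a) * poly_length p"
    by (intro mult_right_mono) (auto simp: poly_length_def sum_nonneg)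
  finally show ?thesis .
qed

lemma poly_length_prod_linear:
  "poly_length (\<Prod>z\<in>#A. [:- z, 1:]) \<le> 2 ^ size A * (\<Prod>z\<in>#A. max 1 (cmod z))"
proof (induction A)
  case (add a A)
  have "poly_length ([:- a, 1:] * (\<Prod>z\<in>#A. [:- z, 1:])) \<le>
      2 * max 1 (cmod a) * poly_length (\<Prod>z\<in>#A. [:- z, 1:])"
    by (rule poly_length_linear_mult)
  also have "\<dots> \<le> 2 * max 1 (cmod a) * (2 ^ size A * (\<Prod>z\<in>#A. max 1 (cmod z)))"
    by (intro mult_left_mono add) auto
  finally show ?case by (simp add: mult_ac)
qed (simp add: poly_length_def)

definition int_length :: "int poly \<Rightarrow> real" where
  "int_length P = (\<Sum>i\<le>degree P. real_of_int \<bar>coeff P i\<bar>)"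

lemma int_length_le_mahler:
  assumes "P \<noteq> 0"
  shows "int_length P \<le> 2 ^ degree P * mahler P"
proof -
  let ?p = "of_int_poly P :: complex poly"
  have p0: "?p \<noteq> 0" using assms by simp
  have "int_length P = poly_length ?p"
    by (simp add: int_length_def poly_length_def)
  also have "?p = smult (lead_coeff ?p) (\<Prod>z\<in>#proots ?p. [:- z, 1:])" by (rule split_over_proots(1)[OF p0])
  also have "poly_length \<dots> = cmod (lead_coeff ?p) * poly_length (\<Prod>z\<in>#proots ?p. [:- z, 1:])"
    using assms by (simp add: poly_length_def norm_mult sum_distrib_left)
  also have "\<dots> \<le> cmod (lead_coeff ?p) * (2 ^ size (proots ?p) * (\<Prod>z\<in>#proots ?p. max 1 (cmod z)))"
    by (intro mult_left_mono poly_length_prod_linear) auto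
  finally show ?thesis using split_over_proots(2)[OF p0] by (simp add: mahler_def mult_ac)
qed

lemma abs_coeff_le_int_length: "real_of_int \<bar>coeff P i\<bar> \<le> int_length P"
proof (cases "i \<le> degree P")
  case True
  then show ?thesis unfolding int_length_def by (intro member_le_sum) auto
next
  case False
  then show ?thesis by (simp add: coeff_eq_0 int_length_def sum_nonneg)
qed

lemma int_length_ge_1: "P \<noteq> 0 \<Longrightarrow> int_length P \<ge> 1"
proof -
  assume "P \<noteq> 0"
  then have "lead_coeff P \<noteq> 0" by simp
  then have "1 \<le> real_of_int \<bar>lead_coeff P\<bar>" by linarith
  then show ?thesis using abs_coeff_le_int_length[of P "degree P"] by linarith
qed

lemma (in field_abs_value) ipoly_le:
  "v (ipoly P x) \<le> int_length P * max 1 (v x) ^ degree P"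
proof -
  have "v (ipoly P x) = v (\<Sum>i\<le>degree P. of_int (coeff P i) * x ^ i)"
    by (simp add: poly_altdef)
  also have "\<dots> \<le> (\<Sum>i\<le>degree P. v (of_int (coeff P i) * x ^ i))" by (rule sum_le) simp
  also have "\<dots> \<le> (\<Sum>i\<le>degree P. real_of_int \<bar>coeff P i\<bar> * max 1 (v x) ^ degree P)"
  proof (rule sum_mono)
    fix i assume i: "i \<in> {..degree P}"
    have "v x ^ i \<le> max 1 (v x) ^ i" using nonneg by (intro power_mono) auto
    also have "\<dots> \<le> max 1 (v x) ^ degree P" using i by (intro power_increasing) auto
    finally show "v (of_int (coeff P i) * x ^ i) \<le> real_of_int \<bar>coeff P i\<bar> * max 1 (v x) ^ degree P"
      unfolding mult power using nonneg by (intro mult_mono int_upper) auto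
  qed
  finally show ?thesis by (simp add: int_length_def sum_distrib_right)
qed

lemma cmod_field_abs_value: "field_abs_value cmod"
proof
  show "1 / real_of_int \<bar>n\<bar> \<le> cmod (of_int n)" if "n \<noteq> 0" for n
  proof -
    have "1 \<le> real_of_int \<bar>n\<bar>" using that by linarith
    then have "1 / real_of_int \<bar>n\<bar> \<le> 1" by simp
    also have "1 \<le> cmod (of_int n)" using \<open>1 \<le> real_of_int \<bar>n\<bar>\<close> by simp
    finally show ?thesis .
  qed
qed (auto simp: norm_mult norm_triangle_ineq)

interpretation cmod: field_abs_value cmod
  by (rule cmod_field_abs_value)

text \<open>
  By Jensen's formula, \<open>ln (mahler P)\<close> is a mean value over the unit circle.
\<close>
lemma mahler_le_circle_bound:
  assumes "P \<noteq> 0" and B: "B \<ge> 1" "\<And>z. cmod z = 1 \<Longrightarrow> cmod (ipoly P z) \<le> B"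
  shows "mahler P \<le> B"
proof -
  have "ln (mahler P) \<le> ln B"
  proof (rule has_integral_le[OF has_integral_log_mahler[OF assms(1)]])
    show "((\<lambda>t::real. ln B) has_integral ln B) {0..1}"
      using has_integral_const_real[of "ln B" 0 1] by simp
    fix t :: real
    have "cmod (ipoly P (unit_circle t)) \<le> B" by (rule B(2)) (rule norm_unit_circle)
    then show "ln (cmod (ipoly P (unit_circle t))) \<le> ln B"
      using B(1) by (cases "ipoly P (unit_circle t) = 0") (auto intro: ln_mono)
  qed
  then show ?thesis using mahler_ge_1[OF assms(1)] B(1) by simp
qed

text \<open>
  Northcott's finiteness theorem: degree and Mahler measure bound all coefficients.
\<close>
lemma finite_polys_bounded_mahler: "finite {P. degree P \<le> T \<and> mahler P \<le> C}"
proof -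
  define B where "B = \<lfloor>2 ^ T * max 1 C\<rfloor>"
  have "{P. degree P \<le> T \<and> mahler P \<le> C} \<subseteq> Poly ` {xs. set xs \<subseteq> {- B..B} \<and> length xs \<le> Suc T}"
  proof
    fix P assume "P \<in> {P. degree P \<le> T \<and> mahler P \<le> C}"
    then have P: "degree P \<le> T" "mahler P \<le> C" by auto
    have "\<bar>coeff P i\<bar> \<le> B" for i
    proof (cases "P = 0")
      case True
      then show ?thesis by (simp add: B_def)
    next
      case False
      have "real_of_int \<bar>coeff P i\<bar> \<le> 2 ^ degree P * mahler P"
        using abs_coeff_le_int_length int_length_le_mahler[OF False] by (rule order_trans)
      also have "\<dots> \<le> 2 ^ T * max 1 C" using P mahler_ge_1[OF False]
        by (intro mult_mono power_increasing) auto
      finally show ?thesis unfolding B_def by (simp add: le_floor_iff)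
    qed
    then have "set (coeffs P) \<subseteq> {- B..B}"
      by (auto simp: coeffs_def abs_le_iff minus_le_iff simp del: upt_Suc split: if_splits)
    moreover have "length (coeffs P) \<le> Suc T" using P(1) by (simp add: length_coeffs_degree coeffs_def)
    ultimately show "P \<in> Poly ` {xs. set xs \<subseteq> {- B..B} \<and> length xs \<le> Suc T}"
      by (intro image_eqI[of _ _ "coeffs P"]) auto
  qed
  then show ?thesis by (rule finite_subset) (intro finite_imageI finite_lists_length_le finite_atLeastAtMost_int)
qed

section \<open>Vandermonde determinants and discriminants\<close>

definition vandermonde_mat :: "nat \<Rightarrow> (nat \<Rightarrow> 'a::comm_ring_1) \<Rightarrow> 'a mat" where
  "vandermonde_mat n f = mat n n (\<lambda>(i, j). f i ^ j)"

lemma vandermonde_mat_carrier [simp]: "vandermonde_mat n f \<in> carrier_mat n n"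
  by (simp add: vandermonde_mat_def)

lemma det_vandermonde_repeated:
  fixes f :: "nat \<Rightarrow> 'a::field"
  assumes "i < n" "j < n" "i \<noteq> j" "f i = f j"
  shows "det (vandermonde_mat n f) = 0"
proof (rule det_identical_rows[OF vandermonde_mat_carrier assms(3,1,2)])
  show "row (vandermonde_mat n f) i = row (vandermonde_mat n f) j"
    using assms by (intro eq_vecI) (auto simp: vandermonde_mat_def)
qed

text \<open>
  As a function of the last node the determinant is a polynomial, by Laplace expansion along the last
  row. It vanishes at the other nodes, and its leading coefficient is the Vandermonde determinant of
  those nodes.
\<close>
lemma det_vandermonde:
  fixes f :: "nat \<Rightarrow> 'a::field"
  shows "det (vandermonde_mat n f) = (\<Prod>j<n. \<Prod>i<j. f j - f i)"
proof (induction n)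
  case 0
  then show ?case by (simp add: vandermonde_mat_def)
next
  case (Suc n)
  show ?case
  proof (cases "inj_on f {..<n}")
    case False
    then obtain i j where ij: "i < n" "j < n" "i \<noteq> j" "f i = f j" by (auto simp: inj_on_def)
    define a b where "a = min i j" and "b = max i j"
    have ab: "a < b" "b < Suc n" "f a = f b" using ij by (auto simp: a_def b_def min_def max_def)
    have "(\<Prod>i<b. f b - f i) = 0" using ab by (intro prod_zero) (auto intro!: bexI[of _ a])
    then have "(\<Prod>j<Suc n. \<Prod>i<j. f j - f i) = 0" using ab by (intro prod_zero) auto
    moreover have "det (vandermonde_mat (Suc n) f) = 0"
      using ij by (intro det_vandermonde_repeated[of i _ j]) auto
    ultimately show ?thesis by simp
  next
    case True
    let ?A = "vandermonde_mat (Suc n)"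
    define p where "p = (\<Sum>j<Suc n. monom (cofactor (?A f) n j) j)"
    have det: "det (?A (f(n := y))) = poly p y" for y
    proof -
      have "mat_delete (?A (f(n := y))) n j = mat_delete (?A f) n j" for j
        by (rule eq_matI) (auto simp: mat_delete_def vandermonde_mat_def)
      then have cof: "cofactor (?A (f(n := y))) n j = cofactor (?A f) n j" for j
        by (simp add: cofactor_def)
      have "det (?A (f(n := y))) = (\<Sum>j<Suc n. ?A (f(n := y)) $$ (n, j) * cofactor (?A f) n j)"
        unfolding laplace_expansion_row[OF vandermonde_mat_carrier lessI] cof ..
      also have "\<dots> = (\<Sum>j<Suc n. cofactor (?A f) n j * y ^ j)"
        by (intro sum.cong) (auto simp: vandermonde_mat_def)
      also have "\<dots> = poly p y" by (simp add: p_def poly_sum poly_monom)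
      finally show ?thesis .
    qed
    have coeff: "coeff p n = (\<Prod>j<n. \<Prod>i<j. f j - f i)"
    proof -
      have "coeff p n = cofactor (?A f) n n"
        by (simp add: p_def coeff_sum del: sum.lessThan_Suc)
      also have "\<dots> = det (mat_delete (?A f) n n)" by (simp add: cofactor_def)
      also have "mat_delete (?A f) n n = vandermonde_mat n f"
        by (rule eq_matI) (auto simp: mat_delete_def vandermonde_mat_def)
      finally show ?thesis using Suc by simp
    qed
    have deg: "degree p \<le> n" unfolding p_def
      by (intro degree_sum_le) (auto intro: order_trans[OF degree_monom_le])
    define q where "q = (\<Prod>i<n. [:- f i, 1:])"
    have "lead_coeff q = (\<Prod>i<n. lead_coeff [:- f i, 1:])" unfolding q_def by (rule lead_coeff_prod)
    then have q: "degree q = n" "monic q" "\<And>y. poly q y = (\<Prod>i<n. y - f i)"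
      by (auto simp: q_def degree_prod_eq_sum_degree poly_prod)
    have "p - smult (coeff p n) q = 0"
    proof (rule ccontr)
      let ?r = "p - smult (coeff p n) q"
      assume r: "?r \<noteq> 0"
      have "degree ?r \<le> n" using deg q(1) by (intro degree_diff_le) auto
      moreover have "coeff ?r n = 0" using q by simp
      ultimately have "degree ?r < n" using r by (metis leading_coeff_0_iff le_neq_implies_less)
      moreover have "f ` {..<n} \<subseteq> {y. poly ?r y = 0}"
      proof
        fix y assume "y \<in> f ` {..<n}"
        then obtain i where i: "i < n" "y = f i" by auto
        have "det (?A (f(n := y))) = 0" using i by (intro det_vandermonde_repeated[of i _ n]) auto
        then show "y \<in> {y. poly ?r y = 0}" using i by (auto simp: det q)
      qed
      then have "card (f ` {..<n}) \<le> degree ?r"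
        using card_poly_roots_bound[OF r] poly_roots_finite[OF r] by (meson card_mono le_trans)
      ultimately show False using True by (simp add: card_image)
    qed
    then have p: "p = smult (coeff p n) q" by simp
    have "det (?A f) = poly p (f n)" using det[of "f n"] by simp
    also have "\<dots> = coeff p n * (\<Prod>i<n. f n - f i)" by (subst p) (simp add: q)
    finally show ?thesis unfolding coeff by simp
  qed
qed

text \<open>
  The Leibniz expansion suffices. The factor \<open>fact n\<close> is larger than the one in Hadamard's inequality,
  but only logarithms divided by \<open>n\<^sup>2\<close> matter later.
\<close>
lemma vandermonde_bound:
  fixes f :: "nat \<Rightarrow> complex"
  shows "(\<Prod>j<n. \<Prod>i<j. cmod (f j - f i)) \<le> fact n * (\<Prod>i<n. max 1 (cmod (f i))) ^ (n - 1)"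
proof -
  let ?S = "{p. p permutes {0..<n}}"
  have "(\<Prod>j<n. \<Prod>i<j. cmod (f j - f i)) = cmod (det (vandermonde_mat n f))"
    by (simp add: det_vandermonde prod_norm)
  also have "det (vandermonde_mat n f) = (\<Sum>p\<in>?S. signof p * (\<Prod>i = 0..<n. f i ^ p i))"
    by (auto simp: det_def vandermonde_mat_def permutes_def intro!: sum.cong prod.cong)
  also have "cmod \<dots> \<le> (\<Sum>p\<in>?S. cmod (signof p * (\<Prod>i = 0..<n. f i ^ p i)))" by (rule norm_sum)
  also have "\<dots> \<le> (\<Sum>p\<in>?S. (\<Prod>i<n. max 1 (cmod (f i))) ^ (n - 1))"
  proof (rule sum_mono)
    fix p assume p: "p \<in> ?S"
    have "cmod (signof p) = 1" by (simp add: sign_def)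
    then have "cmod (signof p * (\<Prod>i = 0..<n. f i ^ p i)) = (\<Prod>i = 0..<n. cmod (f i) ^ p i)"
      by (simp add: norm_mult norm_power flip: prod_norm)
    also have "\<dots> \<le> (\<Prod>i = 0..<n. max 1 (cmod (f i)) ^ (n - 1))"
    proof (intro prod_mono conjI)
      fix i assume i: "i \<in> {0..<n}"
      then have "p i < n" using p permutes_in_image by fastforce
      then have "max 1 (cmod (f i)) ^ p i \<le> max 1 (cmod (f i)) ^ (n - 1)"
        by (intro power_increasing) auto
      moreover have "cmod (f i) ^ p i \<le> max 1 (cmod (f i)) ^ p i" by (intro power_mono) auto
      ultimately show "cmod (f i) ^ p i \<le> max 1 (cmod (f i)) ^ (n - 1)" by linarith
    qed auto
    also have "\<dots> = (\<Prod>i<n. max 1 (cmod (f i))) ^ (n - 1)"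
      by (simp add: prod_power_distrib lessThan_atLeast0)
    finally show "cmod (signof p * (\<Prod>i = 0..<n. f i ^ p i)) \<le> (\<Prod>i<n. max 1 (cmod (f i))) ^ (n - 1)" .
  qed
  also have "\<dots> = fact n * (\<Prod>i<n. max 1 (cmod (f i))) ^ (n - 1)"
    by (simp add: card_permutations[of "{0..<n}" n])
  finally show ?thesis .
qed

lemma pderiv_linear_product_at_root:
  fixes f :: "nat \<Rightarrow> 'a::field"
  assumes "k < n"
  shows "poly (pderiv (\<Prod>i<n. [:- f i, 1:])) (f k) = (\<Prod>i\<in>{..<n} - {k}. f k - f i)"
proof -
  have "poly (pderiv (\<Prod>i<n. [:- f i, 1:])) (f k) = (\<Sum>a<n. \<Prod>i\<in>{..<n} - {a}. f k - f i)"
    by (simp add: pderiv_prod poly_sum poly_prod pderiv_pCons)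
  also have "\<dots> = (\<Sum>a\<in>{k}. \<Prod>i\<in>{..<n} - {a}. f k - f i)"
  proof (rule sum.mono_neutral_right)
    show "\<forall>a\<in>{..<n} - {k}. (\<Prod>i\<in>{..<n} - {a}. f k - f i) = 0"
    proof
      fix a assume "a \<in> {..<n} - {k}"
      then show "(\<Prod>i\<in>{..<n} - {a}. f k - f i) = 0" using assms by (intro prod_zero) auto
    qed
  qed (use assms in auto)
  finally show ?thesis by simp
qed

lemma ordered_pairs_product:
  fixes g :: "nat \<Rightarrow> nat \<Rightarrow> 'a::comm_monoid_mult"
  assumes "\<And>i j. g i j = g j i"
  shows "(\<Prod>k<n. \<Prod>i\<in>{..<n} - {k}. g k i) = (\<Prod>j<n. \<Prod>i<j. g j i) * (\<Prod>j<n. \<Prod>i<j. g j i)"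
proof (induction n)
  case (Suc n)
  have split: "{..<Suc n} - {k} = insert n ({..<n} - {k})" if "k < n" for k using that by auto
  have "(\<Prod>k<Suc n. \<Prod>i\<in>{..<Suc n} - {k}. g k i) = (\<Prod>k<n. \<Prod>i\<in>{..<Suc n} - {k}. g k i) * (\<Prod>i<n. g n i)"
  proof -
    have "{..<Suc n} - {n} = {..<n}" by auto
    then show ?thesis by simp
  qed
  also have "(\<Prod>k<n. \<Prod>i\<in>{..<Suc n} - {k}. g k i) = (\<Prod>k<n. g k n * (\<Prod>i\<in>{..<n} - {k}. g k i))"
    by (intro prod.cong) (simp_all add: split)
  also have "\<dots> = (\<Prod>i<n. g n i) * (\<Prod>k<n. \<Prod>i\<in>{..<n} - {k}. g k i)"
    unfolding prod.distrib using assms by (metis (mono_tags, lifting) prod.cong)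
  finally show ?case unfolding Suc by (simp add: mult_ac)
qed simp

text \<open>
  The product of the values of the derivative at the roots is the square of a Vandermonde determinant,
  up to sign.
\<close>
lemma discriminant_bound:
  fixes A :: "complex multiset"
  defines "F \<equiv> \<Prod>x\<in>#A. [:- x, 1:]"
  shows "(\<Prod>x\<in>#A. cmod (poly (pderiv F) x)) \<le>
    (fact (size A) * (\<Prod>x\<in>#A. max 1 (cmod x)) ^ (size A - 1))\<^sup>2"
proof -
  obtain xs where xs: "A = mset xs" by (metis ex_mset)
  define n where "n = length xs"
  define f where "f i = xs ! i" for i
  have img: "image_mset h A = image_mset (\<lambda>i. h (f i)) (mset_set {..<n})" for h :: "complex \<Rightarrow> 'b"
  proof -
    have "image_mset f (mset_set {..<n}) = mset (map f [0..<n])" by (simp add: lessThan_atLeast0)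
    also have "map f [0..<n] = xs" using map_nth[of xs] by (simp add: f_def[abs_def] n_def)
    finally have "A = image_mset f (mset_set {..<n})" by (simp add: xs)
    then have "image_mset h A = image_mset h (image_mset f (mset_set {..<n}))" by (rule arg_cong)
    then show ?thesis by (simp add: multiset.map_comp comp_def)
  qed
  have prod: "(\<Prod>x\<in>#A. h x) = (\<Prod>i<n. h (f i))" for h :: "complex \<Rightarrow> 'b::comm_monoid_mult"
    unfolding img by (simp add: prod_unfold_prod_mset)
  have F: "F = (\<Prod>i<n. [:- f i, 1:])" unfolding F_def prod ..
  have "(\<Prod>x\<in>#A. cmod (poly (pderiv F) x)) = (\<Prod>k<n. \<Prod>i\<in>{..<n} - {k}. cmod (f k - f i))"
    unfolding prod F by (intro prod.cong refl) (simp only: pderiv_linear_product_at_root lessThan_iff prod_norm)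
  also have "\<dots> = (\<Prod>j<n. \<Prod>i<j. cmod (f j - f i))\<^sup>2"
    unfolding power2_eq_square by (rule ordered_pairs_product) (rule norm_minus_commute)
  also have "\<dots> \<le> (fact n * (\<Prod>i<n. max 1 (cmod (f i))) ^ (n - 1))\<^sup>2"
    by (intro power_mono vandermonde_bound prod_nonneg) auto
  finally show ?thesis unfolding prod by (simp add: xs n_def)
qed

section \<open>Small Mahler measure bounds a polynomial on the unit circle\<close>

text \<open>
  The resultant of \<open>P\<close> and its derivative is a nonzero integer.
\<close>
lemma irreducible_discriminant_lower:
  fixes P :: "int poly"
  assumes irr: "irreducible P" and lead: "lead_coeff P > 0"
  defines "A \<equiv> proots (of_int_poly P :: complex poly)" and "a \<equiv> real_of_int (lead_coeff P)"
  shows "1 \<le> a ^ (2 * degree P - 1) * (\<Prod>x\<in>#A. cmod (poly (pderiv (\<Prod>x\<in>#A. [:- x, 1:])) x))"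
proof (cases "degree P = 0")
  case True
  moreover have "P \<noteq> 0" using lead by auto
  ultimately have "A = {#}" using split_over_proots(2)[of "of_int_poly P :: complex poly"] lead
    by (simp add: A_def)
  then show ?thesis using True by simp
next
  case False
  let ?p = "of_int_poly P :: complex poly"
  have P0: "P \<noteq> 0" "?p \<noteq> 0" using lead by auto
  have a0: "a > 0" using lead by (simp add: a_def)
  have dP: "pderiv P \<noteq> 0" using False by (simp add: pderiv_eq_0_iff)
  have size: "size A = degree P" using split_over_proots(2)[OF P0(2)] by (simp add: A_def)
  have p: "?p = smult (of_int (lead_coeff P)) (\<Prod>x\<in>#A. [:- x, 1:])"
    using split_over_proots(1)[OF P0(2)] by (simp add: A_def)
  have der: "ipoly (pderiv P) x = of_int (lead_coeff P) * poly (pderiv (\<Prod>x\<in>#A. [:- x, 1:])) x" for x :: complex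
    using arg_cong[OF p, of "\<lambda>q. poly (pderiv q) x"] by (simp add: of_int_hom.map_poly_pderiv pderiv_smult)
  define N where "N = resultant P (pderiv P)"
  have N: "of_int N = of_int (lead_coeff P) ^ (degree P - 1) * (\<Prod>x\<in>#A. ipoly (pderiv P) x)"
    using int_resultant_root_product[OF P0(1) dP, where 'a = complex]
    by (simp add: N_def A_def degree_pderiv)
  have "ipoly (pderiv P) x \<noteq> 0" if "x \<in># A" for x
    using that irreducible_int_poly_pderiv_nonzero[OF irr _ lead] P0 by (auto simp: A_def)
  then have "of_int N \<noteq> (0::complex)" unfolding N using lead by (auto simp: prod_mset_zero_iff)
  then have "N \<noteq> 0" by auto
  then have "1 \<le> \<bar>real_of_int N\<bar>" by linarith
  also have "\<bar>real_of_int N\<bar> = cmod (of_int N)" by simp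
  also have "\<dots> = a ^ (degree P - 1) * (\<Prod>x\<in>#A. cmod (ipoly (pderiv P) x))"
    unfolding N cmod.mult cmod.prod_mset using a0 by (simp add: norm_power a_def)
  also have "(\<Prod>x\<in>#A. cmod (ipoly (pderiv P) x)) = a ^ degree P * (\<Prod>x\<in>#A. cmod (poly (pderiv (\<Prod>x\<in>#A. [:- x, 1:])) x))"
    unfolding der cmod.mult prod_mset.distrib using a0 by (simp add: size a_def)
  also have "a ^ (degree P - 1) * (a ^ degree P * y) = a ^ (2 * degree P - 1) * y" for y
    using False by (simp add: mult.assoc[symmetric] flip: power_add) (simp add: mult_2)
  finally show ?thesis .
qed

text \<open>Maximum principle\<close>
text \<open>
  The maximum principle on the disc of radius \<open>R\<close>, for the polynomial \<open>\<Prod>b\<in>B. b - u\<close> in \<open>u\<close>.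
\<close>
lemma product_maximum:
  fixes B :: "complex multiset"
  assumes "R > 0"
  shows "\<exists>u. cmod u = R \<and> (\<Prod>b\<in>#B. cmod b) \<le> (\<Prod>b\<in>#B. cmod (b - u))"
proof (rule ccontr)
  define Q where "Q u = (\<Prod>b\<in>#B. b - u)" for u
  assume contra: "\<not> ?thesis"
  then have lt: "cmod (Q u) < cmod (Q 0)" if "cmod u = R" for u
    using that unfolding Q_def cmod.prod_mset by fastforce
  have cont: "continuous_on S (\<lambda>u. \<Prod>b\<in>#B. b - u)" for S
    by (induction B) (auto intro!: continuous_intros)
  have hol: "(\<lambda>u. \<Prod>b\<in>#B. b - u) holomorphic_on S" for S
    by (induction B) (auto intro!: holomorphic_intros)
  have ne: "sphere (0::complex) R \<noteq> {}" using assms by simp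
  obtain u0 where u0: "cmod u0 = R" "\<And>u. cmod u = R \<Longrightarrow> cmod (Q u) \<le> cmod (Q u0)"
  proof -
    have "continuous_on (sphere 0 R) (\<lambda>u. cmod (Q u))"
      unfolding Q_def by (intro continuous_on_norm cont)
    from continuous_attains_sup[OF compact_sphere ne this] show ?thesis using that by auto
  qed
  have "cmod (Q 0) \<le> cmod (Q u0)"
  proof (rule maximum_modulus_frontier[of Q "cball 0 R"])
    show "Q holomorphic_on interior (cball 0 R)" unfolding Q_def[abs_def] by (rule hol)
    show "continuous_on (closure (cball 0 R)) Q" unfolding Q_def[abs_def] by (rule cont)
  qed (use assms u0 in auto)
  then show False using lt[OF u0(1)] by simp
qed

lemma prod_mset_mono_nonneg:
  fixes f g :: "'a \<Rightarrow> real"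
  assumes "\<And>x. x \<in># A \<Longrightarrow> 0 \<le> f x \<and> f x \<le> g x"
  shows "(\<Prod>x\<in>#A. f x) \<le> (\<Prod>x\<in>#A. g x)"
proof -
  have "0 \<le> (\<Prod>x\<in>#A. f x) \<and> (\<Prod>x\<in>#A. f x) \<le> (\<Prod>x\<in>#A. g x)"
    using assms
  proof (induction A)
    case (add a A)
    then have "0 \<le> f a" "f a \<le> g a" "0 \<le> (\<Prod>x\<in>#A. f x)" "(\<Prod>x\<in>#A. f x) \<le> (\<Prod>x\<in>#A. g x)" by auto
    then show ?case by (simp add: mult_mono)
  qed simp
  then show ?thesis ..
qed

text \<open>
  Apply the discriminant bound to the roots of \<open>P\<close> together with the \<open>m\<close> roots of
  \<open>G = (X - z)\<^sup>m - u\<close>, where \<open>\<bar>u\<bar> = r\<^sup>m\<close>. These lie on the circle of radius \<open>r\<close> around \<open>z\<close> and are well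
  spaced: \<open>\<bar>G'\<bar> = m r\<^sup>m\<^sup>-\<^sup>1\<close> at each of them. The cross terms form the square of \<open>\<Prod>\<bar>G(x)\<bar>\<close> over the roots
  \<open>x\<close> of \<open>P\<close>, and for a suitable argument of \<open>u\<close> this product is at least \<open>\<Prod>\<bar>x - z\<bar>\<^sup>m\<close>, its value for
  \<open>u = 0\<close>.
\<close>
lemma circle_bound_multiplicative:
  fixes P :: "int poly" and z :: complex
  assumes irr: "irreducible P" and lead: "lead_coeff P > 0"
    and z: "cmod z = 1" and r: "0 < r" and m: "m > 0"
  defines "a \<equiv> real_of_int (lead_coeff P)" and "n \<equiv> degree P + m"
  shows "(cmod (ipoly P z) / a) ^ (2 * m) * (real m * r ^ (m - 1)) ^ m \<le>
    a ^ (2 * degree P - 1) * (fact n * (mahler P / a * (1 + r) ^ m) ^ (n - 1))\<^sup>2"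
proof -
  let ?p = "of_int_poly P :: complex poly"
  have P0: "P \<noteq> 0" "?p \<noteq> 0" using lead by auto
  have a0: "a > 0" using lead by (simp add: a_def)
  define A where "A = proots ?p"
  define F where "F = (\<Prod>x\<in>#A. [:- x, 1:])"
  have size_A: "size A = degree P" using split_over_proots(2)[OF P0(2)] by (simp add: A_def)
  have pF: "ipoly P x = of_int (lead_coeff P) * poly F x" for x
    using arg_cong[OF split_over_proots(1)[OF P0(2)], of "\<lambda>q. poly q x"] by (simp add: F_def A_def)
  obtain u where u: "cmod u = r ^ m"
    "(\<Prod>b\<in>#image_mset (\<lambda>x. (x - z) ^ m) A. cmod b) \<le> (\<Prod>b\<in>#image_mset (\<lambda>x. (x - z) ^ m) A. cmod (b - u))"
    using product_maximum[of "r ^ m"] r by (metis zero_less_power)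
  define G where "G = [:- z, 1:] ^ m - [:u:]"
  have G_eval: "poly G x = (x - z) ^ m - u" for x by (simp add: G_def poly_power)
  have deg_pow: "degree ([:- z, 1:] ^ m) = m" by (simp add: degree_power_eq)
  have coeff_G: "coeff G m = 1"
  proof -
    have "coeff G m = coeff ([:- z, 1:] ^ m) m" using m by (cases m) (auto simp: G_def)
    also have "\<dots> = 1" using lead_coeff_power[of "[:- z, 1:]" m] deg_pow by simp
    finally show ?thesis .
  qed
  have deg_G: "degree G = m"
  proof (rule antisym)
    show "degree G \<le> m" unfolding G_def using deg_pow by (intro degree_diff_le) auto
    show "m \<le> degree G" using coeff_G by (intro le_degree) simp
  qed
  then have lead_G: "lead_coeff G = 1" using coeff_G by simp
  have G0: "G \<noteq> 0" using lead_G by auto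
  define B where "B = proots G"
  have size_B: "size B = m" using split_over_proots(2)[OF G0] deg_G by (simp add: B_def)
  have GB: "G = (\<Prod>y\<in>#B. [:- y, 1:])" using split_over_proots(1)[OF G0] lead_G by (simp add: B_def)
  have B: "cmod (y - z) = r" if "y \<in># B" for y
  proof -
    have "(y - z) ^ m = u" using that G0 G_eval[of y] by (simp add: B_def)
    then have "cmod (y - z) ^ m = r ^ m" using u(1) by (metis norm_power)
    then show ?thesis using r m by (metis norm_ge_zero less_imp_le power_eq_imp_eq_base)
  qed
  define S where "S = (\<Prod>x\<in>#A. cmod (poly G x))"
  have S_B: "(\<Prod>y\<in>#B. cmod (poly F y)) = S"
  proof -
    have "S = (\<Prod>x\<in>#A. \<Prod>y\<in>#B. cmod (x - y))"
      unfolding S_def GB by (simp add: poly_prod_mset image_mset.compositionality comp_def cmod.prod_mset)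
    also have "\<dots> = (\<Prod>y\<in>#B. \<Prod>x\<in>#A. cmod (x - y))"
      by (induction A) (simp_all add: prod_mset.distrib)
    also have "\<dots> = (\<Prod>y\<in>#B. cmod (poly F y))"
      unfolding F_def by (simp add: poly_prod_mset image_mset.compositionality comp_def cmod.prod_mset norm_minus_commute)
    finally show ?thesis by simp
  qed
  have S_lower: "(cmod (ipoly P z) / a) ^ m \<le> S"
  proof -
    have "cmod (poly F z) = (\<Prod>x\<in>#A. cmod (x - z))"
      unfolding F_def by (simp add: poly_prod_mset image_mset.compositionality comp_def cmod.prod_mset norm_minus_commute)
    moreover have "(\<Prod>x\<in>#A. cmod (x - z)) ^ m = (\<Prod>x\<in>#A. cmod (x - z) ^ m)"
      by (induction A) (simp_all add: power_mult_distrib)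
    ultimately have "cmod (poly F z) ^ m = (\<Prod>x\<in>#A. cmod (x - z) ^ m)" by simp
    also have "\<dots> \<le> S" using u(2) by (simp add: S_def G_eval image_mset.compositionality comp_def norm_power)
    finally show ?thesis using a0 P0 by (simp add: pF norm_mult a_def)
  qed
  define H where "H = F * G"
  have H: "H = (\<Prod>x\<in>#A + B. [:- x, 1:])" by (simp add: H_def F_def GB)
  have derA: "poly (pderiv H) x = poly (pderiv F) x * poly G x" if "x \<in># A" for x
  proof -
    have "poly F x = 0" using that by (auto simp: F_def poly_prod_mset prod_mset_zero_iff)
    then show ?thesis by (simp add: H_def pderiv_mult)
  qed
  have derB: "cmod (poly (pderiv H) y) = cmod (poly F y) * (real m * r ^ (m - 1))" if "y \<in># B" for y
  proof -
    have "poly G y = 0" using that G0 by (simp add: B_def)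
    moreover have "poly (pderiv G) y = of_nat m * (y - z) ^ (m - 1)"
      by (simp add: G_def pderiv_diff pderiv_power pderiv_pCons poly_power)
    ultimately show ?thesis using B[OF that] by (simp add: H_def pderiv_mult norm_mult norm_power)
  qed
  define \<Delta> where "\<Delta> = (\<Prod>x\<in>#A. cmod (poly (pderiv F) x))"
  have \<Delta>: "1 \<le> a ^ (2 * degree P - 1) * \<Delta>"
    using irreducible_discriminant_lower[OF irr lead] by (simp add: \<Delta>_def F_def A_def a_def)
  have prod_H: "(\<Prod>x\<in>#A + B. cmod (poly (pderiv H) x)) = \<Delta> * S * (S * (real m * r ^ (m - 1)) ^ m)"
  proof -
    have "(\<Prod>x\<in>#A. cmod (poly (pderiv H) x)) = (\<Prod>x\<in>#A. cmod (poly (pderiv F) x) * cmod (poly G x))"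
      by (intro arg_cong[of _ _ prod_mset] image_mset_cong) (simp add: derA norm_mult)
    moreover have "(\<Prod>y\<in>#B. cmod (poly (pderiv H) y)) = (\<Prod>y\<in>#B. cmod (poly F y) * (real m * r ^ (m - 1)))"
      by (intro arg_cong[of _ _ prod_mset] image_mset_cong) (simp add: derB)
    ultimately show ?thesis by (simp add: prod_mset.distrib \<Delta>_def S_B size_B) (simp add: S_def)
  qed
  have max_AB: "(\<Prod>x\<in>#A + B. max 1 (cmod x)) \<le> mahler P / a * (1 + r) ^ m"
  proof -
    have "(\<Prod>x\<in>#A. max 1 (cmod x)) = mahler P / a" using a0 lead P0 by (simp add: mahler_def a_def A_def)
    moreover have "(\<Prod>y\<in>#B. max 1 (cmod y)) \<le> (\<Prod>y\<in>#B. 1 + r)"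
    proof (rule prod_mset_mono_nonneg)
      fix y assume "y \<in># B"
      then have "cmod y \<le> 1 + r" using B[of y] norm_triangle_ineq[of "y - z" z] z by simp
      then show "0 \<le> max 1 (cmod y) \<and> max 1 (cmod y) \<le> 1 + r" using r by simp
    qed
    moreover have "mahler P / a \<ge> 0" using mahler_ge_1[OF P0(1)] a0 by simp
    ultimately have "(\<Prod>x\<in>#A. max 1 (cmod x)) * (\<Prod>y\<in>#B. max 1 (cmod y)) \<le> mahler P / a * (1 + r) ^ m"
      by (simp only: mult_left_mono prod_mset_constant size_B)
    then show ?thesis by simp
  qed
  have "(cmod (ipoly P z) / a) ^ (2 * m) * (real m * r ^ (m - 1)) ^ m \<le> S\<^sup>2 * (real m * r ^ (m - 1)) ^ m"
    using power_mono[OF S_lower, of 2] a0 r by (intro mult_right_mono) (auto simp: power_mult[symmetric] mult.commute)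
  also have "\<dots> = 1 * (S\<^sup>2 * (real m * r ^ (m - 1)) ^ m)" by simp
  also have "\<dots> \<le> a ^ (2 * degree P - 1) * \<Delta> * (S\<^sup>2 * (real m * r ^ (m - 1)) ^ m)"
    using \<Delta> r by (intro mult_right_mono) auto
  also have "\<dots> = a ^ (2 * degree P - 1) * (\<Prod>x\<in>#A + B. cmod (poly (pderiv H) x))"
    unfolding prod_H by (simp add: power2_eq_square mult_ac)
  also have "\<dots> \<le> a ^ (2 * degree P - 1) * (fact n * (\<Prod>x\<in>#A + B. max 1 (cmod x)) ^ (n - 1))\<^sup>2"
    using discriminant_bound[of "A + B"] a0 unfolding H[symmetric]
    by (intro mult_left_mono) (simp_all add: size_A size_B n_def)
  also have "\<dots> \<le> a ^ (2 * degree P - 1) * (fact n * (mahler P / a * (1 + r) ^ m) ^ (n - 1))\<^sup>2"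
    using a0 prod_mset_ge_1[of "A + B" "\<lambda>x. max 1 (cmod x)"]
    by (intro mult_left_mono power_mono max_AB) auto
  finally show ?thesis .
qed

lemma ln_fact_le: "ln (fact n :: real) \<le> real n * ln (real n)"
proof -
  have "(fact n :: real) \<le> real n ^ n" using fact_le_power[of n, where 'a = real] by simp
  then have "ln (fact n) \<le> ln (real n ^ n)" by (cases "n = 0") (auto intro: ln_mono)
  then show ?thesis by (cases "n = 0") (auto simp: ln_realpow)
qed

text \<open>
  In the logarithm of the preceding estimate the leading coefficient \<open>a\<close> cancels except for one summand
  \<open>ln a \<le> ln (mahler P)\<close>.
\<close>
lemma circle_bound_log:
  fixes P :: "int poly" and z :: complex
  assumes irr: "irreducible P" and lead: "lead_coeff P > 0" and deg: "degree P > 0"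
    and z: "cmod z = 1" and r: "0 < r" "r < 1" and m: "m > 0" and nz: "ipoly P z \<noteq> 0"
  defines "n \<equiv> degree P + m"
  shows "2 * real m * ln (cmod (ipoly P z)) \<le> 2 * real n * ln (real n) + 2 * real n * ln (mahler P)
    + 2 * real m * real n * r + (real m)\<^sup>2 * ln (1 / r)"
proof -
  define a where "a = real_of_int (lead_coeff P)"
  have a1: "a \<ge> 1" using lead by (simp add: a_def)
  have M1: "mahler P \<ge> 1" using lead by (intro mahler_ge_1) auto
  have aM: "a \<le> mahler P" using mahler_ge_lead[of P] lead by (simp add: a_def)
  have n: "n \<ge> 2" using deg m by (simp add: n_def)
  define l where "l = ln (cmod (ipoly P z))"
  define q where "q = ln (mahler P)"
  define la where "la = ln a"
  have la: "0 \<le> la" "la \<le> q" using a1 aM by (simp_all add: la_def q_def)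
  let ?L = "(cmod (ipoly P z) / a) ^ (2 * m) * (real m * r ^ (m - 1)) ^ m"
  let ?R = "a ^ (2 * degree P - 1) * (fact n * (mahler P / a * (1 + r) ^ m) ^ (n - 1))\<^sup>2"
  have "?L \<le> ?R" using circle_bound_multiplicative[OF irr lead z r(1) m] by (simp add: a_def n_def)
  moreover have "?L > 0" using nz a1 r m by simp
  ultimately have ln_le: "ln ?L \<le> ln ?R" by (intro ln_mono) auto
  have "ln ?L = 2 * real m * (l - la) + real m * (ln (real m) + real (m - 1) * ln r)"
    using nz a1 r m by (simp add: ln_mult_pos ln_realpow ln_divide_pos l_def la_def)
  also have "\<dots> = 2 * real m * (l - la) + real m * ln (real m) + real m * (real m - 1) * ln r"
    using m by (simp add: algebra_simps of_nat_diff)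
  finally have L: "ln ?L = 2 * real m * (l - la) + real m * ln (real m) + real m * (real m - 1) * ln r" .
  have "ln ?R = real (2 * degree P - 1) * la + 2 * (ln (fact n) + real (n - 1) * (q - la + real m * ln (1 + r)))"
    using a1 M1 r by (simp add: ln_mult_pos ln_realpow ln_divide_pos q_def la_def)
  also have "\<dots> = (2 * real (degree P) - 1) * la + 2 * ln (fact n) + 2 * (real n - 1) * (q - la + real m * ln (1 + r))"
    using deg n by (simp add: algebra_simps of_nat_diff)
  finally have R: "ln ?R = (2 * real (degree P) - 1) * la + 2 * ln (fact n) + 2 * (real n - 1) * (q - la + real m * ln (1 + r))" .
  have lnr: "ln r = - ln (1 / r)" using r by (simp add: ln_div)
  have nn: "real n = real (degree P) + real m" by (simp add: n_def)
  have "2 * real m * l \<le> 2 * ln (fact n) + 2 * (real n - 1) * q + la + 2 * real m * (real n - 1) * ln (1 + r)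
      + real m * (real m - 1) * ln (1 / r) - real m * ln (real m)"
    using ln_le unfolding L R lnr nn by (simp add: algebra_simps)
  moreover have "ln (fact n) \<le> real n * ln (real n)" by (rule ln_fact_le)
  moreover have "2 * (real n - 1) * q + la \<le> 2 * real n * q" using la by (simp add: algebra_simps)
  moreover have "2 * real m * (real n - 1) * ln (1 + r) \<le> 2 * real m * real n * r"
    using r n ln_add_one_self_le_self[of r] by (intro mult_mono) auto
  moreover have "real m * (real m - 1) * ln (1 / r) \<le> (real m)\<^sup>2 * ln (1 / r)"
    using r by (intro mult_right_mono) (auto simp: power2_eq_square algebra_simps)
  moreover have "real m * ln (real m) \<ge> 0" using m by simp
  ultimately show ?thesis unfolding l_def q_def by linarith
qed

text \<open>
  With \<open>m \<approx> \<eta> D\<close> points the preceding lemma bounds \<open>ln \<bar>P(z)\<bar> / D\<close> by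
  \<open>2 ln (2 D) / (\<eta> D) + 2 \<delta> / \<eta> + 2 r + \<eta> ln (1/r)\<close>. Each of the four terms is made at most \<open>\<epsilon> / 4\<close>, by
  choosing \<open>r\<close>, then \<open>\<eta>\<close>, then \<open>\<delta>\<close> and \<open>T\<close>.
\<close>
lemma circle_bound:
  assumes "\<epsilon> > 0"
  shows "\<exists>\<delta>>0. \<exists>T. \<forall>P z. low_height \<delta> T P \<longrightarrow> cmod z = 1 \<longrightarrow>
    cmod (ipoly P z) \<le> exp (\<epsilon> * real (degree P))"
proof -
  define r where "r = min (1/2) (\<epsilon> / 8)"
  have r: "0 < r" "r < 1" "2 * r \<le> \<epsilon> / 4" using assms by (auto simp: r_def)
  define L where "L = ln (1 / r)"
  have L: "L > 0" using r by (simp add: L_def)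
  define \<eta> where "\<eta> = min (1/2) (\<epsilon> / (4 * L))"
  have \<eta>: "0 < \<eta>" "\<eta> \<le> 1/2" "\<eta> * L \<le> \<epsilon> / 4"
  proof -
    show "0 < \<eta>" "\<eta> \<le> 1/2" using assms L by (auto simp: \<eta>_def)
    have "\<eta> * L \<le> \<epsilon> / (4 * L) * L" using L by (intro mult_right_mono) (auto simp: \<eta>_def)
    then show "\<eta> * L \<le> \<epsilon> / 4" using L by simp
  qed
  define \<delta> where "\<delta> = \<eta> * \<epsilon> / 8"
  have \<delta>: "\<delta> > 0" using \<eta> assms by (simp add: \<delta>_def)
  have "eventually (\<lambda>D::nat. 2 * ln (2 * real D) \<le> \<eta> * \<epsilon> / 4 * real D) sequentially"
    using \<eta>(1) assms by real_asymp
  moreover have "eventually (\<lambda>D::nat. 1 / \<eta> \<le> real D) sequentially" using \<eta>(1) by real_asymp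
  ultimately obtain T where T: "\<And>D. D \<ge> T \<Longrightarrow> 2 * ln (2 * real D) \<le> \<eta> * \<epsilon> / 4 * real D \<and> 1 / \<eta> \<le> real D"
    using eventually_conj by (metis (mono_tags, lifting) eventually_sequentially)
  show ?thesis
  proof (intro exI[of _ \<delta>] conjI exI[of _ T] allI impI \<delta>)
    fix P z assume low: "low_height \<delta> T P" and z: "cmod z = 1"
    then have P: "irreducible P" "lead_coeff P > 0" "T < degree P"
      and M: "ln (mahler P) \<le> \<delta> * real (degree P)" by (auto simp: low_height_def)
    show "cmod (ipoly P z) \<le> exp (\<epsilon> * real (degree P))"
    proof (cases "ipoly P z = 0")
      case False
      define D where "D = real (degree P)"
      have D: "D > 0" "2 * ln (2 * D) \<le> \<eta> * \<epsilon> / 4 * D" "1 \<le> \<eta> * D"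
        using T[of "degree P"] P(3) \<eta>(1) by (auto simp: D_def field_simps)
      define m where "m = nat \<lceil>\<eta> * D\<rceil>"
      have m: "\<eta> * D \<le> real m" "real m \<le> 2 * (\<eta> * D)" using D(3) by (auto simp: m_def) linarith
      then have m0: "m > 0" using D(3) by (cases m) auto
      define n where "n = degree P + m"
      have nD: "real n \<le> 2 * D"
      proof -
        have "2 * (\<eta> * D) \<le> D" using mult_right_mono[OF \<eta>(2), of D] D(1) by simp
        then show ?thesis using m(2) by (simp add: n_def D_def)
      qed
      have n1: "real n \<ge> 1" using m0 by (simp add: n_def)
      define l where "l = ln (cmod (ipoly P z))"
      have "2 * real m * l \<le> 2 * real n * ln (real n) + 2 * real n * ln (mahler P)
          + 2 * real m * real n * r + (real m)\<^sup>2 * L"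
        using circle_bound_log[OF P(1,2) _ z r(1,2) m0 False] P(3) by (simp add: l_def L_def n_def)
      also have "2 * real n * ln (real n) \<le> 2 * (2 * D) * ln (2 * D)"
        using nD n1 by (intro mult_mono ln_mono) auto
      also have "2 * (2 * D) * ln (2 * D) \<le> 2 * real m * (\<epsilon> / 4 * D)"
      proof -
        have "2 * (2 * D) * ln (2 * D) = 2 * D * (2 * ln (2 * D))" by simp
        also have "\<dots> \<le> 2 * D * (\<eta> * \<epsilon> / 4 * D)" using D by (intro mult_left_mono) auto
        also have "\<dots> = 2 * (\<eta> * D) * (\<epsilon> / 4 * D)" by simp
        also have "\<dots> \<le> 2 * real m * (\<epsilon> / 4 * D)" using m(1) assms D(1) by (intro mult_right_mono) auto
        finally show ?thesis .
      qed
      also have "2 * real n * ln (mahler P) \<le> 2 * real m * (\<epsilon> / 4 * D)"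
      proof -
        have "2 * real n * ln (mahler P) \<le> 2 * (2 * D) * (\<delta> * D)"
        proof (intro mult_mono)
          have "P \<noteq> 0" using P(2) by auto
          then show "0 \<le> ln (mahler P)" using mahler_ge_1[of P] by simp
        qed (use nD M D(1) in \<open>auto simp: D_def\<close>)
        also have "\<dots> = 2 * (\<eta> * D) * (\<epsilon> / 4 * D)" by (simp add: \<delta>_def)
        also have "\<dots> \<le> 2 * real m * (\<epsilon> / 4 * D)" using m(1) assms D(1) by (intro mult_right_mono) auto
        finally show ?thesis .
      qed
      also have "2 * real m * real n * r \<le> 2 * real m * (\<epsilon> / 4 * D)"
      proof -
        have "real n * r \<le> 2 * D * r" using nD r by (intro mult_right_mono) auto
        also have "\<dots> \<le> \<epsilon> / 4 * D" using mult_left_mono[OF r(3), of D] D(1) by (simp add: mult_ac)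
        finally have "2 * real m * (real n * r) \<le> 2 * real m * (\<epsilon> / 4 * D)" by (intro mult_left_mono) auto
        then show ?thesis by (simp add: mult.assoc)
      qed
      also have "(real m)\<^sup>2 * L \<le> 2 * real m * (\<epsilon> / 4 * D)"
      proof -
        have "real m * L \<le> 2 * (\<eta> * D) * L" using m(2) L by (intro mult_right_mono) auto
        also have "\<dots> \<le> 2 * (\<epsilon> / 4 * D)" using mult_left_mono[OF \<eta>(3), of D] D(1) by (simp add: mult_ac)
        finally have "real m * (real m * L) \<le> real m * (2 * (\<epsilon> / 4 * D))" by (intro mult_left_mono) auto
        then show ?thesis by (simp add: power2_eq_square mult_ac)
      qed
      finally have "2 * real m * l \<le> 2 * real m * (\<epsilon> * D)" by (simp add: algebra_simps)
      then have "l \<le> \<epsilon> * D" using m0 by simp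
      then have "exp l \<le> exp (\<epsilon> * D)" by simp
      then show ?thesis using False by (simp add: l_def D_def)
    qed simp
  qed
qed

section \<open>Equidistribution at zero and at roots of unity\<close>

lemma abs_const_coeff_le_mahler:
  assumes "P \<noteq> 0"
  shows "real_of_int \<bar>coeff P 0\<bar> \<le> mahler P"
proof -
  let ?p = "of_int_poly P :: complex poly"
  have p0: "?p \<noteq> 0" using assms by simp
  have "real_of_int \<bar>coeff P 0\<bar> = cmod (ipoly P 0)" by (simp add: poly_0_coeff_0)
  also have "\<dots> = real_of_int \<bar>lead_coeff P\<bar> * (\<Prod>z\<in>#proots ?p. cmod z)"
    unfolding poly_over_proots[OF p0] cmod.mult cmod.prod_mset by simp
  also have "\<dots> \<le> mahler P" unfolding mahler_def
    by (intro mult_left_mono prod_mset_mono_nonneg) auto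
  finally show ?thesis .
qed

definition unity_poly :: "nat \<Rightarrow> int poly" where
  "unity_poly N = monom 1 N - 1"

lemma unity_poly_degree: "N > 0 \<Longrightarrow> degree (unity_poly N) = N"
  and unity_poly_lead: "N > 0 \<Longrightarrow> lead_coeff (unity_poly N) = 1"
  and unity_poly_nonzero: "N > 0 \<Longrightarrow> unity_poly N \<noteq> 0"
proof -
  assume N: "N > 0"
  show deg: "degree (unity_poly N) = N"
  proof (rule antisym)
    show "degree (unity_poly N) \<le> N" unfolding unity_poly_def
      by (intro degree_diff_le degree_monom_le) auto
    show "N \<le> degree (unity_poly N)" using N by (intro le_degree) (simp add: unity_poly_def)
  qed
  show "lead_coeff (unity_poly N) = 1" unfolding deg using N by (simp add: unity_poly_def)
  then show "unity_poly N \<noteq> 0" by auto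
qed

lemma ipoly_unity_poly: "ipoly (unity_poly N) x = x ^ N - 1"
  by (simp add: unity_poly_def of_int_poly_hom.hom_minus poly_monom map_poly_monom)

lemma size_proots_unity_poly:
  "N > 0 \<Longrightarrow> size (proots (of_int_poly (unity_poly N) :: 'a::{alg_closed_field, field_char_0} poly)) = N"
  using split_over_proots(2)[of "of_int_poly (unity_poly N) :: 'a poly"]
  by (simp add: unity_poly_nonzero unity_poly_degree)

lemma proots_unity_poly_iff:
  fixes x :: "'a::field_char_0"
  shows "N > 0 \<Longrightarrow> x \<in># proots (of_int_poly (unity_poly N)) \<longleftrightarrow> x ^ N = 1"
  by (simp add: unity_poly_nonzero ipoly_unity_poly)

lemma resultant_unity_poly:
  assumes "N > 0" "P \<noteq> 0"
  shows "of_int (resultant (unity_poly N) P) =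
    (\<Prod>x\<in>#proots (of_int_poly (unity_poly N)). ipoly P (x :: 'a::{alg_closed_field, field_char_0}))"
  using int_resultant_root_product[OF unity_poly_nonzero[OF assms(1)] assms(2), where 'a = 'a]
  by (simp add: unity_poly_lead[OF assms(1)])

lemma irreducible_nonzero_at_root_of_unity:
  fixes x :: "'a::field_char_0"
  assumes "irreducible P" "lead_coeff P > 0" "degree P > N" "N > 0" "x ^ N = 1"
  shows "ipoly P x \<noteq> 0"
proof
  assume "ipoly P x = 0"
  then have "P dvd unity_poly N" using irreducible_int_poly_dvd[OF assms(1) _ assms(2), of x] assms(5)
    by (simp add: ipoly_unity_poly)
  then have "degree P \<le> degree (unity_poly N)" using unity_poly_nonzero assms(4) by (intro dvd_imp_degree_le)
  then show False using assms by (simp add: unity_poly_degree)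
qed

context field_abs_value
begin

text \<open>
  For the minimal polynomial \<open>P\<close> of an algebraic number this is the difference between its logarithmic
  average and the expected limit, multiplied by the degree.
\<close>
definition deviation :: "'a \<Rightarrow> int poly \<Rightarrow> real" where
  "deviation \<kappa> P =
    ln (v (ipoly P \<kappa>)) - ln (v (of_int (lead_coeff P))) - real (degree P) * ln (max 1 (v \<kappa>))"

definition equidistributes :: "'a \<Rightarrow> bool" where
  "equidistributes \<kappa> \<longleftrightarrow> (\<forall>\<epsilon>>0. \<exists>\<delta>>0. \<exists>T. \<forall>P. low_height \<delta> T P \<longrightarrow> ipoly P \<kappa> \<noteq> 0 \<longrightarrow>
    \<bar>deviation \<kappa> P\<bar> \<le> \<epsilon> * real (degree P))"

text \<open>
  An integer of small usual size has small logarithm at every place, in both directions.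
\<close>
lemma abs_ln_int:
  assumes "n \<noteq> 0"
  shows "\<bar>ln (v (of_int n))\<bar> \<le> ln (real_of_int \<bar>n\<bar>)"
proof -
  have n: "real_of_int \<bar>n\<bar> > 0" using assms by simp
  have pos: "v (of_int n) > 0" using assms by (intro pos) simp
  have "ln (v (of_int n)) \<le> ln (real_of_int \<bar>n\<bar>)" using pos int_upper by (intro ln_mono) auto
  moreover have "ln (1 / real_of_int \<bar>n\<bar>) \<le> ln (v (of_int n))"
    using n int_lower[OF assms] by (intro ln_mono) auto
  then have "- ln (real_of_int \<bar>n\<bar>) \<le> ln (v (of_int n))" using n by (simp add: ln_div)
  ultimately show ?thesis by (simp add: abs_le_iff)
qed

lemma abs_ln_lead_le:
  assumes "P \<noteq> 0"
  shows "\<bar>ln (v (of_int (lead_coeff P)))\<bar> \<le> ln (mahler P)"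
proof -
  have l: "lead_coeff P \<noteq> 0" using assms by simp
  then have "\<bar>ln (v (of_int (lead_coeff P)))\<bar> \<le> ln (real_of_int \<bar>lead_coeff P\<bar>)" by (rule abs_ln_int)
  also have "\<dots> \<le> ln (mahler P)" using l mahler_ge_lead[of P] by (intro ln_mono) auto
  finally show ?thesis .
qed

lemma equidistributes_0: "equidistributes 0"
  unfolding equidistributes_def
proof (intro allI impI)
  fix \<epsilon> :: real assume \<epsilon>: "\<epsilon> > 0"
  have "\<bar>deviation 0 P\<bar> \<le> \<epsilon> * real (degree P)"
    if low: "low_height (\<epsilon> / 2) 0 P" and "ipoly P (0::'a) \<noteq> 0" for P
  proof -
    have P0: "P \<noteq> 0" and M: "ln (mahler P) \<le> \<epsilon> / 2 * real (degree P)"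
      using low by (auto simp: low_height_def)
    have c: "ipoly P (0::'a) = of_int (coeff P 0)" by (simp add: poly_0_coeff_0)
    then have c0: "coeff P 0 \<noteq> 0" using that by auto
    have "\<bar>ln (v (ipoly P 0))\<bar> \<le> ln (real_of_int \<bar>coeff P 0\<bar>)" unfolding c by (rule abs_ln_int[OF c0])
    also have "\<dots> \<le> ln (mahler P)" using c0 abs_const_coeff_le_mahler[OF P0] by (intro ln_mono) auto
    finally have "\<bar>ln (v (ipoly P 0))\<bar> \<le> ln (mahler P)" .
    moreover have "\<bar>ln (v (of_int (lead_coeff P)))\<bar> \<le> ln (mahler P)" by (rule abs_ln_lead_le[OF P0])
    moreover have "ln (max 1 (v 0)) = 0" by simp
    ultimately show ?thesis using M by (auto simp: deviation_def)
  qed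
  then show "\<exists>\<delta>>0. \<exists>T. \<forall>P. low_height \<delta> T P \<longrightarrow> ipoly P 0 \<noteq> 0 \<longrightarrow>
      \<bar>deviation 0 P\<bar> \<le> \<epsilon> * real (degree P)"
    using \<epsilon> by (intro exI[of _ "\<epsilon> / 2"] conjI exI[of _ 0]) auto
qed

lemma root_of_unity_abs:
  assumes "\<kappa> \<in> roots_of_unity"
  shows "v \<kappa> = 1"
proof -
  obtain n where n: "n > 0" "\<kappa> ^ n = 1" using assms by (auto simp: roots_of_unity_def)
  then have "v \<kappa> ^ n = 1 ^ n" by (metis one power power_one)
  then show ?thesis using n(1) nonneg[of \<kappa>] by (metis power_eq_imp_eq_base zero_le_one)
qed

text \<open>
  The product of the \<open>N\<close> values of \<open>P\<close> at the \<open>N\<close>-th roots of unity is an integer of usual size at most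
  \<open>E\<^sup>N\<close>, hence at least \<open>E\<^sup>-\<^sup>N\<close> at the given place, where the other \<open>N - 1\<close> values are at most \<open>E\<close>.
\<close>
lemma root_of_unity_estimate:
  fixes P :: "int poly" and \<kappa> :: 'a
  assumes irr: "irreducible P" and lead: "lead_coeff P > 0" and deg: "degree P > N"
    and N: "N > 0" "\<kappa> ^ N = 1" and E: "E \<ge> 1"
    and cE: "\<And>z. cmod z = 1 \<Longrightarrow> cmod (ipoly P z) \<le> E"
    and vE: "\<And>\<zeta>. \<zeta> \<in> roots_of_unity \<Longrightarrow> v (ipoly P \<zeta>) \<le> E"
  shows "1 / E ^ (2 * N) \<le> v (ipoly P \<kappa>)"
proof -
  have P0: "P \<noteq> 0" using lead by auto
  define R where "R = resultant (unity_poly N) P"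
  have ne: "ipoly P x \<noteq> 0" if "x \<in># proots (of_int_poly (unity_poly N))" for x :: complex
    using irreducible_nonzero_at_root_of_unity[OF irr lead deg N(1)] that N(1) by (simp add: proots_unity_poly_iff del: set_count_proots)
  have "of_int R \<noteq> (0::complex)" unfolding R_def resultant_unity_poly[OF N(1) P0] prod_mset_zero_iff
    using ne by fastforce
  then have R0: "R \<noteq> 0" by auto
  have "real_of_int \<bar>R\<bar> = cmod (of_int R)" by simp
  also have "\<dots> = (\<Prod>x\<in>#proots (of_int_poly (unity_poly N)). cmod (ipoly P x))"
    unfolding R_def resultant_unity_poly[OF N(1) P0] cmod.prod_mset ..
  also have "\<dots> \<le> (\<Prod>x\<in>#proots (of_int_poly (unity_poly N) :: complex poly). E)"
  proof (rule prod_mset_mono_nonneg)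
    fix x :: complex assume "x \<in># proots (of_int_poly (unity_poly N))"
    then have "x \<in> roots_of_unity" using N(1) proots_unity_poly_iff[of N x] by (auto simp: roots_of_unity_def)
    then show "0 \<le> cmod (ipoly P x) \<and> cmod (ipoly P x) \<le> E" using cE cmod.root_of_unity_abs by simp
  qed
  also have "\<dots> = E ^ N" using N(1) by (simp add: size_proots_unity_poly)
  finally have "real_of_int \<bar>R\<bar> \<le> E ^ N" .
  then have "1 / E ^ N \<le> 1 / real_of_int \<bar>R\<bar>" using R0 by (intro divide_left_mono) auto
  also have "\<dots> \<le> v (of_int R)" by (rule int_lower[OF R0])
  also have "\<dots> \<le> v (ipoly P \<kappa>) * E ^ N"
  proof -
    have "\<kappa> \<in># proots (of_int_poly (unity_poly N))" using N by (subst proots_unity_poly_iff) auto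
    then obtain B where B: "proots (of_int_poly (unity_poly N)) = add_mset \<kappa> B" by (metis mset_add)
    have "(\<Prod>x\<in>#B. v (ipoly P x)) \<le> (\<Prod>x\<in>#B. E)"
    proof (rule prod_mset_mono_nonneg)
      fix x assume "x \<in># B"
      then have "x \<in># proots (of_int_poly (unity_poly N))" by (simp add: B del: set_count_proots)
      then have "x \<in> roots_of_unity" using N(1) proots_unity_poly_iff[of N x] by (auto simp: roots_of_unity_def)
      then show "0 \<le> v (ipoly P x) \<and> v (ipoly P x) \<le> E" using vE nonneg by simp
    qed
    also have "\<dots> = E ^ size B" by simp
    also have "\<dots> \<le> E ^ N"
      using E size_proots_unity_poly[OF N(1), where 'a = 'a] by (intro power_increasing) (auto simp: B)
    finally show ?thesis unfolding R_def resultant_unity_poly[OF N(1) P0] prod_mset B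
      using nonneg by (simp add: mult_left_mono)
  qed
  finally have "1 / E ^ N * (1 / E ^ N) \<le> v (ipoly P \<kappa>) * E ^ N * (1 / E ^ N)"
    using E by (intro mult_right_mono) auto
  then show ?thesis using E by (simp add: power_add mult_2)
qed

text \<open>
  Only an upper bound has to be supplied for the given place; at the archimedean place it is
  \<open>circle_bound\<close>.
\<close>
lemma equidistributes_root_of_unity:
  assumes upper: "\<And>\<epsilon>. \<epsilon> > 0 \<Longrightarrow> \<exists>\<delta>>0. \<exists>T. \<forall>P \<zeta>. low_height \<delta> T P \<longrightarrow> \<zeta> \<in> roots_of_unity \<longrightarrow>
      v (ipoly P \<zeta>) \<le> exp (\<epsilon> * real (degree P))"
    and \<kappa>: "\<kappa> \<in> roots_of_unity"
  shows "equidistributes \<kappa>"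
  unfolding equidistributes_def
proof (intro allI impI)
  fix \<epsilon> :: real assume \<epsilon>: "\<epsilon> > 0"
  obtain N where N: "N > 0" "\<kappa> ^ N = 1" using \<kappa> by (auto simp: roots_of_unity_def)
  \<comment> \<open>The lower bound \<open>E\<^sup>-\<^sup>2\<^sup>N\<close> with \<open>E = exp (\<epsilon>' D)\<close> is then \<open>exp (- \<epsilon> D / 2)\<close>.\<close>
  define \<epsilon>' where "\<epsilon>' = \<epsilon> / (4 * real N)"
  have \<epsilon>': "\<epsilon>' > 0" using \<epsilon> N by (simp add: \<epsilon>'_def)
  obtain d1 T1 where 1: "d1 > 0" "\<And>P z. low_height d1 T1 P \<Longrightarrow> cmod z = 1 \<Longrightarrow>
      cmod (ipoly P z) \<le> exp (\<epsilon>' * real (degree P))"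
    using circle_bound[OF \<epsilon>'] by blast
  obtain d2 T2 where 2: "d2 > 0" "\<And>P \<zeta>. low_height d2 T2 P \<Longrightarrow> \<zeta> \<in> roots_of_unity \<Longrightarrow>
      v (ipoly P \<zeta>) \<le> exp (\<epsilon>' * real (degree P))"
    using upper[OF \<epsilon>'] by blast
  define \<delta> where "\<delta> = min (\<epsilon> / 2) (min d1 d2)"
  define T where "T = max N (max T1 T2)"
  have "\<bar>deviation \<kappa> P\<bar> \<le> \<epsilon> * real (degree P)" if low: "low_height \<delta> T P" and P\<kappa>: "ipoly P \<kappa> \<noteq> 0" for P
  proof -
    have P: "irreducible P" "lead_coeff P > 0" "degree P > T" "ln (mahler P) \<le> \<delta> * real (degree P)"
      using low by (auto simp: low_height_def)
    define D where "D = real (degree P)"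
    have "\<delta> * D \<le> \<epsilon> / 2 * D" "\<delta> * D \<le> d1 * D" "\<delta> * D \<le> d2 * D"
      by (rule mult_right_mono; simp add: \<delta>_def D_def)+
    then have M: "ln (mahler P) \<le> \<epsilon> / 2 * D" "ln (mahler P) \<le> d1 * D" "ln (mahler P) \<le> d2 * D"
      using P(4) by (simp_all add: D_def)
    define E where "E = exp (\<epsilon>' * D)"
    have E1: "E \<ge> 1" using \<epsilon>' by (simp add: E_def D_def)
    have c: "cmod (ipoly P z) \<le> E" if "cmod z = 1" for z
      using 1(2)[OF _ that, of P] P M(2) by (simp add: low_height_def T_def E_def D_def)
    have w: "v (ipoly P \<zeta>) \<le> E" if "\<zeta> \<in> roots_of_unity" for \<zeta>
      using 2(2)[OF _ that, of P] P M(3) by (simp add: low_height_def T_def E_def D_def)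
    have lower: "1 / E ^ (2 * N) \<le> v (ipoly P \<kappa>)"
      by (rule root_of_unity_estimate[OF P(1,2) _ N E1 c w]) (use P(3) in \<open>simp_all add: T_def\<close>)
    have lnE: "ln (E ^ (2 * N)) = \<epsilon> / 2 * D" using N(1) by (simp add: E_def ln_realpow \<epsilon>'_def)
    have pos: "v (ipoly P \<kappa>) > 0" using P\<kappa> by (rule pos)
    have Epos: "E ^ (2 * N) > 0" using E1 by simp
    have "ln (1 / E ^ (2 * N)) \<le> ln (v (ipoly P \<kappa>))" using lower Epos by (intro ln_mono) auto
    then have lo: "- (\<epsilon> / 2 * D) \<le> ln (v (ipoly P \<kappa>))" using lnE ln_inverse[of "E ^ (2 * N)"] by (simp add: inverse_eq_divide)
    have "v (ipoly P \<kappa>) \<le> E ^ (2 * N)"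
      using w[OF \<kappa>] E1 N(1) self_le_power[of E "2 * N"] by simp
    then have up: "ln (v (ipoly P \<kappa>)) \<le> \<epsilon> / 2 * D" using pos unfolding lnE[symmetric] by (intro ln_mono) auto
    have a: "\<bar>ln (v (of_int (lead_coeff P)))\<bar> \<le> \<epsilon> / 2 * D"
      using abs_ln_lead_le[of P] M(1) P(1) by (metis irreducible_def order_trans)
    have "ln (max 1 (v \<kappa>)) = 0" using root_of_unity_abs[OF \<kappa>] by simp
    then show ?thesis using lo up a unfolding deviation_def D_def[symmetric] by (simp add: abs_le_iff) linarith
  qed
  moreover have "\<delta> > 0" using \<epsilon> 1(1) 2(1) by (simp add: \<delta>_def)
  ultimately show "\<exists>\<delta>>0. \<exists>T. \<forall>P. low_height \<delta> T P \<longrightarrow> ipoly P \<kappa> \<noteq> 0 \<longrightarrow>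
      \<bar>deviation \<kappa> P\<bar> \<le> \<epsilon> * real (degree P)"
    by (intro exI[of _ \<delta>] conjI exI[of _ T]) auto
qed

end

section \<open>Polynomials with small coefficients\<close>

definition sign_poly :: "int poly \<Rightarrow> bool" where
  "sign_poly R \<longleftrightarrow> (\<forall>i. coeff R i \<in> {-1, 0, 1})"

lemma sign_poly_int_length: "sign_poly R \<Longrightarrow> int_length R \<le> real (degree R) + 1"
proof -
  assume R: "sign_poly R"
  have "int_length R \<le> (\<Sum>i\<le>degree R. 1)" unfolding int_length_def
  proof (rule sum_mono)
    fix i
    have "coeff R i \<in> {-1, 0, 1}" using R by (simp add: sign_poly_def)
    then show "real_of_int \<bar>coeff R i\<bar> \<le> 1" by auto
  qed
  then show ?thesis by simp
qed

lemma sign_poly_lead: "sign_poly R \<Longrightarrow> R \<noteq> 0 \<Longrightarrow> \<bar>lead_coeff R\<bar> = 1"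
proof -
  assume "sign_poly R" "R \<noteq> 0"
  then have "lead_coeff R \<in> {-1, 0, 1}" "lead_coeff R \<noteq> 0" by (auto simp: sign_poly_def)
  then show ?thesis by auto
qed

text \<open>
  If \<open>\<bar>z\<bar> > 2\<close>, then the leading term outweighs the geometric sum of the others.
\<close>
lemma sign_poly_root_bound:
  assumes R: "sign_poly R" "R \<noteq> 0" and z: "ipoly R z = 0"
  shows "cmod z \<le> 2"
proof (rule ccontr)
  assume "\<not> cmod z \<le> 2"
  then have z2: "cmod z > 2" by simp
  define n where "n = degree R"
  have "0 = (\<Sum>i\<le>n. of_int (coeff R i) * z ^ i)"
    using z by (simp add: poly_altdef n_def)
  also have "\<dots> = of_int (coeff R n) * z ^ n + (\<Sum>i<n. of_int (coeff R i) * z ^ i)"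
    by (simp add: lessThan_Suc_atMost[symmetric])
  finally have "of_int (coeff R n) * z ^ n = - (\<Sum>i<n. of_int (coeff R i) * z ^ i)"
    by (simp add: eq_neg_iff_add_eq_0)
  then have "cmod (of_int (coeff R n) * z ^ n) = cmod (\<Sum>i<n. of_int (coeff R i) * z ^ i)" by simp
  also have "\<dots> \<le> (\<Sum>i<n. cmod (of_int (coeff R i) * z ^ i))" by (rule norm_sum)
  also have "\<dots> \<le> (\<Sum>i<n. cmod z ^ i)"
  proof (rule sum_mono)
    fix i
    have "coeff R i \<in> {-1, 0, 1}" using R by (simp add: sign_poly_def)
    then show "cmod (of_int (coeff R i) * z ^ i) \<le> cmod z ^ i" by (auto simp: norm_mult norm_power)
  qed
  also have "\<dots> = (cmod z ^ n - 1) / (cmod z - 1)" using z2 by (subst geometric_sum) auto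
  also have "\<dots> \<le> (cmod z ^ n - 1) / 1" using z2 by (intro divide_left_mono) auto
  finally have "cmod (of_int (coeff R n) * z ^ n) < cmod z ^ n" by simp
  moreover have "\<bar>real_of_int (coeff R n)\<bar> = 1"
    using sign_poly_lead[OF R] unfolding n_def by (metis of_int_1 of_int_abs)
  ultimately show False by (simp add: norm_mult norm_power)
qed

lemma finite_cover_unit_disc:
  "\<exists>C. finite C \<and> cball (0::complex) 1 \<subseteq> (\<Union>c\<in>C. ball c (1/2))"
proof -
  have "y \<in> (\<Union>c\<in>UNIV. ball c (1/2))" for y :: complex
    by (rule UN_I[of y]) simp_all
  then have "cball (0::complex) 1 \<subseteq> (\<Union>c\<in>UNIV. ball c (1/2))" by blast
  then show ?thesis by (rule compactE_image[OF compact_cball, rotated]) auto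
qed

text \<open>
  Iterated pigeonhole in the compact unit disc, one point of \<open>Z\<close> after the other.
\<close>
lemma infinite_close_powers:
  fixes Z :: "complex set"
  assumes "finite Z" "\<And>z. z \<in> Z \<Longrightarrow> cmod z \<le> 1"
  shows "\<exists>J::nat set. infinite J \<and> (\<forall>z\<in>Z. \<forall>i\<in>J. \<forall>j\<in>J. cmod (z ^ i - z ^ j) < 1)"
  using assms
proof (induction Z rule: finite_induct)
  case empty
  show ?case by (rule exI[of _ UNIV]) auto
next
  case (insert z Z)
  then obtain I where I: "infinite I" "\<forall>z\<in>Z. \<forall>i\<in>I. \<forall>j\<in>I. cmod (z ^ i - z ^ j) < 1" by auto
  obtain C where C: "finite C" "cball (0::complex) 1 \<subseteq> (\<Union>c\<in>C. ball c (1/2))"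
    using finite_cover_unit_disc by blast
  have "\<exists>c\<in>C. z ^ i \<in> ball c (1/2)" for i
  proof -
    have "cmod (z ^ i) \<le> 1" using insert.prems[of z] by (simp add: norm_power power_le_one)
    then have "z ^ i \<in> cball 0 1" by simp
    then show ?thesis using C(2) by blast
  qed
  then obtain f where f: "\<And>i. f i \<in> C" "\<And>i. z ^ i \<in> ball (f i) (1/2)" by metis
  have "finite (f ` I)" using f(1) by (intro finite_subset[OF _ C(1)]) auto
  then obtain c where c: "infinite {i \<in> I. f i = f c}" using pigeonhole_infinite[OF I(1)] by blast
  have "cmod (z ^ i - z ^ j) < 1" if "f i = f c" "f j = f c" for i j
  proof -
    have "dist (f c) (z ^ i) < 1/2" "dist (f c) (z ^ j) < 1/2" using f(2)[of i] f(2)[of j] that by auto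
    then have "dist (z ^ i) (z ^ j) < 1" by (metis dist_commute dist_triangle_half_r)
    then show ?thesis by (simp add: dist_norm)
  qed
  then show ?case using c I(2) by (intro exI[of _ "{i \<in> I. f i = f c}"]) auto
qed

lemma prod_mset_lt_1:
  fixes f :: "'a \<Rightarrow> real"
  assumes "A \<noteq> {#}" "\<And>x. x \<in># A \<Longrightarrow> 0 \<le> f x \<and> f x < 1"
  shows "(\<Prod>x\<in>#A. f x) < 1"
  using assms
proof (induction A)
  case (add a A)
  have "(\<Prod>x\<in>#A. f x) \<le> (\<Prod>x\<in>#A. 1)"
    using add.prems by (intro prod_mset_mono_nonneg) (auto simp: less_imp_le)
  then have "f a * (\<Prod>x\<in>#A. f x) \<le> f a * 1" using add.prems by (intro mult_left_mono) auto
  then show ?case using add.prems(2)[of a] by simp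
qed simp

text \<open>
  Kronecker's theorem. Two powers \<open>x\<^sup>i\<close> and \<open>x\<^sup>j\<close> can be found whose difference has all its conjugates in
  the open unit disc. The norm of the difference is then an integer of absolute value less than 1.
\<close>
theorem kronecker:
  fixes x :: "'a::{alg_closed_field, field_char_0}"
  assumes x: "algebraic x" "x \<noteq> 0" and monic: "lead_coeff (int_min_poly x) = 1"
    and disc: "\<And>z. ipoly (int_min_poly x) z = 0 \<Longrightarrow> cmod z \<le> 1"
  shows "x \<in> roots_of_unity"
proof -
  define Q where "Q = int_min_poly x"
  note Q = int_min_poly_characterization[OF x(1), folded Q_def]
  have Q0: "Q \<noteq> 0" using Q(3) by auto
  define A where "A = proots (of_int_poly Q :: complex poly)"
  have fin: "finite {z::complex. ipoly Q z = 0}" using Q0 by (intro poly_roots_finite) simp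
  obtain J where J: "infinite J" "\<And>z i j. ipoly Q z = 0 \<Longrightarrow> i \<in> J \<Longrightarrow> j \<in> J \<Longrightarrow> cmod (z ^ i - z ^ j) < 1"
    using infinite_close_powers[OF fin] disc unfolding Q_def by blast
  obtain i where i: "i \<in> J" using J(1) by (metis finite.emptyI ex_in_conv)
  obtain j where j: "j \<in> J" "i < j" using J(1) by (meson infinite_nat_iff_unbounded)
  \<comment> \<open>The norm of \<open>x\<^sup>i - x\<^sup>j\<close> is the resultant of \<open>Q\<close> and \<open>W\<close>, as \<open>Q\<close> is monic.\<close>
  define W :: "int poly" where "W = monom 1 i - monom 1 j"
  have "coeff W i = 1" using j by (simp add: W_def)
  then have W0: "W \<noteq> 0" by auto
  define N where "N = resultant Q W"
  have "cmod (of_int N) = (\<Prod>z\<in>#A. cmod (ipoly W z))"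
    using int_resultant_root_product[OF Q0 W0, where 'a = complex] monic
    by (simp add: N_def A_def Q_def cmod.prod_mset)
  also have "\<dots> < 1"
  proof (rule prod_mset_lt_1)
    have "size A = degree Q" unfolding A_def using split_over_proots(2)[of "of_int_poly Q :: complex poly"] Q0 by simp
    then show "A \<noteq> {#}" using Q(6) by auto
    fix z assume "z \<in># A"
    then have "ipoly Q z = 0" using Q0 by (simp add: A_def)
    moreover have "ipoly W z = z ^ i - z ^ j" by (simp add: W_def of_int_poly_hom.hom_minus poly_monom map_poly_monom)
    ultimately show "0 \<le> cmod (ipoly W z) \<and> cmod (ipoly W z) < 1" using J(2) i j(1) by simp
  qed
  finally have "N = 0" by simp
  then have "(\<Prod>y\<in>#proots (of_int_poly Q). ipoly W (y::'a)) = 0"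
    using int_resultant_root_product[OF Q0 W0, where 'a = 'a] monic by (simp add: N_def Q_def)
  then obtain y :: 'a where "y \<in># proots (of_int_poly Q)" "ipoly W y = 0"
    unfolding prod_mset_zero_iff by auto
  then have "ipoly W x = 0"
    using irreducible_int_poly_root_transfer[OF Q(1,3) _ _ Q(2), of y W] Q0 by simp
  then have "x ^ i = x ^ j" by (simp add: W_def of_int_poly_hom.hom_minus poly_monom map_poly_monom)
  also have "x ^ j = x ^ i * x ^ (j - i)" using j(2) by (simp flip: power_add)
  finally have "x ^ (j - i) = 1" using x(2) by simp
  then show ?thesis unfolding roots_of_unity_def using j(2) by (intro CollectI exI[of _ "j - i"]) auto
qed

text \<open>
  Suppose that every power \<open>x\<^sup>k\<close> is a root of such a polynomial \<open>R\<close>. The minimal polynomial of \<open>x\<close> divides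
  \<open>R(X\<^sup>k)\<close>, so it is monic, and its complex roots \<open>z\<close> satisfy \<open>\<bar>z\<bar>\<^sup>k \<le> 2\<close> for all \<open>k\<close>. Hence Kronecker's
  theorem applies.
\<close>
lemma ex_power_no_sign_relation:
  fixes x :: "'a::{alg_closed_field, field_char_0}"
  assumes x: "algebraic x" "x \<noteq> 0" "x \<notin> roots_of_unity"
  shows "\<exists>k>0. \<forall>R. sign_poly R \<longrightarrow> R \<noteq> 0 \<longrightarrow> ipoly R (x ^ k) \<noteq> 0"
proof (rule ccontr)
  assume "\<not> ?thesis"
  then have rel: "\<exists>R. sign_poly R \<and> R \<noteq> 0 \<and> ipoly R (x ^ k) = 0" if "k > 0" for k using that by blast
  define Q where "Q = int_min_poly x"
  note Q = int_min_poly_characterization[OF x(1), folded Q_def]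
  have dvd: "\<exists>R. sign_poly R \<and> R \<noteq> 0 \<and> Q dvd pcompose R (monom 1 k)" if k: "k > 0" for k
  proof -
    obtain R where R: "sign_poly R" "R \<noteq> 0" "ipoly R (x ^ k) = 0" using rel[OF k] by blast
    have "ipoly (pcompose R (monom 1 k)) x = 0" using R(3)
      by (simp add: of_int_hom.map_poly_pcompose poly_pcompose map_poly_monom poly_monom)
    then show ?thesis using R Q(4) by blast
  qed
  have "lead_coeff Q = 1"
  proof -
    obtain R where R: "sign_poly R" "R \<noteq> 0" "Q dvd pcompose R (monom 1 1)" using dvd[of 1] by auto
    then obtain B where B: "pcompose R (monom 1 1) = Q * B" by (elim dvdE)
    have "pcompose R (monom 1 1) = R" using pcompose_idR[of R] by (simp add: monom_altdef)
    then have "lead_coeff R = lead_coeff Q * lead_coeff B" using B by (simp add: lead_coeff_mult)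
    then have "lead_coeff Q dvd 1" using sign_poly_lead[OF R(1,2)] by (metis dvd_abs_iff dvd_triv_left)
    then show ?thesis using Q(3) by simp
  qed
  moreover have "cmod z \<le> 1" if z: "ipoly Q z = 0" for z
  proof (rule ccontr)
    assume "\<not> cmod z \<le> 1"
    then obtain k where k: "2 < cmod z ^ k" using real_arch_pow[of "cmod z" 2] by auto
    then have k0: "k > 0" by (cases k) auto
    obtain R where R: "sign_poly R" "R \<noteq> 0" "Q dvd pcompose R (monom 1 k)" using dvd[OF k0] by auto
    then obtain B where B: "pcompose R (monom 1 k) = Q * B" by (elim dvdE)
    have "ipoly (pcompose R (monom 1 k)) z = 0" unfolding B using z by (simp add: of_int_poly_hom.hom_mult)
    then have "ipoly R (z ^ k) = 0"
      by (simp add: of_int_hom.map_poly_pcompose poly_pcompose map_poly_monom poly_monom)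
    then show False using sign_poly_root_bound[OF R(1,2)] k by (fastforce simp: norm_power)
  qed
  ultimately have "x \<in> roots_of_unity" using kronecker[OF x(1,2)] unfolding Q_def by blast
  then show False using x(3) by simp
qed

context field_abs_value
begin

text \<open>
  Of more than \<open>N\<^sup>r\<^sup>+\<^sup>1\<close> points in the unit ball, more than \<open>N\<^sup>r\<close> lie in the same ball of radius \<open>\<bar>t\<bar>\<close>
  around a centre \<open>f\<close>. The map \<open>x \<mapsto> (x - f) / t\<close> sends these back into the unit ball.
\<close>
lemma pigeonhole_close:
  assumes K: "is_subfield K" and t: "t \<in> K" "t \<noteq> 0"
    and F: "finite F" "F \<subseteq> K" "\<And>x. x \<in> K \<Longrightarrow> v x \<le> 1 \<Longrightarrow> \<exists>f\<in>F. v (x - f) \<le> v t"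
    and S: "finite S" "S \<subseteq> K" "\<And>x. x \<in> S \<Longrightarrow> v x \<le> 1" "card S > card F ^ r"
  shows "\<exists>x\<in>S. \<exists>y\<in>S. x \<noteq> y \<and> v (x - y) \<le> 2 * v t ^ r"
  using S
proof (induction r arbitrary: S)
  case 0
  then obtain x y where xy: "x \<in> S" "y \<in> S" "x \<noteq> y"
    by (metis card_le_Suc0_iff_eq power_0 not_le One_nat_def)
  then have "v (x - y) \<le> 1 + 1" using triangle[of x "- y"] 0(3)[OF xy(1)] 0(3)[OF xy(2)] by simp
  then show ?case using xy by auto
next
  case (Suc r)
  note K' = K[unfolded is_subfield_def]
  have "\<forall>x\<in>S. \<exists>f\<in>F. v (x - f) \<le> v t" using F(3) Suc.prems(2,3) by blast
  then obtain g where g: "\<And>x. x \<in> S \<Longrightarrow> g x \<in> F" "\<And>x. x \<in> S \<Longrightarrow> v (x - g x) \<le> v t" by metis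
  have "\<exists>f\<in>F. card {x \<in> S. g x = f} > card F ^ r"
  proof (rule ccontr)
    assume "\<not> ?thesis"
    then have le: "card {x \<in> S. g x = f} \<le> card F ^ r" if "f \<in> F" for f using that by auto
    have "S = (\<Union>f\<in>F. {x \<in> S. g x = f})" using g(1) by auto
    then have "card S \<le> (\<Sum>f\<in>F. card {x \<in> S. g x = f})" using card_UN_le[OF F(1)] by metis
    also have "\<dots> \<le> card F * card F ^ r" using sum_bounded_above[of F, OF le] by simp
    finally show False using Suc.prems(4) by simp
  qed
  then obtain f where f: "f \<in> F" "card {x \<in> S. g x = f} > card F ^ r" by blast
  define h where "h x = (x - f) * inverse t" for x
  define S' where "S' = h ` {x \<in> S. g x = f}"
  have inj: "inj_on h A" for A using t(2) by (auto simp: inj_on_def h_def)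
  have vt: "v t > 0" using t(2) by (rule pos)
  have "\<exists>x\<in>S'. \<exists>y\<in>S'. x \<noteq> y \<and> v (x - y) \<le> 2 * v t ^ r"
  proof (rule Suc.IH)
    show "finite S'" using Suc.prems(1) by (simp add: S'_def)
    have "h x \<in> K" if "x \<in> S" for x
    proof -
      have "x \<in> K" "- f \<in> K" using that Suc.prems(2) F(2) f(1) K' by auto
      then have "x + - f \<in> K" "inverse t \<in> K" using K' t(1) by auto
      then have "(x + - f) * inverse t \<in> K" using K' by blast
      then show ?thesis by (simp add: h_def)
    qed
    then show "S' \<subseteq> K" by (auto simp: S'_def)
    show "v x \<le> 1" if "x \<in> S'" for x
    proof -
      obtain y where y: "y \<in> S" "g y = f" "x = h y" using \<open>x \<in> S'\<close> by (auto simp: S'_def)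
      have "v (y - f) \<le> v t" using g(2)[OF y(1)] y(2) by simp
      then show ?thesis using vt by (simp add: y(3) h_def divide field_simps)
    qed
    show "card F ^ r < card S'" using f(2) by (simp add: S'_def card_image[OF inj])
  qed
  then obtain x y where xy: "x \<in> S" "y \<in> S" "h x \<noteq> h y" "v (h x - h y) \<le> 2 * v t ^ r"
    by (auto simp: S'_def)
  have "h x - h y = (x - y) * inverse t" by (simp add: h_def algebra_simps)
  then have "v (x - y) \<le> 2 * v t ^ Suc r" using xy(4) vt by (simp add: divide field_simps)
  moreover have "x \<noteq> y" using xy(3) by auto
  ultimately show ?case using xy(1,2) by blast
qed

text \<open>
  The parameters are \<open>m = 2 b s + 1\<close> exponents \<open>0, k, \<dots>, k (m - 1)\<close> and \<open>r = 2 s\<close> rounds of the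
  pigeonhole principle, where \<open>2\<^sup>b\<close> is at least the number of balls: then the \<open>2\<^sup>m\<close> subsums exceed the
  number of boxes. Half of the rounds are spent on the factor \<open>m\<close> in the trivial bound for a subsum.
\<close>
lemma ex_small_sign_poly:
  assumes \<kappa>: "algebraic \<kappa>" "\<kappa> \<noteq> 0" "\<kappa> \<notin> roots_of_unity"
    and K: "is_subfield K" "\<kappa> \<in> K" and t: "t \<in> K" "t \<noteq> 0" "v t < 1"
    and F: "finite F" "F \<subseteq> K" "\<And>x. x \<in> K \<Longrightarrow> v x \<le> 1 \<Longrightarrow> \<exists>f\<in>F. v (x - f) \<le> v t"
  shows "\<exists>k>0. \<exists>b. \<forall>\<^sub>F s in sequentially. \<exists>R. sign_poly R \<and> degree R \<le> k * (2 * b * s + 1) \<and>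
    ipoly R \<kappa> \<noteq> 0 \<and> v (ipoly R \<kappa>) \<le> 2 * v t ^ s * max 1 (v \<kappa>) ^ (k * (2 * b * s + 1))"
proof -
  obtain k where k: "k > 0" "\<And>R. sign_poly R \<Longrightarrow> R \<noteq> 0 \<Longrightarrow> ipoly R (\<kappa> ^ k) \<noteq> 0"
    using ex_power_no_sign_relation[OF \<kappa>] by blast
  note K' = K(1)[unfolded is_subfield_def]
  define b where "b = card F"
  have vt: "v t > 0" using t(2) by (rule pos)
  define w where "w = max 1 (v \<kappa>)"
  \<comment> \<open>The factor \<open>u\<^sup>n\<close> brings values of polynomials of degree \<open>n\<close> back to polynomial size.\<close>
  define u where "u = (if v \<kappa> > 1 then inverse \<kappa> else 1)"
  have u: "u \<in> K" "v u * w = 1" using K K' \<kappa>(2) by (auto simp: u_def w_def)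
  have Kpow: "x ^ i \<in> K" if "x \<in> K" for x i using that K' by (induction i) auto
  have Ksum: "(\<Sum>i\<in>A. f i) \<in> K" if "finite A" "\<And>i. i \<in> A \<Longrightarrow> f i \<in> K" for A and f :: "nat \<Rightarrow> 'a"
    using that K' by (induction A rule: finite_induct) auto
  have main: "\<exists>R. sign_poly R \<and> degree R \<le> k * (2 * b * s + 1) \<and>
    ipoly R \<kappa> \<noteq> 0 \<and> v (ipoly R \<kappa>) \<le> 2 * v t ^ s * w ^ (k * (2 * b * s + 1))"
    if s: "real (2 * b * s + 1) * v t ^ s \<le> 1" for s
  proof -
    define m where "m = 2 * b * s + 1"
    define n where "n = k * m"
    define P :: "nat set \<Rightarrow> int poly" where "P A = (\<Sum>i\<in>A. monom 1 (k * i))" for A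
    define x where "x A = ipoly (P A) \<kappa>" for A
    have x_sum: "x A = (\<Sum>i\<in>A. \<kappa> ^ (k * i))" for A
      by (simp add: x_def P_def of_int_poly_hom.hom_sum poly_sum map_poly_monom poly_monom)
    have coeff_P: "coeff (P A) j = (if \<exists>i\<in>A. j = k * i then 1 else 0)" if "finite A" for A j
    proof -
      have "coeff (P A) j = (\<Sum>i\<in>A. if k * i = j then 1 else 0)" by (simp add: P_def coeff_sum)
      also have "\<dots> = int (card (A \<inter> {i. k * i = j}))" using that by (simp add: sum.If_cases)
      also have "\<dots> = (if \<exists>i\<in>A. j = k * i then 1 else 0)"
      proof (cases "\<exists>i\<in>A. j = k * i")
        case True
        then obtain i where "i \<in> A" "j = k * i" by blast
        then have "A \<inter> {i. k * i = j} = {i}" using k(1) by auto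
        then show ?thesis using True by simp
      next
        case False
        then have "A \<inter> {i. k * i = j} = {}" by auto
        then show ?thesis using False by simp
      qed
      finally show ?thesis .
    qed
    have sgn: "sign_poly (P A - P B)" if "finite A" "finite B" for A B
      unfolding sign_poly_def using that by (auto simp: coeff_P)
    \<comment> \<open>Normalised subsums, which lie in the unit ball because \<open>m \<bar>t\<bar>\<^sup>s \<le> 1\<close>.\<close>
    define y where "y A = t ^ s * u ^ n * x A" for A
    have v_u: "v u ^ n * w ^ n = 1" using u(2) by (simp flip: power_mult_distrib)
    have v_y: "v (y A - y B) = v t ^ s * v u ^ n * v (x A - x B)" for A B
      by (simp add: y_def mult power flip: right_diff_distrib)
    have inj_x: "x A \<noteq> x B" if AB: "finite A" "finite B" "A \<noteq> B" for A B
    proof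
      assume eq: "x A = x B"
      define R :: "int poly" where "R = (\<Sum>i\<in>A. monom 1 i) - (\<Sum>i\<in>B. monom 1 i)"
      have cR: "coeff R j = (if j \<in> A then 1 else 0) - (if j \<in> B then 1 else 0)" for j
        using AB by (simp add: R_def coeff_sum)
      have "sign_poly R" by (auto simp: sign_poly_def cR)
      moreover have "R \<noteq> 0"
      proof
        assume "R = 0"
        then have "(j \<in> A) = (j \<in> B)" for j using cR[of j] by (auto split: if_splits)
        then show False using AB(3) by blast
      qed
      ultimately have "ipoly R (\<kappa> ^ k) \<noteq> 0" by (rule k(2))
      moreover have "ipoly R (\<kappa> ^ k) = x A - x B"
        by (simp add: R_def x_sum of_int_poly_hom.hom_sum of_int_poly_hom.hom_minus poly_sum map_poly_monom poly_monom power_mult)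
      ultimately show False using eq by simp
    qed
    have ne: "t ^ s * u ^ n \<noteq> 0" using t(2) u(2) by auto
    have inj_y: "inj_on y (Pow {..<m})"
      by (rule inj_onI) (metis (no_types, lifting) PowD finite_lessThan finite_subset inj_x mult_left_cancel ne y_def)
    have "\<exists>z\<in>y ` Pow {..<m}. \<exists>z'\<in>y ` Pow {..<m}. z \<noteq> z' \<and> v (z - z') \<le> 2 * v t ^ (2 * s)"
    proof (rule pigeonhole_close[OF K(1) t(1,2) F])
      show "finite (y ` Pow {..<m})" by simp
      show "y ` Pow {..<m} \<subseteq> K"
      proof
        fix z assume "z \<in> y ` Pow {..<m}"
        then obtain A where A: "A \<subseteq> {..<m}" "z = y A" by auto
        have "x A \<in> K" unfolding x_sum using A(1) Kpow K(2) by (intro Ksum) (auto intro: finite_subset)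
        then show "z \<in> K" unfolding A(2) y_def using Kpow t(1) u(1) K' by auto
      qed
      show "v z \<le> 1" if z: "z \<in> y ` Pow {..<m}" for z
      proof -
        obtain A where A: "A \<subseteq> {..<m}" "z = y A" using z by auto
        have finA: "finite A" using A(1) by (rule finite_subset) simp
        have "v (x A) \<le> (\<Sum>i\<in>A. v (\<kappa> ^ (k * i)))" unfolding x_sum by (rule sum_le[OF finA])
        also have "\<dots> \<le> (\<Sum>i\<in>A. w ^ n)"
        proof (rule sum_mono)
          fix i assume "i \<in> A"
          then have "k * i \<le> n" using A(1) by (auto simp: n_def)
          then have "w ^ (k * i) \<le> w ^ n" by (intro power_increasing) (auto simp: w_def)
          moreover have "v \<kappa> ^ (k * i) \<le> w ^ (k * i)" using nonneg by (intro power_mono) (auto simp: w_def)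
          ultimately show "v (\<kappa> ^ (k * i)) \<le> w ^ n" by simp
        qed
        also have "\<dots> \<le> real m * w ^ n"
          using A(1) card_mono[OF _ A(1)] by (simp add: w_def mult_right_mono)
        finally have "v (x A) \<le> real m * w ^ n" .
        then have "v z \<le> v t ^ s * v u ^ n * (real m * w ^ n)"
          unfolding A(2) y_def mult power using nonneg by (intro mult_left_mono) auto
        also have "\<dots> = real m * v t ^ s" using v_u by simp
        finally show ?thesis using s by (simp add: m_def)
      qed
      have "card F ^ (2 * s) \<le> (2 ^ b) ^ (2 * s)" unfolding b_def
        by (intro power_mono) (auto intro: less_imp_le[OF less_exp])
      also have "\<dots> = 2 ^ (2 * b * s)" by (simp add: mult_ac flip: power_mult)
      also have "\<dots> < 2 ^ m" unfolding m_def by simp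
      finally show "card F ^ (2 * s) < card (y ` Pow {..<m})"
        by (simp add: card_image[OF inj_y] card_Pow)
    qed
    then obtain A B where AB: "A \<subseteq> {..<m}" "B \<subseteq> {..<m}" "y A \<noteq> y B" "v (y A - y B) \<le> 2 * v t ^ (2 * s)" by blast
    have fin: "finite A" "finite B" using AB(1,2) by (auto intro: finite_subset)
    have "v t ^ s * v u ^ n * v (x A - x B) \<le> 2 * v t ^ (2 * s)" using AB(4) v_y by simp
    also have "v t ^ (2 * s) = v t ^ s * v t ^ s" by (simp add: mult_2 power_add)
    finally have "v t ^ s * (v u ^ n * v (x A - x B)) \<le> v t ^ s * (2 * v t ^ s)"
      by (simp only: mult.assoc mult.left_commute[of _ 2])
    then have "v u ^ n * v (x A - x B) \<le> 2 * v t ^ s" using vt by simp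
    then have "w ^ n * (v u ^ n * v (x A - x B)) \<le> w ^ n * (2 * v t ^ s)"
      by (intro mult_left_mono) (auto simp: w_def)
    moreover have "w ^ n * (v u ^ n * v (x A - x B)) = v (x A - x B)" using v_u by (simp add: mult_ac)
    ultimately have "v (x A - x B) \<le> 2 * v t ^ s * w ^ n" by (simp add: mult_ac)
    moreover have "ipoly (P A - P B) \<kappa> = x A - x B" by (simp add: x_def of_int_poly_hom.hom_minus)
    moreover have "degree (P A) \<le> n" if A: "A \<subseteq> {..<m}" for A unfolding P_def
    proof (rule degree_sum_le)
      show "finite A" using A by (rule finite_subset) simp
      fix i assume "i \<in> A"
      then have "k * i \<le> n" using A by (auto simp: n_def)
      then show "degree (monom 1 (k * i) :: int poly) \<le> n" using degree_monom_le order_trans by blast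
    qed
    then have "degree (P A - P B) \<le> n" using AB by (intro degree_diff_le) auto
    moreover have "x A \<noteq> x B" using AB(3) by (auto simp: y_def)
    ultimately show ?thesis using sgn[OF fin]
      by (intro exI[of _ "P A - P B"]) (simp add: n_def m_def)
  qed
  have "eventually (\<lambda>s. real (2 * b * s + 1) * v t ^ s \<le> 1) sequentially"
  proof -
    have "((\<lambda>s. real s * v t ^ s) \<longlongrightarrow> 0) sequentially" using t(3) vt
      by (intro powser_times_n_limit_0) simp
    moreover have "((\<lambda>s. v t ^ s) \<longlongrightarrow> 0) sequentially" using t(3) vt by (intro LIMSEQ_realpow_zero) auto
    ultimately have "((\<lambda>s. 2 * real b * (real s * v t ^ s) + v t ^ s) \<longlongrightarrow> 2 * real b * 0 + 0) sequentially"
      by (intro tendsto_add tendsto_mult tendsto_const)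
    then have "eventually (\<lambda>s. 2 * real b * (real s * v t ^ s) + v t ^ s < 1) sequentially"
      by (rule order_tendstoD) simp
    then show ?thesis by eventually_elim (simp add: algebra_simps)
  qed
  then have "\<forall>\<^sub>F s in sequentially. \<exists>R. sign_poly R \<and> degree R \<le> k * (2 * b * s + 1) \<and>
    ipoly R \<kappa> \<noteq> 0 \<and> v (ipoly R \<kappa>) \<le> 2 * v t ^ s * max 1 (v \<kappa>) ^ (k * (2 * b * s + 1))"
    unfolding w_def[symmetric] by eventually_elim (rule main)
  then show ?thesis using k(1) by blast
qed

end

section \<open>Failure of equidistribution elsewhere\<close>

lemma ln_int_length_le:
  assumes "F \<noteq> 0"
  shows "ln (int_length F) \<le> real (degree F) + ln (mahler F)"
proof -
  have M: "mahler F \<ge> 1" using assms by (rule mahler_ge_1)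
  have "ln (int_length F) \<le> ln (2 ^ degree F * mahler F)"
    using int_length_le_mahler[OF assms] int_length_ge_1[OF assms] by (intro ln_mono) auto
  also have "\<dots> = real (degree F) * ln 2 + ln (mahler F)"
    using M by (simp add: ln_mult_pos ln_realpow)
  also have "real (degree F) * ln 2 \<le> real (degree F) * 1"
    using ln_le_minus_one[of "2::real"] by (intro mult_left_mono) auto
  finally show ?thesis by simp
qed

lemma of_int_poly_const: "of_int_poly [:c:] = [:of_int c:]"
  by (rule poly_eqI) (simp add: coeff_pCons split: nat.split)

lemma mahler_const: "mahler [:c:] = real_of_int \<bar>c\<bar>"
  by (simp add: mahler_def of_int_poly_const)

lemma prod_mset_nonneg_real: "(\<And>x. x \<in># A \<Longrightarrow> f x \<ge> (0::real)) \<Longrightarrow> (\<Prod>x\<in>#A. f x) \<ge> 0"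
  by (induction A) auto

lemma prime_int_poly_lead_pos:
  fixes p :: "int poly"
  assumes "prime p"
  shows "lead_coeff p > 0"
proof -
  have "coeff (unit_factor p) 0 = 1" using unit_factor_prime[OF assms] by simp
  then have "sgn (lead_coeff p) = 1" by (simp add: unit_factor_poly_def)
  then show ?thesis by (simp add: sgn_1_pos)
qed

context field_abs_value
begin

text \<open>
  Liouville's inequality. The resultant of \<open>F\<close> with the minimal polynomial of \<open>\<kappa>\<close> is a nonzero integer
  and the product of the values of \<open>F\<close> at the conjugates of \<open>\<kappa>\<close>. All these values are at most
  exponential in the degree times a power of the Mahler measure.
\<close>
lemma liouville:
  assumes \<kappa>: "algebraic \<kappa>"
  shows "\<exists>C\<ge>0. \<forall>F. F \<noteq> 0 \<longrightarrow> ipoly F \<kappa> \<noteq> 0 \<longrightarrow>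
    - C * (real (degree F) + ln (mahler F)) \<le> ln (v (ipoly F \<kappa>))"
proof -
  define Q where "Q = int_min_poly \<kappa>"
  note Q = int_min_poly_characterization[OF \<kappa>, folded Q_def]
  have Q0: "Q \<noteq> 0" using Q(3) by auto
  define a where "a = real_of_int (lead_coeff Q)"
  have a1: "a \<ge> 1" using Q(3) by (simp add: a_def)
  define d where "d = degree Q"
  define A where "A = proots (of_int_poly Q :: 'a poly)"
  define A' where "A' = proots (of_int_poly Q :: complex poly)"
  have size: "size A = d" "size A' = d"
    using split_over_proots(2)[of "of_int_poly Q :: 'a poly"]
      split_over_proots(2)[of "of_int_poly Q :: complex poly"] Q0 by (auto simp: A_def A'_def d_def)
  define m1 where "m1 = mahler Q"
  define m2 where "m2 = a * (\<Prod>z\<in>#A. max 1 (v z))"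
  have m1: "m1 \<ge> 1" unfolding m1_def using Q0 by (rule mahler_ge_1)
  have "(\<Prod>z\<in>#A. max 1 (v z)) \<ge> 1" by (rule prod_mset_ge_1) simp
  then have m2: "m2 \<ge> 1" using mult_mono[of 1 a 1 "\<Prod>z\<in>#A. max 1 (v z)"] a1 by (simp add: m2_def)
  define C where "C = 2 * real d + ln (m1 * m2)"
  have lnm: "ln (m1 * m2) \<ge> 0" using mult_mono[of 1 m1 1 m2] m1 m2 by simp
  have main: "- C * (real (degree F) + ln (mahler F)) \<le> ln (v (ipoly F \<kappa>))" if F: "F \<noteq> 0" "ipoly F \<kappa> \<noteq> 0" for F
  proof -
    define D where "D = degree F"
    define l where "l = int_length F"
    have l1: "l \<ge> 1" unfolding l_def using F(1) by (rule int_length_ge_1)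
    define R where "R = resultant Q F"
    have RC: "of_int R = of_int (lead_coeff Q) ^ D * (\<Prod>z\<in>#A'. ipoly F z)"
      unfolding R_def A'_def D_def by (rule int_resultant_root_product[OF Q0 F(1)])
    have Rv: "of_int R = of_int (lead_coeff Q) ^ D * (\<Prod>z\<in>#A. ipoly F z)"
      unfolding R_def A_def D_def by (rule int_resultant_root_product[OF Q0 F(1)])
    have R0: "R \<noteq> 0"
    proof
      assume "R = 0"
      then have "(\<Prod>z\<in>#A. ipoly F z) = 0" using Rv Q(3) by auto
      then obtain z where "z \<in># A" "ipoly F z = 0" unfolding prod_mset_zero_iff by auto
      then show False using F(2) irreducible_int_poly_root_transfer[OF Q(1,3) _ _ Q(2), of z F] Q0
        by (simp add: A_def)
    qed
    have "real_of_int \<bar>R\<bar> = cmod (of_int R)" by simp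
    also have "\<dots> = a ^ D * (\<Prod>z\<in>#A'. cmod (ipoly F z))"
      unfolding RC cmod.mult cmod.prod_mset using Q(3) by (simp add: a_def norm_power)
    also have "\<dots> \<le> a ^ D * (\<Prod>z\<in>#A'. l * max 1 (cmod z) ^ D)"
      using cmod.ipoly_le[of F] a1 by (intro mult_left_mono prod_mset_mono_nonneg) (auto simp: l_def D_def)
    also have "\<dots> = l ^ d * m1 ^ D"
    proof -
      have "(\<Prod>z\<in>#A'. max 1 (cmod z) ^ D) = (\<Prod>z\<in>#A'. max 1 (cmod z)) ^ D"
        by (induction A') (simp_all add: power_mult_distrib)
      moreover have "m1 = a * (\<Prod>z\<in>#A'. max 1 (cmod z))" using Q(3) by (simp add: m1_def mahler_def a_def A'_def)
      ultimately show ?thesis by (simp add: prod_mset.distrib size power_mult_distrib)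
    qed
    finally have "real_of_int \<bar>R\<bar> \<le> l ^ d * m1 ^ D" .
    then have "1 / (l ^ d * m1 ^ D) \<le> 1 / real_of_int \<bar>R\<bar>" using R0 l1 m1 by (intro divide_left_mono) auto
    also have "\<dots> \<le> v (of_int R)" by (rule int_lower[OF R0])
    also have "\<dots> \<le> v (ipoly F \<kappa>) * (l ^ d * m2 ^ D)"
    proof -
      have "\<kappa> \<in># A" using Q(2) Q0 by (simp add: A_def)
      then obtain B where B: "A = add_mset \<kappa> B" by (metis mset_add)
      have "(\<Prod>z\<in>#B. v (ipoly F z)) \<le> (\<Prod>z\<in>#B. l * max 1 (v z) ^ D)"
        using ipoly_le[of F] nonneg by (intro prod_mset_mono_nonneg) (auto simp: l_def D_def)
      also have "\<dots> \<le> (l * max 1 (v \<kappa>) ^ D) * (\<Prod>z\<in>#B. l * max 1 (v z) ^ D)"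
      proof -
        have "1 * 1 \<le> l * max 1 (v \<kappa>) ^ D" using l1 by (intro mult_mono one_le_power) auto
        moreover have "1 \<le> (\<Prod>z\<in>#B. l * max 1 (v z) ^ D)"
        proof (rule prod_mset_ge_1)
          fix z
          show "1 \<le> l * max 1 (v z) ^ D" using mult_mono[of 1 l 1 "max 1 (v z) ^ D"] l1 by simp
        qed
        ultimately show ?thesis by (simp add: mult_le_cancel_right1)
      qed
      also have "\<dots> = (\<Prod>z\<in>#A. l * max 1 (v z) ^ D)" by (simp add: B)
      also have "\<dots> = l ^ d * (\<Prod>z\<in>#A. max 1 (v z)) ^ D"
      proof -
        have "(\<Prod>z\<in>#A. max 1 (v z) ^ D) = (\<Prod>z\<in>#A. max 1 (v z)) ^ D"
          by (induction A) (simp_all add: power_mult_distrib)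
        then show ?thesis by (simp add: prod_mset.distrib size)
      qed
      finally have "(\<Prod>z\<in>#B. v (ipoly F z)) \<le> l ^ d * (\<Prod>z\<in>#A. max 1 (v z)) ^ D" .
      moreover have "v (of_int (lead_coeff Q)) ^ D \<le> a ^ D"
        using int_upper[of "lead_coeff Q"] nonneg Q(3) by (intro power_mono) (auto simp: a_def)
      ultimately have "v (of_int (lead_coeff Q)) ^ D * (v (ipoly F \<kappa>) * (\<Prod>z\<in>#B. v (ipoly F z))) \<le>
          a ^ D * (v (ipoly F \<kappa>) * (l ^ d * (\<Prod>z\<in>#A. max 1 (v z)) ^ D))"
        using nonneg a1 by (intro mult_mono mult_left_mono mult_nonneg_nonneg)
          (auto intro!: prod_mset_nonneg_real)
      moreover have "v (of_int R) = v (of_int (lead_coeff Q)) ^ D * (v (ipoly F \<kappa>) * (\<Prod>z\<in>#B. v (ipoly F z)))"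
        unfolding Rv mult prod_mset by (simp add: B)
      ultimately show ?thesis by (simp add: m2_def power_mult_distrib mult_ac)
    qed
    finally have low: "1 / (l ^ d * m1 ^ D) \<le> v (ipoly F \<kappa>) * (l ^ d * m2 ^ D)" .
    have lm: "l ^ d * m1 ^ D > 0" "l ^ d * m2 ^ D > 0" using l1 m1 m2 by auto
    have vpos: "v (ipoly F \<kappa>) > 0" using F(2) by (rule pos)
    have "ln (1 / (l ^ d * m1 ^ D)) \<le> ln (v (ipoly F \<kappa>) * (l ^ d * m2 ^ D))"
      using low lm by (intro ln_mono) auto
    then have "- ln (l ^ d * m1 ^ D) \<le> ln (v (ipoly F \<kappa>)) + ln (l ^ d * m2 ^ D)"
      using lm vpos ln_inverse[of "l ^ d * m1 ^ D"] by (simp add: ln_mult_pos inverse_eq_divide)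
    moreover have "ln (l ^ d * m1 ^ D) = real d * ln l + real D * ln m1"
      using l1 m1 by (simp add: ln_mult_pos ln_realpow)
    moreover have "ln (l ^ d * m2 ^ D) = real d * ln l + real D * ln m2"
      using l1 m2 by (simp add: ln_mult_pos ln_realpow)
    moreover have "ln (m1 * m2) = ln m1 + ln m2" using m1 m2 by (simp add: ln_mult_pos)
    ultimately have "- (2 * real d * ln l + real D * ln (m1 * m2)) \<le> ln (v (ipoly F \<kappa>))"
      by (simp add: algebra_simps)
    moreover have "2 * real d * ln l \<le> 2 * real d * (real D + ln (mahler F))"
      using ln_int_length_le[OF F(1)] unfolding l_def D_def by (intro mult_left_mono) auto
    moreover have "real D * ln (m1 * m2) \<le> (real D + ln (mahler F)) * ln (m1 * m2)"
      using lnm mahler_ge_1[OF F(1)] by (intro mult_right_mono) auto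
    ultimately show ?thesis by (simp add: C_def D_def algebra_simps)
  qed
  have "C \<ge> 0" using lnm by (simp add: C_def)
  then show ?thesis using main by blast
qed

text \<open>
  Degree, logarithmic Mahler measure and logarithm of the value at \<open>\<kappa>\<close> are all additive over products.
  The hypothesis \<open>C \<ge> 1\<close> covers constant factors.
\<close>
lemma factorwise_lower_bound:
  fixes \<kappa> :: 'a
  assumes P: "P \<noteq> 0" "ipoly P \<kappa> \<noteq> 0" and C: "C \<ge> 1"
    and irr: "\<And>F. irreducible F \<Longrightarrow> lead_coeff F > 0 \<Longrightarrow> degree F > 0 \<Longrightarrow> F dvd P \<Longrightarrow>
      L * real (degree F) - C * ln (mahler F) \<le> ln (v (ipoly F \<kappa>))"
  shows "L * real (degree P) - C * ln (mahler P) \<le> ln (v (ipoly P \<kappa>))"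
proof -
  have const: "L * real (degree [:c:]) - C * ln (mahler [:c:]) \<le> ln (v (ipoly [:c:] \<kappa>))" if "c \<noteq> 0" for c
  proof -
    have "1 * ln (real_of_int \<bar>c\<bar>) \<le> C * ln (real_of_int \<bar>c\<bar>)"
      using C that by (intro mult_right_mono) auto
    moreover have "ipoly [:c:] \<kappa> = of_int c" by (simp add: of_int_poly_const)
    ultimately show ?thesis using abs_ln_int[OF that] by (simp add: mahler_const)
  qed
  have "x dvd P \<longrightarrow> L * real (degree x) - C * ln (mahler x) \<le> ln (v (ipoly x \<kappa>))" for x
  proof (induction x rule: prime_divisors_induct)
    case zero
    then show ?case using P by simp
  next
    case (unit x)
    then obtain c where "x = [:c:]" "c \<noteq> 0" by (auto simp: is_unit_poly_iff)
    then show ?case using const by blast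
  next
    case (factor p x)
    show ?case
    proof
      assume px: "p * x dvd P"
      then have dvd: "p dvd P" "x dvd P" by (auto intro: dvd_mult_left dvd_mult_right)
      obtain e where e: "P = p * x * e" using px by (elim dvdE)
      have "ipoly P \<kappa> = ipoly p \<kappa> * ipoly x \<kappa> * ipoly e \<kappa>" unfolding e by (simp add: of_int_poly_hom.hom_mult)
      then have ne: "p \<noteq> 0" "x \<noteq> 0" "ipoly p \<kappa> \<noteq> 0" "ipoly x \<kappa> \<noteq> 0"
        using P(2) by auto
      have p: "L * real (degree p) - C * ln (mahler p) \<le> ln (v (ipoly p \<kappa>))"
      proof (cases "degree p = 0")
        case True
        then obtain c where "p = [:c:]" by (rule degree_eq_zeroE)
        then show ?thesis using const ne(1) by simp
      next
        case False
        then show ?thesis using factor.hyps dvd(1) prime_int_poly_lead_pos[OF factor.hyps]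
          by (intro irr) (auto simp: prime_def prime_elem_imp_irreducible)
      qed
      have "mahler p > 0" "mahler x > 0" using mahler_ge_1[OF ne(1)] mahler_ge_1[OF ne(2)] by simp_all
      then have e1: "ln (mahler (p * x)) = ln (mahler p) + ln (mahler x)"
        using ne by (simp add: mahler_mult ln_mult_pos)
      have e2: "ln (v (ipoly (p * x) \<kappa>)) = ln (v (ipoly p \<kappa>)) + ln (v (ipoly x \<kappa>))"
        unfolding of_int_poly_hom.hom_mult poly_mult mult by (rule ln_mult_pos[OF pos[OF ne(3)] pos[OF ne(4)]])
      have e3: "degree (p * x) = degree p + degree x" using ne by (simp add: degree_mult_eq)
      have "L * real (degree x) - C * ln (mahler x) \<le> ln (v (ipoly x \<kappa>))" using factor.IH dvd(2) by blast
      then show "L * real (degree (p * x)) - C * ln (mahler (p * x)) \<le> ln (v (ipoly (p * x) \<kappa>))"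
        using p unfolding e1 e2 e3 of_nat_add distrib_left by linarith
    qed
  qed
  from this[THEN mp, OF dvd_refl] show ?thesis .
qed

end

text \<open>
  Each \<open>\<beta>\<close> rules out at most one \<open>c\<close>.
\<close>
lemma avoid_roots:
  fixes a b :: "complex \<Rightarrow> complex"
  assumes "finite B"
  shows "\<exists>c\<in>{1..int (card B) + 1}. \<forall>\<beta>\<in>B. b \<beta> \<noteq> 0 \<longrightarrow> a \<beta> + of_int c * b \<beta> \<noteq> 0"
proof (rule ccontr)
  assume "\<not> ?thesis"
  then have "\<forall>c\<in>{1..int (card B) + 1}. \<exists>\<beta>\<in>B. b \<beta> \<noteq> 0 \<and> a \<beta> + of_int c * b \<beta> = 0" by blast
  then obtain g where g: "\<And>c. c \<in> {1..int (card B) + 1} \<Longrightarrow> g c \<in> B \<and> b (g c) \<noteq> 0 \<and> a (g c) + of_int c * b (g c) = 0"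
    by metis
  have "inj_on g {1..int (card B) + 1}"
  proof (rule inj_onI)
    fix c c' assume c: "c \<in> {1..int (card B) + 1}" "c' \<in> {1..int (card B) + 1}" "g c = g c'"
    then have "of_int c * b (g c) = of_int c' * b (g c)" "b (g c) \<noteq> 0"
      using g[OF c(1)] g[OF c(2)] by (metis add_left_cancel)+
    then show "c = c'" by simp
  qed
  moreover have "g ` {1..int (card B) + 1} \<subseteq> B" using g by blast
  ultimately have "card {1..int (card B) + 1} \<le> card B" using card_inj_on_le assms by blast
  then show False by simp
qed

context field_abs_value
begin

text \<open>
  The set \<open>S\<close> consists of the polynomials of small degree and small height, which the equidistribution
  property does not control, and \<open>B\<close> is the set of their roots. It does not depend on the parameter
  \<open>s\<close>, so the coefficients \<open>c\<close> and \<open>c'\<close> that keep \<open>P\<close> from vanishing on \<open>B\<close> stay bounded and the Mahler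
  measure of \<open>P\<close> grows only polynomially in \<open>s\<close>, whereas \<open>R(\<kappa>)\<close> decreases exponentially.
\<close>
theorem not_equidistributes:
  assumes \<kappa>: "algebraic \<kappa>" "\<kappa> \<noteq> 0" "\<kappa> \<notin> roots_of_unity"
    and K: "is_subfield K" "\<kappa> \<in> K" and t: "t \<in> K" "t \<noteq> 0" "v t < 1"
    and F: "finite F" "F \<subseteq> K" "\<And>x. x \<in> K \<Longrightarrow> v x \<le> 1 \<Longrightarrow> \<exists>f\<in>F. v (x - f) \<le> v t"
  shows "\<not> equidistributes \<kappa>"
proof
  assume equi: "equidistributes \<kappa>"
  define Q where "Q = int_min_poly \<kappa>"
  note Q = int_min_poly_characterization[OF \<kappa>(1), folded Q_def]
  have Q0: "Q \<noteq> 0" using Q(3) by auto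
  define d where "d = degree Q"
  define L where "L = ln (max 1 (v \<kappa>))"
  have L0: "L \<ge> 0" by (simp add: L_def)
  have vt: "v t > 0" using t(2) by (rule pos)
  define c0 where "c0 = - ln (v t)"
  have c0: "c0 > 0" using vt t(3) by (simp add: c0_def ln_less_zero)
  obtain k b where k: "k > 0" and small: "\<forall>\<^sub>F s in sequentially. \<exists>R. sign_poly R \<and> degree R \<le> k * (2 * b * s + 1) \<and>
    ipoly R \<kappa> \<noteq> 0 \<and> v (ipoly R \<kappa>) \<le> 2 * v t ^ s * max 1 (v \<kappa>) ^ (k * (2 * b * s + 1))"
    using ex_small_sign_poly[OF \<kappa> K t F] by blast
  \<comment> \<open>As \<open>n = k (2 b s + 1)\<close>, an error of \<open>\<epsilon> n\<close> uses up at most half of the gain \<open>s c0\<close>.\<close>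
  define \<epsilon> where "\<epsilon> = c0 / (4 * real k * real b + 1)"
  have \<epsilon>: "\<epsilon> > 0" using c0 by (simp add: \<epsilon>_def add_nonneg_pos)
  have \<epsilon>b: "\<epsilon> * (2 * real k * real b) \<le> c0 / 2"
  proof -
    have "\<epsilon> * (2 * real k * real b) = c0 * (2 * real k * real b / (4 * real k * real b + 1))" by (simp add: \<epsilon>_def)
    also have "2 * real k * real b / (4 * real k * real b + 1) \<le> 1 / 2"
    proof -
      have "4 * real k * real b + 1 > 0" by (simp add: add_nonneg_pos)
      then show ?thesis by (simp only: pos_divide_le_eq) simp
    qed
    finally show ?thesis using c0 by simp
  qed
  obtain \<delta> T where \<delta>: "\<delta> > 0" and good: "\<And>P. low_height \<delta> T P \<Longrightarrow> ipoly P \<kappa> \<noteq> 0 \<Longrightarrow>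
    \<bar>deviation \<kappa> P\<bar> \<le> \<epsilon> * real (degree P)"
    using equi \<epsilon> unfolding equidistributes_def by meson
  obtain C1 where C1: "C1 \<ge> 0" "\<And>F. F \<noteq> 0 \<Longrightarrow> ipoly F \<kappa> \<noteq> 0 \<Longrightarrow>
    - C1 * (real (degree F) + ln (mahler F)) \<le> ln (v (ipoly F \<kappa>))"
    using liouville[OF \<kappa>(1)] by blast
  \<comment> \<open>For a factor of height above \<open>\<delta>\<close> the degree is at most \<open>ln M / \<delta>\<close>; with this \<open>C\<close> the term \<open>C ln M\<close>
    absorbs both the loss in Liouville's inequality and the main term \<open>L D\<close>.\<close>
  define C where "C = 1 + C1 * (1 / \<delta> + 1) + L / \<delta>"
  have C: "C \<ge> 1" using C1(1) \<delta> L0 by (simp add: C_def)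
  define S where "S = {F. degree F \<le> T \<and> mahler F \<le> exp (\<delta> * real T)} - {0}"
  have finS: "finite S" unfolding S_def using finite_polys_bounded_mahler by blast
  define B where "B = (\<Union>F\<in>S. {\<beta>::complex. ipoly F \<beta> = 0})"
  have finB: "finite B" unfolding B_def
    using finS by (intro finite_UN_I poly_roots_finite) (auto simp: S_def)
  define X where "X = (real (card B) + 2) * int_length Q"
  have X0: "X > 0" using int_length_ge_1[OF Q0] by (simp add: X_def)
  have Q_0: "ipoly Q (0::complex) \<noteq> 0"
  proof
    assume "ipoly Q (0::complex) = 0"
    then show False using irreducible_int_poly_root_transfer[OF Q(1,3) _ _ Q(2), of 0 "[:0, 1:]"] \<kappa>(2) by simp
  qed
  have main: "real s * c0 \<le> \<epsilon> * (real n + real d) + ln 2 + C * ln (real n + 1 + X)"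
    if n: "n = k * (2 * b * s + 1)" and R: "sign_poly R" "degree R \<le> n" "ipoly R \<kappa> \<noteq> 0"
      "v (ipoly R \<kappa>) \<le> 2 * v t ^ s * max 1 (v \<kappa>) ^ n" for n s R
  proof -
    have n0: "n > 0" using k n by simp
    \<comment> \<open>The root 0 needs its own summand \<open>c' Q\<close>, because \<open>c X\<^sup>n Q\<close> vanishes there.\<close>
    define c' :: int where "c' = (if ipoly R (0::complex) = 0 then 1 else 0)"
    obtain c where c: "c \<in> {1..int (card B) + 1}" "\<And>\<beta>. \<beta> \<in> B \<Longrightarrow> \<beta> ^ n * ipoly Q \<beta> \<noteq> 0 \<Longrightarrow>
        (ipoly R \<beta> + of_int c' * ipoly Q \<beta>) + of_int c * (\<beta> ^ n * ipoly Q \<beta>) \<noteq> 0"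
      using avoid_roots[OF finB, of "\<lambda>\<beta>. \<beta> ^ n * ipoly Q \<beta>" "\<lambda>\<beta>. ipoly R \<beta> + of_int c' * ipoly Q \<beta>"] by blast
    define W where "W = monom c n + [:c':]"
    define P where "P = R + W * Q"
    have P\<kappa>: "ipoly P \<kappa> = ipoly R \<kappa>"
      by (simp add: P_def W_def of_int_poly_hom.hom_add of_int_poly_hom.hom_mult Q(2))
    have PC: "ipoly P x = ipoly R x + (of_int c * x ^ n + of_int c') * ipoly Q x" for x :: complex
      by (simp add: P_def W_def of_int_poly_hom.hom_add of_int_poly_hom.hom_mult of_int_poly_const map_poly_monom poly_monom)
    have degW: "degree W = n" unfolding W_def using n0 c(1)
      by (subst degree_add_eq_left) (auto simp: degree_monom_eq)
    then have W0: "W \<noteq> 0" using n0 by auto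
    have "degree (W * Q) = n + d" using W0 Q0 degW by (simp add: degree_mult_eq d_def)
    then have degP: "degree P = n + d" unfolding P_def using R(2) Q(6)
      by (subst degree_add_eq_right) (auto simp: d_def)
    then have P0: "P \<noteq> 0" using n0 by auto
    have P_0: "ipoly P (0::complex) \<noteq> 0"
    proof -
      have "ipoly P (0::complex) = ipoly R 0 + of_int c' * ipoly Q 0" unfolding PC using n0 by (simp add: zero_power)
      then show ?thesis using Q_0 unfolding c'_def by (cases "ipoly R (0::complex) = 0") simp_all
    qed
    have lenR: "int_length R \<le> real n + 1" using sign_poly_int_length[OF R(1)] R(2) by simp
    have MP: "mahler P \<le> real n + 1 + X"
    proof (rule mahler_le_circle_bound[OF P0])
      show "1 \<le> real n + 1 + X" using X0 by simp
      fix z :: complex assume z: "cmod z = 1"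
      have "cmod (ipoly R z) \<le> real n + 1" using cmod.ipoly_le[of R z] z lenR by simp
      moreover have "cmod (of_int c * z ^ n + of_int c') \<le> real (card B) + 2"
      proof -
        have "cmod (of_int c * z ^ n + of_int c') \<le> \<bar>real_of_int c\<bar> * 1 + \<bar>real_of_int c'\<bar>"
          using norm_triangle_ineq[of "of_int c * z ^ n" "of_int c'"] z by (simp add: norm_mult norm_power)
        moreover have "real_of_int c \<le> real (card B) + 1" "real_of_int c \<ge> 1"
        proof -
          have "c \<le> int (card B) + 1" "c \<ge> 1" using c(1) by auto
          then show "real_of_int c \<le> real (card B) + 1" "real_of_int c \<ge> 1" by linarith+
        qed
        moreover have "\<bar>real_of_int c'\<bar> \<le> 1" by (simp add: c'_def)
        ultimately show ?thesis by linarith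
      qed
      moreover have "cmod (ipoly Q z) \<le> int_length Q" using cmod.ipoly_le[of Q z] z by simp
      ultimately have "cmod (ipoly R z) + cmod (of_int c * z ^ n + of_int c') * cmod (ipoly Q z) \<le>
          real n + 1 + (real (card B) + 2) * int_length Q"
        by (intro add_mono mult_mono) auto
      then show "cmod (ipoly P z) \<le> real n + 1 + X"
        unfolding PC X_def using norm_triangle_ineq[of "ipoly R z" "(of_int c * z ^ n + of_int c') * ipoly Q z"]
        by (simp add: norm_mult)
    qed
    have "(L - \<epsilon>) * real (degree P) - C * ln (mahler P) \<le> ln (v (ipoly P \<kappa>))"
    proof (rule factorwise_lower_bound[OF P0 _ C])
      show "ipoly P \<kappa> \<noteq> 0" using R(3) P\<kappa> by simp
      fix G assume G: "irreducible G" "lead_coeff G > 0" "degree G > 0" "G dvd P"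
      have G0: "G \<noteq> 0" using G by auto
      obtain H where H: "P = G * H" using G(4) by (elim dvdE)
      have G\<kappa>: "ipoly G \<kappa> \<noteq> 0" using R(3) P\<kappa> unfolding H by (auto simp: of_int_poly_hom.hom_mult)
      define D where "D = real (degree G)"
      define M where "M = ln (mahler G)"
      have M0: "M \<ge> 0" unfolding M_def using mahler_ge_1[OF G0] by simp
      have D0: "D \<ge> 0" by (simp add: D_def)
      have "(L - \<epsilon>) * D - C * M \<le> ln (v (ipoly G \<kappa>))"
      proof (cases "M \<le> \<delta> * D")
        case False
        then have DM: "D \<le> M / \<delta>" using \<delta> by (simp add: field_simps)
        have "(L - \<epsilon>) * D \<le> L * D" using \<epsilon> D0 by (simp add: left_diff_distrib)
        also have "\<dots> \<le> L * (M / \<delta>)" using DM L0 by (rule mult_left_mono)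
        finally have "(L - \<epsilon>) * D \<le> L / \<delta> * M" by simp
        moreover have "C1 * (D + M) \<le> C1 * (1 / \<delta> + 1) * M"
          using mult_left_mono[OF DM C1(1)] by (simp add: algebra_simps)
        moreover have "- C1 * (D + M) \<le> ln (v (ipoly G \<kappa>))" unfolding D_def M_def by (rule C1(2)[OF G0 G\<kappa>])
        ultimately show ?thesis using M0 by (simp add: C_def algebra_simps)
      next
        case True
        have "degree G > T"
        proof (rule ccontr)
          assume "\<not> degree G > T"
          then have GT: "degree G \<le> T" by simp
          have "\<delta> * D \<le> \<delta> * real T" using GT \<delta> by (intro mult_left_mono) (simp_all add: D_def)
          then have "exp M \<le> exp (\<delta> * real T)" using True by simp
          moreover have "exp M = mahler G" unfolding M_def using mahler_ge_1[OF G0] by simp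
          ultimately have "mahler G \<le> exp (\<delta> * real T)" by simp
          then have GS: "G \<in> S" using GT G0 by (simp add: S_def)
          have "degree (of_int_poly G :: complex poly) > 0" using G(3) by simp
          then obtain \<beta> :: complex where \<beta>: "ipoly G \<beta> = 0" using alg_closed_imp_poly_has_root by blast
          then have P\<beta>: "ipoly P \<beta> = 0" unfolding H by (simp add: of_int_poly_hom.hom_mult)
          have "\<beta> \<noteq> 0" using P\<beta> P_0 by auto
          moreover have "ipoly Q \<beta> \<noteq> 0"
          proof
            assume Q\<beta>: "ipoly Q \<beta> = 0"
            then have "ipoly R \<beta> = 0" using P\<beta> PC[of \<beta>] by simp
            then show False using irreducible_int_poly_root_transfer[OF Q(1,3) Q\<beta> _ Q(2)] R(3) by blast
          qed
          moreover have "\<beta> \<in> B" using GS \<beta> by (auto simp: B_def)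
          ultimately have "ipoly R \<beta> + of_int c' * ipoly Q \<beta> + of_int c * (\<beta> ^ n * ipoly Q \<beta>) \<noteq> 0"
            using c(2) by simp
          then show False using P\<beta> unfolding PC by (simp add: algebra_simps)
        qed
        then have "\<bar>ln (v (ipoly G \<kappa>)) - ln (v (of_int (lead_coeff G))) - D * L\<bar> \<le> \<epsilon> * D"
          using good[OF _ G\<kappa>] G True by (simp add: low_height_def deviation_def L_def D_def M_def)
        moreover have "\<bar>ln (v (of_int (lead_coeff G)))\<bar> \<le> M" unfolding M_def by (rule abs_ln_lead_le[OF G0])
        moreover have "1 * M \<le> C * M" using C M0 by (rule mult_right_mono)
        ultimately show ?thesis by (simp add: left_diff_distrib mult.commute[of D] abs_le_iff)
      qed
      then show "(L - \<epsilon>) * real (degree G) - C * ln (mahler G) \<le> ln (v (ipoly G \<kappa>))" by (simp add: D_def M_def)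
    qed
    also have "\<dots> \<le> ln (2 * v t ^ s * max 1 (v \<kappa>) ^ n)"
      unfolding P\<kappa> using R(3,4) pos by (intro ln_mono) auto
    also have "\<dots> = ln 2 - real s * c0 + real n * L"
      using vt by (simp add: ln_mult_pos ln_realpow c0_def L_def)
    finally have "(L - \<epsilon>) * (real n + real d) - C * ln (mahler P) \<le> ln 2 - real s * c0 + real n * L"
      by (simp add: degP)
    moreover have "C * ln (mahler P) \<le> C * ln (real n + 1 + X)"
      using C mahler_ge_1[OF P0] MP by (intro mult_left_mono ln_mono) auto
    moreover have "L * real d \<ge> 0" using L0 by simp
    ultimately show ?thesis by (simp add: algebra_simps)
  qed
  define Z where "Z = 2 * real k * real b + real k + 1 + X"
  define Y where "Y = \<epsilon> * (real k + real d) + ln 2"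
  have Z0: "Z > 0" using X0 by (simp add: Z_def add_nonneg_pos)
  have "eventually (\<lambda>s::nat. Y + C * ln (Z * (real s + 1)) < c0 / 2 * real s) sequentially"
    using Z0 c0 by real_asymp
  then have "eventually (\<lambda>s::nat. False) sequentially" using small
  proof eventually_elim
    case (elim s)
    define n where "n = k * (2 * b * s + 1)"
    obtain R where R: "sign_poly R" "degree R \<le> n" "ipoly R \<kappa> \<noteq> 0" "v (ipoly R \<kappa>) \<le> 2 * v t ^ s * max 1 (v \<kappa>) ^ n"
      using elim(2) unfolding n_def by blast
    have n: "real n = 2 * real k * real b * real s + real k" by (simp add: n_def algebra_simps)
    have "real n + 1 + X \<le> Z * (real s + 1)" unfolding n Z_def using X0 by (simp add: algebra_simps)
    then have "C * ln (real n + 1 + X) \<le> C * ln (Z * (real s + 1))"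
      using C X0 by (intro mult_left_mono ln_mono) auto
    moreover have "\<epsilon> * (real n + real d) \<le> c0 / 2 * real s + \<epsilon> * (real k + real d)"
      using mult_right_mono[OF \<epsilon>b, of "real s"] unfolding n by (simp add: algebra_simps)
    moreover have "real s * c0 \<le> \<epsilon> * (real n + real d) + ln 2 + C * ln (real n + 1 + X)"
      by (rule main[OF n_def R])
    ultimately have "real s * c0 \<le> c0 / 2 * real s + Y + C * ln (Z * (real s + 1))" by (simp add: Y_def)
    then show False using elim(1) by (simp add: field_simps)
  qed
  then show False by simp
qed

end

section \<open>From polynomials to sequences of algebraic numbers\<close>

lemma weil_height_eq:
  assumes "algebraic x"
  shows "weil_height x = ln (mahler (int_min_poly x)) / real (degree (int_min_poly x))"
proof -
  have "int_min_poly x \<noteq> 0" using int_min_poly_lead[OF assms] by auto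
  then show ?thesis by (simp add: weil_height_def log_mahler_measure_eq)
qed

lemma weil_height_nonneg: "algebraic x \<Longrightarrow> weil_height x \<ge> 0"
proof -
  assume x: "algebraic x"
  have "int_min_poly x \<noteq> 0" using int_min_poly_lead[OF x] by auto
  then show ?thesis using mahler_ge_1 by (simp add: weil_height_eq[OF x])
qed

lemma ex_root_irreducible_int_poly:
  assumes "irreducible P" "lead_coeff P > 0" "degree P > 0"
  shows "\<exists>x::'a::{alg_closed_field, field_char_0}. algebraic x \<and> int_min_poly x = P"
proof -
  have "degree (of_int_poly P :: 'a poly) > 0" using assms(3) by simp
  then obtain x :: 'a where "ipoly P x = 0" using alg_closed_imp_poly_has_root by blast
  then show ?thesis using irreducible_int_poly_root[OF assms(1) _ assms(2)] by blast
qed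

text \<open>
  Northcott's theorem for algebraic numbers.
\<close>
lemma finite_bounded_height_degree:
  "finite {x::'a::field_char_0. algebraic x \<and> degree (int_min_poly x) \<le> T \<and> weil_height x \<le> h}"
proof -
  define S where "S = {P. degree P \<le> T \<and> mahler P \<le> exp (max h 0 * real T)} - {0}"
  have "finite S" unfolding S_def using finite_polys_bounded_mahler by blast
  moreover have "{x::'a. algebraic x \<and> degree (int_min_poly x) \<le> T \<and> weil_height x \<le> h} \<subseteq>
      (\<Union>P\<in>S. {x. ipoly P x = 0})"
  proof
    fix x :: 'a assume "x \<in> {x. algebraic x \<and> degree (int_min_poly x) \<le> T \<and> weil_height x \<le> h}"
    then have x: "algebraic x" "degree (int_min_poly x) \<le> T" "weil_height x \<le> h" by auto
    define P where "P = int_min_poly x"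
    note P = int_min_poly_characterization[OF x(1), folded P_def]
    have P0: "P \<noteq> 0" using P(3) by auto
    have "ln (mahler P) = weil_height x * real (degree P)"
      using P(6) by (simp add: weil_height_eq[OF x(1)] P_def)
    also have "\<dots> \<le> max h 0 * real T" using x(2,3) by (intro mult_mono) (auto simp: P_def)
    finally have "exp (ln (mahler P)) \<le> exp (max h 0 * real T)" by (simp only: exp_le_cancel_iff)
    moreover have "exp (ln (mahler P)) = mahler P" using mahler_ge_1[OF P0] by simp
    ultimately have "mahler P \<le> exp (max h 0 * real T)" by (simp only:)
    then have "P \<in> S" using x(2) P0 by (simp add: S_def P_def)
    then show "x \<in> (\<Union>P\<in>S. {x. ipoly P x = 0})" using P(2) by blast
  qed
  moreover have "finite (\<Union>P\<in>S. {x::'a. ipoly P x = 0})"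
    by (intro finite_UN_I \<open>finite S\<close> poly_roots_finite) (simp add: S_def)
  ultimately show ?thesis using finite_subset by blast
qed

lemma algebraic_root_of_unity: "x \<in> roots_of_unity \<Longrightarrow> algebraic (x::'a::field_char_0)"
proof -
  assume "x \<in> roots_of_unity"
  then obtain n where "n > 0" "x ^ n = 1" by (auto simp: roots_of_unity_def)
  then show "algebraic x" using unity_poly_nonzero[of n]
    by (intro algebraic_ipoly_root[of "unity_poly n"]) (auto simp: ipoly_unity_poly)
qed

context field_abs_value
begin

lemma log_average_close_iff:
  assumes x: "algebraic x" and \<kappa>: "ipoly (int_min_poly x) \<kappa> \<noteq> 0"
  defines "P \<equiv> int_min_poly x"
  shows "\<bar>log_average v \<kappa> x - ln (max 1 (v \<kappa>))\<bar> \<le> \<epsilon> \<longleftrightarrow> \<bar>deviation \<kappa> P\<bar> \<le> \<epsilon> * real (degree P)"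
proof -
  define D where "D = real (degree P)"
  have D: "D > 0" using int_min_poly_degree[OF x] by (simp add: D_def P_def)
  define y where "y = ln (v (ipoly P \<kappa>)) - ln (v (of_int (lead_coeff P)))"
  have "log_average v \<kappa> x = y / D" using log_average_eq[OF x \<kappa>] by (simp add: y_def D_def P_def)
  then have "log_average v \<kappa> x - ln (max 1 (v \<kappa>)) = deviation \<kappa> P / D"
    using D by (simp add: deviation_def y_def D_def field_simps)
  then have "\<bar>log_average v \<kappa> x - ln (max 1 (v \<kappa>))\<bar> = \<bar>deviation \<kappa> P\<bar> / D" using D by simp
  then show ?thesis using D unfolding D_def[symmetric] by (simp add: pos_divide_le_eq)
qed

text \<open>
  Over an algebraically closed field, irreducible integer polynomials of positive degree are exactly the
  minimal polynomials of algebraic numbers, up to sign.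
\<close>
lemma equidistributes_iff_numbers:
  assumes \<kappa>: "algebraic \<kappa>"
  shows "equidistributes \<kappa> \<longleftrightarrow> (\<forall>\<epsilon>>0. \<exists>\<delta>>0. \<exists>T. \<forall>x. algebraic x \<longrightarrow> \<not> conjugate_over_Q x \<kappa> \<longrightarrow>
    degree (int_min_poly x) > T \<longrightarrow> weil_height x \<le> \<delta> \<longrightarrow> \<bar>log_average v \<kappa> x - ln (max 1 (v \<kappa>))\<bar> \<le> \<epsilon>)"
    (is "_ \<longleftrightarrow> (\<forall>\<epsilon>>0. ?R \<epsilon>)")
proof -
  let ?L = "ln (max 1 (v \<kappa>))"
  have "(\<exists>\<delta>>0. \<exists>T. \<forall>P. low_height \<delta> T P \<longrightarrow> ipoly P \<kappa> \<noteq> 0 \<longrightarrow>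
      \<bar>deviation \<kappa> P\<bar> \<le> \<epsilon> * real (degree P)) \<longleftrightarrow> ?R \<epsilon>" for \<epsilon>
  proof -
    have "(\<forall>P. low_height \<delta> T P \<longrightarrow> ipoly P \<kappa> \<noteq> 0 \<longrightarrow> \<bar>deviation \<kappa> P\<bar> \<le> \<epsilon> * real (degree P)) \<longleftrightarrow>
      (\<forall>x. algebraic x \<longrightarrow> \<not> conjugate_over_Q x \<kappa> \<longrightarrow>
        degree (int_min_poly x) > T \<longrightarrow> weil_height x \<le> \<delta> \<longrightarrow> \<bar>log_average v \<kappa> x - ?L\<bar> \<le> \<epsilon>)"
      (is "(\<forall>P. ?A P) \<longleftrightarrow> (\<forall>x. ?B x)") for \<delta> T
    proof
      assume A: "\<forall>P. ?A P"
      show "\<forall>x. ?B x"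
      proof (intro allI impI)
        fix x assume x: "algebraic x" "\<not> conjugate_over_Q x \<kappa>" "degree (int_min_poly x) > T" "weil_height x \<le> \<delta>"
        note P = int_min_poly_characterization[OF x(1)]
        have P\<kappa>: "ipoly (int_min_poly x) \<kappa> \<noteq> 0" using x(2) conjugate_over_Q_iff[OF x(1) \<kappa>] by simp
        have "low_height \<delta> T (int_min_poly x)"
          using x(3,4) P(1,3,6) by (simp add: low_height_def weil_height_eq[OF x(1)] pos_divide_le_eq)
        then show "\<bar>log_average v \<kappa> x - ?L\<bar> \<le> \<epsilon>"
          unfolding log_average_close_iff[OF x(1) P\<kappa>] using A P\<kappa> by blast
      qed
    next
      assume B: "\<forall>x. ?B x"
      show "\<forall>P. ?A P"
      proof (intro allI impI)
        fix P assume low: "low_height \<delta> T P" and P\<kappa>: "ipoly P \<kappa> \<noteq> 0"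
        then have P: "irreducible P" "lead_coeff P > 0" "degree P > T" "ln (mahler P) \<le> \<delta> * real (degree P)"
          by (auto simp: low_height_def)
        obtain x :: 'a where x: "algebraic x" "int_min_poly x = P"
          using ex_root_irreducible_int_poly[OF P(1,2)] P(3) by fastforce
        have nc: "\<not> conjugate_over_Q x \<kappa>" using conjugate_over_Q_iff[OF x(1) \<kappa>] P\<kappa> x(2) by simp
        have "weil_height x \<le> \<delta>"
          using P(3,4) by (simp add: weil_height_eq[OF x(1)] x(2) pos_divide_le_eq)
        then have "\<bar>log_average v \<kappa> x - ?L\<bar> \<le> \<epsilon>" using B x P(3) nc by blast
        then show "\<bar>deviation \<kappa> P\<bar> \<le> \<epsilon> * real (degree P)"
          using log_average_close_iff[OF x(1), of \<kappa> \<epsilon>] P\<kappa> x(2) by simp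
      qed
    qed
    then show ?thesis by presburger
  qed
  then show ?thesis unfolding equidistributes_def by presburger
qed

text \<open>
  The two inputs that depend on the place: an upper bound at roots of unity, and total boundedness of
  the unit ball of a field \<open>K\<close> that contains \<open>\<kappa>\<close>.
\<close>
theorem equidistributes_iff:
  assumes \<kappa>: "algebraic \<kappa>"
    and upper: "\<And>\<epsilon>. \<epsilon> > 0 \<Longrightarrow> \<exists>\<delta>>0. \<exists>T. \<forall>P \<zeta>. low_height \<delta> T P \<longrightarrow> \<zeta> \<in> roots_of_unity \<longrightarrow>
      v (ipoly P \<zeta>) \<le> exp (\<epsilon> * real (degree P))"
    and K: "is_subfield K" "\<kappa> \<in> K" and t: "t \<in> K" "t \<noteq> 0" "v t < 1"
    and F: "finite F" "F \<subseteq> K" "\<And>x. x \<in> K \<Longrightarrow> v x \<le> 1 \<Longrightarrow> \<exists>f\<in>F. v (x - f) \<le> v t"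
  shows "equidistributes \<kappa> \<longleftrightarrow> \<kappa> \<in> {0} \<union> roots_of_unity"
  using not_equidistributes[OF \<kappa> _ _ K t F] equidistributes_0 equidistributes_root_of_unity[OF upper] by blast

end

section \<open>The archimedean place\<close>

text \<open>
  Here \<open>K\<close> is the whole complex plane, and the closed unit disc is compact.
\<close>
lemma complex_equidistributes_iff:
  assumes "algebraic \<kappa>"
  shows "cmod.equidistributes \<kappa> \<longleftrightarrow> \<kappa> \<in> {0} \<union> roots_of_unity"
proof -
  obtain F where F: "finite F" "cball (0::complex) 1 \<subseteq> (\<Union>c\<in>F. ball c (1/2))"
    using finite_cover_unit_disc by blast
  have cover: "\<exists>f\<in>F. cmod (x - f) \<le> cmod (1/2)" if "cmod x \<le> 1" for x
  proof -
    have "x \<in> cball 0 1" using that by simp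
    then obtain f where "f \<in> F" "x \<in> ball f (1/2)" using F(2) by blast
    then show ?thesis by (intro bexI[of _ f]) (auto simp: dist_norm norm_minus_commute less_imp_le)
  qed
  have upper: "\<exists>\<delta>>0. \<exists>T. \<forall>P \<zeta>. low_height \<delta> T P \<longrightarrow> \<zeta> \<in> roots_of_unity \<longrightarrow>
      cmod (ipoly P \<zeta>) \<le> exp (\<epsilon> * real (degree P))" if "\<epsilon> > 0" for \<epsilon>
    using circle_bound[OF that] cmod.root_of_unity_abs by meson
  show ?thesis
    by (rule cmod.equidistributes_iff[OF assms upper, of UNIV "1/2" F])
      (use F(1) cover in \<open>auto simp: is_subfield_def\<close>)
qed

lemma integral_log_dist_circle:
  "integral {0..1} (\<lambda>t. ln (cmod (exp (2 * pi * \<i> * of_real t) - \<kappa>))) = ln (max 1 (cmod \<kappa>))"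
  using integral_unique[OF jensen_linear[of \<kappa>]] by (simp add: unit_circle_def)

text \<open>
  If equidistribution fails, there are counterexamples of degree above \<open>n\<close> and height at most
  \<open>1 / (n + 1)\<close> for each \<open>n\<close>, and they form a strict sequence. Conversely, along a strict sequence of
  heights tending to 0 the degrees tend to infinity by Northcott's theorem.
\<close>
lemma K_inf_iff: "\<kappa> \<in> K_inf \<longleftrightarrow> algebraic \<kappa> \<and> cmod.equidistributes \<kappa>"
proof (cases "algebraic \<kappa>")
  case False
  then show ?thesis by (simp add: K_inf_def)
next
  case alg: True
  let ?L = "ln (max 1 (cmod \<kappa>))"
  have K: "\<kappa> \<in> K_inf \<longleftrightarrow> (\<forall>\<alpha>. (\<forall>n. algebraic (\<alpha> n)) \<and> strict_seq \<alpha> \<and> (\<forall>n. \<not> conjugate_over_Q (\<alpha> n) \<kappa>) \<and>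
      (\<lambda>n. weil_height (\<alpha> n)) \<longlonglongrightarrow> 0 \<longrightarrow> (\<lambda>n. log_average cmod \<kappa> (\<alpha> n)) \<longlonglongrightarrow> ?L)"
    using alg unfolding K_inf_def integral_log_dist_circle by blast
  show ?thesis
  proof
    assume \<kappa>: "\<kappa> \<in> K_inf"
    have "cmod.equidistributes \<kappa>"
    proof (rule ccontr)
      assume "\<not> cmod.equidistributes \<kappa>"
      then obtain \<epsilon> where \<epsilon>: "\<epsilon> > 0" "\<And>\<delta> T. \<delta> > 0 \<Longrightarrow> \<exists>x. algebraic x \<and> \<not> conjugate_over_Q x \<kappa> \<and>
          degree (int_min_poly x) > T \<and> weil_height x \<le> \<delta> \<and> \<not> \<bar>log_average cmod \<kappa> x - ?L\<bar> \<le> \<epsilon>"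
        unfolding cmod.equidistributes_iff_numbers[OF alg] by metis
      have "\<forall>n. \<exists>x. algebraic x \<and> \<not> conjugate_over_Q x \<kappa> \<and>
          degree (int_min_poly x) > n \<and> weil_height x \<le> 1 / real (Suc n) \<and> \<not> \<bar>log_average cmod \<kappa> x - ?L\<bar> \<le> \<epsilon>"
        by (intro allI \<epsilon>(2)) simp
      then obtain \<alpha> where \<alpha>: "\<And>n. algebraic (\<alpha> n)" "\<And>n. \<not> conjugate_over_Q (\<alpha> n) \<kappa>"
        "\<And>n. degree (int_min_poly (\<alpha> n)) > n" "\<And>n. weil_height (\<alpha> n) \<le> 1 / real (Suc n)"
        "\<And>n. \<not> \<bar>log_average cmod \<kappa> (\<alpha> n) - ?L\<bar> \<le> \<epsilon>" by metis
      have "strict_seq \<alpha>" unfolding strict_seq_def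
      proof (intro allI impI)
        fix \<beta> :: complex
        have "{n. \<alpha> n = \<beta>} \<subseteq> {..degree (int_min_poly \<beta>)}" using \<alpha>(3) by (auto intro: less_imp_le)
        then show "finite {n. \<alpha> n = \<beta>}" by (rule finite_subset) simp
      qed
      moreover have "(\<lambda>n. weil_height (\<alpha> n)) \<longlonglongrightarrow> 0"
      proof (rule tendsto_sandwich)
        show "\<forall>\<^sub>F n in sequentially. 0 \<le> weil_height (\<alpha> n)" by (intro always_eventually allI weil_height_nonneg \<alpha>(1))
        show "\<forall>\<^sub>F n in sequentially. weil_height (\<alpha> n) \<le> 1 / real (Suc n)" using \<alpha>(4) by simp
        show "(\<lambda>n. 1 / real (Suc n)) \<longlonglongrightarrow> 0" by real_asymp
      qed simp
      ultimately have "(\<lambda>n. log_average cmod \<kappa> (\<alpha> n)) \<longlonglongrightarrow> ?L" using \<kappa> \<alpha>(1,2) unfolding K by blast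
      then have "\<forall>\<^sub>F n in sequentially. dist (log_average cmod \<kappa> (\<alpha> n)) ?L < \<epsilon>" using \<epsilon>(1) by (rule tendstoD)
      then obtain n where "dist (log_average cmod \<kappa> (\<alpha> n)) ?L < \<epsilon>" using eventually_happens'[OF sequentially_bot] by blast
      then show False using \<alpha>(5)[of n] by (simp add: dist_real_def)
    qed
    then show "algebraic \<kappa> \<and> cmod.equidistributes \<kappa>" using alg by simp
  next
    assume "algebraic \<kappa> \<and> cmod.equidistributes \<kappa>"
    then have equi: "cmod.equidistributes \<kappa>" by simp
    show "\<kappa> \<in> K_inf" unfolding K
    proof (intro allI impI)
      fix \<alpha> :: "nat \<Rightarrow> complex"
      assume "(\<forall>n. algebraic (\<alpha> n)) \<and> strict_seq \<alpha> \<and> (\<forall>n. \<not> conjugate_over_Q (\<alpha> n) \<kappa>) \<and>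
        (\<lambda>n. weil_height (\<alpha> n)) \<longlonglongrightarrow> 0"
      then have \<alpha>: "\<And>n. algebraic (\<alpha> n)" "strict_seq \<alpha>" "\<And>n. \<not> conjugate_over_Q (\<alpha> n) \<kappa>"
        "(\<lambda>n. weil_height (\<alpha> n)) \<longlonglongrightarrow> 0" by auto
      show "(\<lambda>n. log_average cmod \<kappa> (\<alpha> n)) \<longlonglongrightarrow> ?L"
      proof (rule tendstoI)
        fix e :: real assume e: "e > 0"
        then obtain \<delta> T where \<delta>: "\<delta> > 0" "\<And>x. algebraic x \<Longrightarrow> \<not> conjugate_over_Q x \<kappa> \<Longrightarrow>
            degree (int_min_poly x) > T \<Longrightarrow> weil_height x \<le> \<delta> \<Longrightarrow> \<bar>log_average cmod \<kappa> x - ?L\<bar> \<le> e / 2"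
          using equi unfolding cmod.equidistributes_iff_numbers[OF alg] by (metis half_gt_zero)
        have ht: "\<forall>\<^sub>F n in sequentially. weil_height (\<alpha> n) < \<delta>" using \<alpha>(4) \<delta>(1) by (rule order_tendstoD)
        define B where "B = {x::complex. algebraic x \<and> degree (int_min_poly x) \<le> T \<and> weil_height x \<le> \<delta>}"
        have "finite B" unfolding B_def by (rule finite_bounded_height_degree)
        moreover have "finite {n. \<alpha> n = \<beta>}" if "\<beta> \<in> B" for \<beta>
          using \<alpha>(2) that by (simp add: strict_seq_def B_def)
        ultimately have "finite (\<Union>\<beta>\<in>B. {n. \<alpha> n = \<beta>})" by blast
        then have "\<forall>\<^sub>F n in sequentially. n \<notin> (\<Union>\<beta>\<in>B. {n. \<alpha> n = \<beta>})"
          unfolding cofinite_eq_sequentially[symmetric] eventually_cofinite not_not Collect_mem_eq .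
        then have "\<forall>\<^sub>F n in sequentially. \<alpha> n \<notin> B" by eventually_elim auto
        then show "\<forall>\<^sub>F n in sequentially. dist (log_average cmod \<kappa> (\<alpha> n)) ?L < e" using ht
        proof eventually_elim
          case (elim n)
          then have "degree (int_min_poly (\<alpha> n)) > T" using \<alpha>(1) by (simp add: B_def)
          then have "\<bar>log_average cmod \<kappa> (\<alpha> n) - ?L\<bar> \<le> e / 2" using \<delta>(2) \<alpha>(1,3) elim(2) by simp
          then show ?case using e by (simp add: dist_real_def)
        qed
      qed
    qed
  qed
qed

theorem K_inf_eq: "K_inf = {0} \<union> roots_of_unity"
  using K_inf_iff complex_equidistributes_iff algebraic_root_of_unity by blast

section \<open>The finite places\<close>

lemma common_denominator:
  fixes f :: "'a \<Rightarrow> rat"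
  assumes "finite X"
  shows "\<exists>N::int. N > 0 \<and> (\<forall>x\<in>X. \<exists>c::int. of_int N * f x = of_int c)"
  using assms
proof (induction X rule: finite_induct)
  case empty
  show ?case by (rule exI[of _ 1]) simp
next
  case (insert x X)
  then obtain N where N: "N > 0" "\<forall>x\<in>X. \<exists>c::int. of_int N * f x = of_int c" by blast
  obtain n d where nd: "quotient_of (f x) = (n, d)" by force
  then have d: "d > 0" "f x = of_int n / of_int d"
    by (simp_all add: quotient_of_denom_pos quotient_of_div)
  have "\<exists>c::int. of_int (N * d) * f y = of_int c" if y: "y \<in> insert x X" for y
  proof (cases "y = x")
    case True
    then have "of_int (N * d) * f y = of_int (N * n)" using d by simp
    then show ?thesis by blast
  next
    case False
    then obtain c :: int where "of_int N * f y = of_int c" using N(2) y by blast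
    then have "of_int (N * d) * f y = of_int (c * d)" by (simp add: mult_ac)
    then show ?thesis by blast
  qed
  then show ?case using N(1) d(1) by (intro exI[of _ "N * d"]) simp
qed

lemma divide_out_gcd:
  fixes c :: "'a \<Rightarrow> int"
  assumes "finite X" "x0 \<in> X" "c x0 \<noteq> 0" "p > 1"
  shows "\<exists>g c'. g \<noteq> 0 \<and> (\<forall>x\<in>X. c x = g * c' x) \<and> (\<exists>x\<in>X. \<not> p dvd c' x)"
proof -
  define g where "g = Gcd (c ` X)"
  have g0: "g \<noteq> 0" using assms(2,3) by (auto simp: g_def Gcd_0_iff)
  have g: "g * (c x div g) = c x" if "x \<in> X" for x
    using that by (simp add: g_def)
  have "\<exists>x\<in>X. \<not> p dvd c x div g"
  proof (rule ccontr)
    assume "\<not> ?thesis"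
    then have "g * p dvd c x" if "x \<in> X" for x using g[OF that] that by (metis dvd_refl mult_dvd_mono)
    then have "g * p dvd g" unfolding g_def[symmetric] by (subst (2) g_def) (auto intro: Gcd_greatest)
    then have "p dvd 1" using g0 by (metis dvd_mult_cancel_left mult.right_neutral)
    then show False using assms(4) by simp
  qed
  then show ?thesis using g0 g by (intro exI[of _ g] exI[of _ "\<lambda>x. c x div g"]) auto
qed

context padic_closure
begin

lemma v_of_int: "v (of_int n) = (if n = 0 then 0 else 1 / real p ^ multiplicity (int p) n)"
proof -
  have "v (of_int n) = padic_abs p (of_int n)" using v_of_rat[of "of_int n"] by simp
  also have "\<dots> = (if n = 0 then 0 else 1 / real p ^ multiplicity (int p) n)"
    by (simp add: padic_abs_def power_int_minus divide_inverse)
  finally show ?thesis .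
qed

lemma p_gt_1: "int p > 1"
  using prime_p prime_gt_1_nat by simp

lemma v_of_int_le_1: "v (of_int n) \<le> 1"
proof -
  have "real p ^ multiplicity (int p) n \<ge> 1" using p_gt_1 by (intro one_le_power) simp
  then show ?thesis by (auto simp: v_of_int divide_le_eq_1)
qed

lemma v_p: "v (of_nat p) = 1 / real p"
proof -
  have "multiplicity (int p) (int p) = 1" using p_gt_1 by (intro multiplicity_self) auto
  then have "v (of_int (int p)) = 1 / real p" unfolding v_of_int using p_gt_1 by simp
  then show ?thesis by simp
qed

lemma v_of_int_dvd: "int p dvd n \<Longrightarrow> v (of_int n) \<le> 1 / real p"
proof -
  assume "int p dvd n"
  then obtain m where "n = int p * m" by (elim dvdE)
  then have "v (of_int n) = v (of_nat p) * v (of_int m)" by (simp add: v_mult)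
  also have "\<dots> \<le> 1 / real p * 1" unfolding v_p by (intro mult_left_mono v_of_int_le_1) auto
  finally show ?thesis by simp
qed

sublocale field_abs_value v
proof
  show "v x \<ge> 0" for x by (rule v_nonneg)
  show "v x = 0 \<longleftrightarrow> x = 0" for x by (rule v_eq_0_iff)
  show "v (x * y) = v x * v y" for x y by (rule v_mult)
  show "v (x + y) \<le> v x + v y" for x y
    using v_ultrametric[of x y] v_nonneg[of x] v_nonneg[of y] by linarith
  show "1 / real_of_int \<bar>n\<bar> \<le> v (of_int n)" if "n \<noteq> 0" for n
  proof -
    have "int p ^ multiplicity (int p) n dvd n" by (rule multiplicity_dvd)
    then have "int p ^ multiplicity (int p) n dvd \<bar>n\<bar>" by simp
    then have "int p ^ multiplicity (int p) n \<le> \<bar>n\<bar>" using that by (intro zdvd_imp_le) auto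
    then have le: "real p ^ multiplicity (int p) n \<le> real_of_int \<bar>n\<bar>"
      by (metis of_int_le_iff of_int_of_nat_eq of_int_power)
    have "real p ^ multiplicity (int p) n > 0" using p_gt_1 by simp
    then show ?thesis using le that by (simp add: v_of_int frac_le)
  qed
qed

lemma sum_le_ultrametric:
  assumes "finite A" "\<And>x. x \<in> A \<Longrightarrow> v (f x) \<le> B" "B \<ge> 0"
  shows "v (\<Sum>x\<in>A. f x) \<le> B"
  using assms
proof (induction A rule: finite_induct)
  case (insert x A)
  have "v (f x) \<le> B" "v (\<Sum>x\<in>A. f x) \<le> B" using insert by auto
  then show ?case using insert.hyps v_ultrametric[of "f x" "\<Sum>x\<in>A. f x"] by simp
qed simp

lemma diff_le_ultrametric: "v x \<le> B \<Longrightarrow> v y \<le> B \<Longrightarrow> v (x - y) \<le> B"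
  using v_ultrametric[of x "- y"] by simp

lemma v_ipoly_root_of_unity: "\<zeta> \<in> roots_of_unity \<Longrightarrow> v (ipoly P \<zeta>) \<le> 1"
proof -
  assume \<zeta>: "\<zeta> \<in> roots_of_unity"
  have "v (\<Sum>i\<le>degree P. of_int (coeff P i) * \<zeta> ^ i) \<le> 1"
    by (rule sum_le_ultrametric) (simp_all add: v_mult root_of_unity_abs[OF \<zeta>] v_of_int_le_1)
  then show ?thesis by (simp add: poly_altdef)
qed

text \<open>
  For elements of the unit ball \<open>O\<close> this is linear independence of their residue classes in \<open>O / p O\<close>
  over the field with \<open>p\<close> elements.
\<close>
definition independent_mod_p :: "'k set \<Rightarrow> bool" where
  "independent_mod_p X \<longleftrightarrow> (\<forall>c::'k \<Rightarrow> int. v (\<Sum>x\<in>X. of_int (c x) * x) \<le> 1 / real p \<longrightarrow> (\<forall>x\<in>X. int p dvd c x))"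

text \<open>
  A rational linear relation can be scaled to have integer coefficients that are not all divisible by
  \<open>p\<close>. So elements that are independent modulo \<open>p\<close> are linearly independent over the rationals.
\<close>
lemma independent_mod_p_card:
  assumes \<kappa>: "algebraic \<kappa>" and X: "finite X" "X \<subseteq> rat_adjoin \<kappa>" "independent_mod_p X"
  shows "card X \<le> degree (int_min_poly \<kappa>)"
proof -
  have "rat_vs.independent X"
  proof (rule rat_vs.independent_if_scalars_zero[OF X(1)], rule ccontr)
    fix f x0 assume sum: "(\<Sum>x\<in>X. of_rat (f x) * x) = 0" and x0: "x0 \<in> X" "f x0 \<noteq> 0"
    obtain N where N: "N > 0" "\<forall>x\<in>X. \<exists>c::int. of_int N * f x = of_int c"
      using common_denominator[OF X(1)] by blast
    then obtain c where c: "\<And>x. x \<in> X \<Longrightarrow> of_int N * f x = of_int (c x :: int)" by metis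
    have "c x0 \<noteq> 0" using c[OF x0(1)] N(1) x0(2) by auto
    then obtain g c' where g: "g \<noteq> 0" "\<And>x. x \<in> X \<Longrightarrow> c x = g * c' x" "\<exists>x\<in>X. \<not> int p dvd c' x"
      using divide_out_gcd[OF X(1) x0(1) _ p_gt_1] by metis
    have "of_int g * (\<Sum>x\<in>X. of_int (c' x) * x) = (\<Sum>x\<in>X. of_int (c x) * x)"
      unfolding sum_distrib_left by (intro sum.cong) (simp_all add: g(2) mult.assoc)
    also have "\<dots> = (\<Sum>x\<in>X. of_int N * (of_rat (f x) * x))"
    proof (rule sum.cong)
      fix x assume "x \<in> X"
      then have "of_rat (of_int N * f x) = (of_rat (of_int (c x)) :: 'k)" using c by simp
      then show "of_int (c x) * x = of_int N * (of_rat (f x) * x)" by (simp add: of_rat_mult mult.assoc[symmetric])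
    qed simp
    also have "\<dots> = 0" using sum by (simp flip: sum_distrib_left)
    finally have "(\<Sum>x\<in>X. of_int (c' x) * x) = 0" using g(1) by simp
    then have "v (\<Sum>x\<in>X. of_int (c' x) * x) \<le> 1 / real p" by simp
    then show False using X(3) g(3) unfolding independent_mod_p_def by blast
  qed
  then have "card X \<le> card ((\<lambda>i. \<kappa> ^ i) ` {..<degree (int_min_poly \<kappa>)})"
    using rat_vs.independent_span_bound[of "(\<lambda>i. \<kappa> ^ i) ` {..<degree (int_min_poly \<kappa>)}" X]
      rat_adjoin_subset_span_powers[OF \<kappa>] X(2) by blast
  also have "\<dots> \<le> degree (int_min_poly \<kappa>)" using card_image_le[of "{..<degree (int_min_poly \<kappa>)}"] by simp
  finally show ?thesis .
qed

text \<open>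
  A maximal set \<open>X\<close> that is independent modulo \<open>p\<close> generates \<open>O / p O\<close>: a relation between \<open>y\<close> and \<open>X\<close>
  has a coefficient at \<open>y\<close> that is invertible modulo \<open>p\<close>. Hence the combinations of \<open>X\<close> with
  coefficients in \<open>{0..<p}\<close> represent all residue classes.
\<close>
lemma finite_residues:
  assumes \<kappa>: "algebraic \<kappa>"
  shows "\<exists>F. finite F \<and> F \<subseteq> rat_adjoin \<kappa> \<and>
    (\<forall>y\<in>rat_adjoin \<kappa>. v y \<le> 1 \<longrightarrow> (\<exists>f\<in>F. v (y - f) \<le> 1 / real p))"
proof -
  define K where "K = rat_adjoin \<kappa>"
  have K: "0 \<in> K" "\<And>x y. x \<in> K \<Longrightarrow> y \<in> K \<Longrightarrow> x + y \<in> K" "\<And>x y. x \<in> K \<Longrightarrow> y \<in> K \<Longrightarrow> x * y \<in> K"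
    using is_subfield_rat_adjoin[of \<kappa>] by (auto simp: K_def is_subfield_def)
  have Kint: "of_int n \<in> K" for n
    using is_subfield_of_rat[OF is_subfield_rat_adjoin[of \<kappa>], of "of_int n"] by (simp add: K_def)
  define good where "good X \<longleftrightarrow> finite X \<and> X \<subseteq> {x \<in> K. v x \<le> 1} \<and> independent_mod_p X" for X
  have "good {}" by (simp add: good_def independent_mod_p_def)
  moreover have "card X \<le> degree (int_min_poly \<kappa>)" if "good X" for X
    using that independent_mod_p_card[OF \<kappa>] by (auto simp: good_def K_def)
  ultimately obtain X where X: "good X" "\<And>Y. good Y \<Longrightarrow> card Y \<le> card X"
    using ex_has_greatest_nat[of good "{}" card "Suc (degree (int_min_poly \<kappa>))"] by (metis le_imp_less_Suc)
  have fin: "finite X" and XO: "\<And>x. x \<in> X \<Longrightarrow> x \<in> K \<and> v x \<le> 1" and ind: "independent_mod_p X"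
    using X(1) by (auto simp: good_def)
  define comb where "comb c = (\<Sum>x\<in>X. of_int (c x) * x)" for c :: "'k \<Rightarrow> int"
  define F where "F = X \<union> comb ` (X \<rightarrow>\<^sub>E {0..<int p})"
  have "finite F" unfolding F_def using fin by (intro finite_UnI finite_imageI finite_PiE) auto
  moreover have "F \<subseteq> K"
  proof -
    have "comb c \<in> K" for c
    proof -
      have "(\<Sum>x\<in>Y. of_int (c x) * x) \<in> K" if "finite Y" "Y \<subseteq> X" for Y
        using that by (induction Y rule: finite_induct) (use K Kint XO in auto)
      then show ?thesis using fin by (simp add: comb_def)
    qed
    then show ?thesis using XO by (auto simp: F_def)
  qed
  moreover have "\<exists>f\<in>F. v (y - f) \<le> 1 / real p" if y: "y \<in> K" "v y \<le> 1" for y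
  proof (cases "y \<in> X")
    case True
    then show ?thesis by (intro bexI[of _ y]) (auto simp: F_def)
  next
    case False
    have "\<not> good (insert y X)" using X(2)[of "insert y X"] False fin by auto
    then have "\<not> independent_mod_p (insert y X)" using fin XO y by (auto simp: good_def)
    then obtain c where c: "v (\<Sum>x\<in>insert y X. of_int (c x) * x) \<le> 1 / real p" "\<exists>x\<in>insert y X. \<not> int p dvd c x"
      unfolding independent_mod_p_def by blast
    define S where "S = of_int (c y) * y + comb c"
    have S: "v S \<le> 1 / real p" using c(1) False fin by (simp add: S_def comb_def)
    have cy: "\<not> int p dvd c y"
    proof
      assume dvd: "int p dvd c y"
      have "v (of_int (c y) * y) \<le> 1 / real p * 1"
        unfolding v_mult using v_of_int_dvd[OF dvd] y(2) v_nonneg by (intro mult_mono) auto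
      then have "v (S - of_int (c y) * y) \<le> 1 / real p" using S by (intro diff_le_ultrametric) simp_all
      then have "v (comb c) \<le> 1 / real p" by (simp add: S_def)
      then have "\<forall>x\<in>X. int p dvd c x" using ind unfolding independent_mod_p_def comb_def by blast
      then show False using c(2) dvd by auto
    qed
    have "coprime (int p) (c y)" using cy prime_p by (simp add: prime_imp_coprime)
    then obtain b q where bq: "b * c y + q * int p = 1"
      by (metis bezout_int coprime_iff_gcd_eq_1 add.commute)
    define e where "e = restrict (\<lambda>x. (- b * c x) mod int p) X"
    have e: "comb e \<in> F" using p_gt_1 by (auto simp: F_def e_def)
    have "v (y - comb e) \<le> 1 / real p"
    proof -
      have "y - comb e = (of_int (q * int p) * y + of_int b * S) + (\<Sum>x\<in>X. of_int ((- b * c x) - e x) * x)"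
      proof -
        have "of_int (b * c y + q * int p) * y = y" unfolding bq by simp
        moreover have "(\<Sum>x\<in>X. of_int ((- b * c x) - e x) * x) = - of_int b * comb c - comb e"
          by (simp add: comb_def sum_distrib_left left_diff_distrib sum_subtractf mult.assoc flip: sum_negf)
        then have "y - comb e = (of_int (b * c y + q * int p) * y) + of_int b * comb c + (\<Sum>x\<in>X. of_int ((- b * c x) - e x) * x)"
          unfolding bq by simp
        ultimately show ?thesis by (simp only: S_def) (simp add: algebra_simps)
      qed
      also have "v \<dots> \<le> max (v (of_int (q * int p) * y + of_int b * S)) (v (\<Sum>x\<in>X. of_int ((- b * c x) - e x) * x))"
        by (rule v_ultrametric)
      also have "\<dots> \<le> 1 / real p"
      proof (rule max.boundedI)
        have "v (of_int (q * int p) * y) \<le> 1 / real p * 1"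
          unfolding v_mult using v_of_int_dvd[of "q * int p"] y(2) v_nonneg by (intro mult_mono) auto
        moreover have "v (of_int b * S) \<le> 1 * (1 / real p)"
          unfolding v_mult using v_of_int_le_1 S v_nonneg by (intro mult_mono) auto
        ultimately show "v (of_int (q * int p) * y + of_int b * S) \<le> 1 / real p"
          using v_ultrametric[of "of_int (q * int p) * y" "of_int b * S"] by simp
        show "v (\<Sum>x\<in>X. of_int ((- b * c x) - e x) * x) \<le> 1 / real p"
        proof (rule sum_le_ultrametric[OF fin])
          fix x assume x: "x \<in> X"
          have "int p dvd (- b * c x) - e x" using x by (simp add: e_def dvd_minus_mod)
          then have "v (of_int ((- b * c x) - e x)) \<le> 1 / real p" by (rule v_of_int_dvd)
          then have "v (of_int ((- b * c x) - e x) * x) \<le> 1 / real p * 1"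
            unfolding v_mult by (rule mult_mono) (use XO[OF x] v_nonneg in auto)
          then show "v (of_int ((- b * c x) - e x) * x) \<le> 1 / real p" by simp
        qed simp
      qed
      finally show ?thesis .
    qed
    then show ?thesis using e by blast
  qed
  ultimately show ?thesis unfolding K_def by blast
qed

text \<open>
  Here \<open>K\<close> is the number field generated by \<open>\<kappa>\<close>, and balls of radius \<open>\<bar>p\<bar>\<close> are residue classes modulo
  \<open>p\<close>.
\<close>
lemma padic_equidistributes_iff:
  assumes \<kappa>: "algebraic \<kappa>"
  shows "equidistributes \<kappa> \<longleftrightarrow> \<kappa> \<in> {0} \<union> roots_of_unity"
proof -
  obtain F where F: "finite F" "F \<subseteq> rat_adjoin \<kappa>"
    "\<And>y. y \<in> rat_adjoin \<kappa> \<Longrightarrow> v y \<le> 1 \<Longrightarrow> \<exists>f\<in>F. v (y - f) \<le> 1 / real p"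
    using finite_residues[OF \<kappa>] by blast
  have tK: "of_nat p \<in> rat_adjoin \<kappa>"
    using is_subfield_of_rat[OF is_subfield_rat_adjoin[of \<kappa>], of "of_nat p"] by simp
  have t: "(of_nat p :: 'k) \<noteq> 0" "v (of_nat p) < 1" using p_gt_1 by (auto simp: v_p)
  have upper: "\<exists>\<delta>>0. \<exists>T. \<forall>P \<zeta>. low_height \<delta> T P \<longrightarrow> \<zeta> \<in> roots_of_unity \<longrightarrow>
      v (ipoly P \<zeta>) \<le> exp (\<epsilon> * real (degree P))" if "\<epsilon> > 0" for \<epsilon>
  proof -
    have "v (ipoly P \<zeta>) \<le> exp (\<epsilon> * real (degree P))" if "\<zeta> \<in> roots_of_unity" for P \<zeta>
      using v_ipoly_root_of_unity[OF that, of P] \<open>\<epsilon> > 0\<close> by (auto intro: order_trans)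
    then show ?thesis by (intro exI[of _ 1] conjI exI[of _ 0]) auto
  qed
  show ?thesis
    by (rule equidistributes_iff[OF \<kappa> upper is_subfield_rat_adjoin generator_in_rat_adjoin tK t F(1,2)])
      (use F(3) in \<open>simp_all add: v_p\<close>)
qed

text \<open>
  The sets of numbers of degree above \<open>T\<close> and height at most \<open>\<delta>\<close> form a basis of the filter, since
  heights are nonnegative.
\<close>
lemma K_fin_iff: "\<kappa> \<in> K_fin v \<longleftrightarrow> algebraic \<kappa> \<and> equidistributes \<kappa>"
proof (cases "algebraic \<kappa>")
  case False
  then show ?thesis by (simp add: K_fin_def)
next
  case alg: True
  let ?L = "ln (max 1 (v \<kappa>))"
  let ?G = "inf (filtercomap weil_height (nhds 0)) (inf (filtercomap rat_adjoin_degree at_top)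
          (principal {\<alpha>::'k. algebraic \<alpha> \<and> \<not> conjugate_over_Q \<alpha> \<kappa>}))"
  have ev: "eventually P ?G \<longleftrightarrow> (\<exists>\<delta>>0. \<exists>T. \<forall>x. algebraic x \<longrightarrow> \<not> conjugate_over_Q x \<kappa> \<longrightarrow>
      degree (int_min_poly x) > T \<longrightarrow> weil_height x \<le> \<delta> \<longrightarrow> P x)" for P
  proof
    assume "eventually P ?G"
    then obtain A B where A: "eventually A (nhds 0)" and B: "eventually B at_top"
      and AB: "\<And>x. A (weil_height x) \<Longrightarrow> B (rat_adjoin_degree x) \<Longrightarrow> algebraic x \<Longrightarrow> \<not> conjugate_over_Q x \<kappa> \<Longrightarrow> P x"
      unfolding eventually_inf eventually_filtercomap eventually_principal by auto
    obtain d where d: "d > 0" "\<And>y. dist y 0 < d \<Longrightarrow> A y" using A unfolding eventually_nhds_metric by blast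
    obtain T where T: "\<And>n. n \<ge> T \<Longrightarrow> B n" using B unfolding eventually_at_top_linorder by blast
    have "P x" if "algebraic x" "\<not> conjugate_over_Q x \<kappa>" "degree (int_min_poly x) > T" "weil_height x \<le> d / 2" for x
      using that d weil_height_nonneg[OF that(1)] T
      by (intro AB) (auto simp: dist_real_def rat_adjoin_degree_eq)
    then show "\<exists>\<delta>>0. \<exists>T. \<forall>x. algebraic x \<longrightarrow> \<not> conjugate_over_Q x \<kappa> \<longrightarrow>
      degree (int_min_poly x) > T \<longrightarrow> weil_height x \<le> \<delta> \<longrightarrow> P x"
      using d(1) by (intro exI[of _ "d / 2"] conjI exI[of _ T]) auto
  next
    assume "\<exists>\<delta>>0. \<exists>T. \<forall>x. algebraic x \<longrightarrow> \<not> conjugate_over_Q x \<kappa> \<longrightarrow>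
      degree (int_min_poly x) > T \<longrightarrow> weil_height x \<le> \<delta> \<longrightarrow> P x"
    then obtain \<delta> T where \<delta>: "\<delta> > 0" and P: "\<And>x. algebraic x \<Longrightarrow> \<not> conjugate_over_Q x \<kappa> \<Longrightarrow>
      degree (int_min_poly x) > T \<Longrightarrow> weil_height x \<le> \<delta> \<Longrightarrow> P x" by blast
    have "eventually (\<lambda>y. y < \<delta>) (nhds 0)" unfolding eventually_nhds_metric
      using \<delta> by (intro exI[of _ \<delta>]) (auto simp: dist_real_def)
    then have E1: "\<forall>\<^sub>F x::'k in filtercomap weil_height (nhds 0). weil_height x < \<delta>"
      by (rule eventually_filtercomapI)
    have E2: "\<forall>\<^sub>F x::'k in filtercomap rat_adjoin_degree at_top. rat_adjoin_degree x > T"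
      by (intro eventually_filtercomapI[of "\<lambda>n. n > T"] eventually_gt_at_top)
    have E3: "\<forall>\<^sub>F x in principal {\<alpha>::'k. algebraic \<alpha> \<and> \<not> conjugate_over_Q \<alpha> \<kappa>}. algebraic x \<and> \<not> conjugate_over_Q x \<kappa>"
      by (simp add: eventually_principal)
    have E23: "\<forall>\<^sub>F x in inf (filtercomap rat_adjoin_degree at_top)
          (principal {\<alpha>::'k. algebraic \<alpha> \<and> \<not> conjugate_over_Q \<alpha> \<kappa>}).
        rat_adjoin_degree x > T \<and> algebraic x \<and> \<not> conjugate_over_Q x \<kappa>"
      unfolding eventually_inf by (intro exI conjI, rule E2, rule E3) blast
    have "\<forall>\<^sub>F x in ?G. weil_height x < \<delta> \<and> rat_adjoin_degree x > T \<and> algebraic x \<and> \<not> conjugate_over_Q x \<kappa>"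
      unfolding eventually_inf[of _ "filtercomap weil_height (nhds 0)"]
      by (intro exI conjI, rule E1, rule E23) blast
    then show "eventually P ?G"
    proof (rule eventually_mono)
      fix x assume "weil_height x < \<delta> \<and> rat_adjoin_degree x > T \<and> algebraic x \<and> \<not> conjugate_over_Q x \<kappa>"
      then show "P x" using P[of x] rat_adjoin_degree_eq[of x] by simp
    qed
  qed
  have "\<kappa> \<in> K_fin v \<longleftrightarrow> (\<forall>\<epsilon>>0. eventually (\<lambda>x. dist (log_average v \<kappa> x) ?L < \<epsilon>) ?G)"
    using alg by (simp add: K_fin_def tendsto_iff)
  also have "\<dots> \<longleftrightarrow> (\<forall>\<epsilon>>0. eventually (\<lambda>x. \<bar>log_average v \<kappa> x - ?L\<bar> \<le> \<epsilon>) ?G)"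
  proof (intro iffI allI impI)
    fix \<epsilon> :: real assume "\<forall>\<epsilon>>0. eventually (\<lambda>x. dist (log_average v \<kappa> x) ?L < \<epsilon>) ?G" "\<epsilon> > 0"
    then have "eventually (\<lambda>x. dist (log_average v \<kappa> x) ?L < \<epsilon>) ?G" by blast
    then show "eventually (\<lambda>x. \<bar>log_average v \<kappa> x - ?L\<bar> \<le> \<epsilon>) ?G"
      by (rule eventually_mono) (simp add: dist_real_def)
  next
    fix \<epsilon> :: real assume all: "\<forall>\<epsilon>>0. eventually (\<lambda>x. \<bar>log_average v \<kappa> x - ?L\<bar> \<le> \<epsilon>) ?G" and \<epsilon>: "\<epsilon> > 0"
    have "eventually (\<lambda>x. \<bar>log_average v \<kappa> x - ?L\<bar> \<le> \<epsilon> / 2) ?G" using all half_gt_zero[OF \<epsilon>] by blast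
    then show "eventually (\<lambda>x. dist (log_average v \<kappa> x) ?L < \<epsilon>) ?G"
      by (rule eventually_mono) (use \<epsilon> in \<open>simp add: dist_real_def\<close>)
  qed
  also have "\<dots> \<longleftrightarrow> equidistributes \<kappa>" unfolding ev equidistributes_iff_numbers[OF alg] ..
  finally show ?thesis using alg by simp
qed

theorem K_fin_eq: "K_fin v = {0} \<union> roots_of_unity"
  using K_fin_iff padic_equidistributes_iff algebraic_root_of_unity by blast

end

theorem proposition4:
  shows "K_inf = {0} \<union> roots_of_unity \<and>
    (\<forall>p. prime p \<longrightarrow>
      (\<forall>(Qp :: 'k::{alg_closed_field, field_char_0} set) v.
        padic_closure p Qp v \<longrightarrow> K_fin v = {0} \<union> roots_of_unity))"
  using K_inf_eq padic_closure.K_fin_eq by blast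

end
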